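(* Let $f:\overline{\mathbb{C}}\to\overline{\mathbb{C}}$ be a rational map of degree at least $2$ having an exponentially mixing invariant probability measure $\nu$ that is absolutely continuous with respect to some conformal measure $\mu$ of $f$, in such a way that the density of $\nu$ with respect to $\mu$ is $\mu$-almost everywhere bounded from below by a positive constant. Then $f$ satisfies the Topological Collet-Eckmann condition.
   Context: Distances, balls, diameters and derivatives on the Riemann sphere $\overline{\mathbb{C}}$ are taken with respect to the spherical metric; $J(f)$ is the Julia set of $f$. Topological Collet-Eckmann (TCE) condition, in its equivalent form of Exponential Shrinking of Components: there exist $\lambda_{\mathrm{Exp}}>1$ and $r_0>0$ such that for every $x\in J(f)$, every integer $n\ge 1$ and every connected component $W$ of $f^{-n}(B(x,r_0))$ we have $\mathrm{diam}(W)\le\lambda_{\mathrm{Exp}}^{-n}$. Conformal measure: a non-zero finite Borel measure $\mu$ on $\overline{\mathbb{C}}$ such that, for some $t>0$ (its exponent), for every Borel subset $U$ of $\overline{\mathbb{C}}$ on which $f$ is injective, $\mu(f(U))=\int_U|f'|^t\,d\mu$. Exponentially mixing: there are constants $C>0$ and $\rho\in(0,1)$ such that for every bounded measurable function $\varphi:\overline{\mathbb{C}}\to\mathbb{R}$, every Lipschitz continuous function $\psi:\overline{\mathbb{C}}\to\mathbb{R}$ and every integer $n\ge1$, $$\left|\int(\varphi\circ f^n)\cdot\psi\,d\nu-\int\varphi\,d\nu\int\psi\,d\nu\right|\le C\Big(\sup_{z\in J(f)}|\varphi(z)|\Big)\|\psi\|_{\mathrm{Lip}}\,\rho^n,$$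 where $\|\psi\|_{\mathrm{Lip}}=\sup_{z\in J(f)}|\psi(z)|+\sup_{z,z'\in J(f),\,z\ne z'}\frac{|\psi(z)-\psi(z')|}{\mathrm{dist}(z,z')}$. *)

theory Defs
  imports
    "HOL-Complex_Analysis.Complex_Analysis"
    "HOL-Computational_Algebra.Computational_Algebra"
    "HOL-Probability.Probability_Measure"
begin

section \<open>The Riemann sphere\<close>

datatype riemann_sphere = Plane complex | Infty

primrec stereo :: "riemann_sphere \<Rightarrow> complex \<times> real" where
  "stereo (Plane z) =
     ((2 / (1 + (cmod z)\<^sup>2)) *\<^sub>R z, ((cmod z)\<^sup>2 - 1) / ((cmod z)\<^sup>2 + 1))"
| "stereo Infty = (0, 1)"

lemma inner_stereo_same [simp]: "stereo p \<bullet> stereo p = 1"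
proof (cases p)
  case (Plane z)
  define s where "s = (cmod z)\<^sup>2"
  have s: "s \<ge> 0" "z \<bullet> z = s" by (auto simp: s_def dot_square_norm)
  have "stereo p \<bullet> stereo p = (2 / (1 + s))\<^sup>2 * s + ((s - 1) / (s + 1))\<^sup>2"
    unfolding Plane stereo.simps s_def[symmetric]
    by (simp add: s power2_eq_square)
  also have "\<dots> = (4 * s + (s - 1)\<^sup>2) / (s + 1)\<^sup>2"
    by (simp add: power_divide add.commute add_divide_distrib)
  also have "4 * s + (s - 1)\<^sup>2 = (s + 1)\<^sup>2"
    by (simp add: power2_eq_square algebra_simps)
  finally show ?thesis using s by simp
qed simp

lemma norm_stereo [simp]: "norm (stereo p) = 1"
  by (simp add: norm_eq_sqrt_inner)

lemma inj_stereo: "inj stereo"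
proof (rule injI)
  have 1: "(cmod z)\<^sup>2 - 1 \<noteq> (cmod z)\<^sup>2 + 1" "(cmod z)\<^sup>2 + 1 \<noteq> 0" for z
    by (simp, smt (verit) zero_le_power2)
  fix p q assume eq: "stereo p = stereo q"
  show "p = q"
  proof (cases p; cases q)
    fix z w assume p: "p = Plane z" and q: "q = Plane w"
    have "((cmod z)\<^sup>2 - 1) / ((cmod z)\<^sup>2 + 1) = ((cmod w)\<^sup>2 - 1) / ((cmod w)\<^sup>2 + 1)"
      using eq p q by simp
    then have "(cmod z)\<^sup>2 = (cmod w)\<^sup>2"
      using 1[of z] 1[of w] by (simp add: field_simps)
    moreover have "(2 / (1 + (cmod z)\<^sup>2)) *\<^sub>R z = (2 / (1 + (cmod w)\<^sup>2)) *\<^sub>R w"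
      using eq p q by simp
    ultimately show "p = q" using p q 1(2)[of w] by (simp add: add.commute)
  next
    fix z assume "p = Plane z" "q = Infty"
    then show "p = q" using eq 1[of z] by (simp add: field_simps)
  next
    fix z assume "p = Infty" "q = Plane z"
    then show "p = q" using eq 1[of z] by (simp add: field_simps)
  qed simp
qed

lemma arccos_inner_triangle:
  fixes u v w :: "'a :: real_inner"
  assumes "norm u = 1" "norm v = 1" "norm w = 1"
  shows "arccos (u \<bullet> w) \<le> arccos (u \<bullet> v) + arccos (v \<bullet> w)"
proof -
  have bnd: "\<bar>x \<bullet> y\<bar> \<le> 1" if "norm x = 1" "norm y = 1" for x y :: 'a
    using Cauchy_Schwarz_ineq2[of x y] that by simp
  define a b where "a = u \<bullet> v" and "b = v \<bullet> w"
  have a: "\<bar>a\<bar> \<le> 1" and b: "\<bar>b\<bar> \<le> 1" and c: "\<bar>u \<bullet> w\<bar> \<le> 1"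
    using bnd assms by (auto simp: a_def b_def)
  have un: "u \<bullet> u = 1" "v \<bullet> v = 1" "w \<bullet> w = 1"
    using assms by (auto simp: dot_square_norm)
  show ?thesis
  proof (cases "arccos a + arccos b \<le> pi")
    case True
    have na: "norm (u - a *\<^sub>R v) = sqrt (1 - a\<^sup>2)"
      by (simp add: norm_eq_sqrt_inner inner_diff_left inner_diff_right un power2_eq_square
          inner_commute[of v u] flip: a_def)
    have nb: "norm (w - b *\<^sub>R v) = sqrt (1 - b\<^sup>2)"
      by (simp add: norm_eq_sqrt_inner inner_diff_left inner_diff_right un power2_eq_square
          inner_commute[of w v] flip: b_def)
    have "u \<bullet> w - a * b = (u - a *\<^sub>R v) \<bullet> (w - b *\<^sub>R v)"
      by (simp add: inner_diff_left inner_diff_right un flip: a_def b_def)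
    moreover have "\<bar>(u - a *\<^sub>R v) \<bullet> (w - b *\<^sub>R v)\<bar> \<le> sqrt (1 - a\<^sup>2) * sqrt (1 - b\<^sup>2)"
      using Cauchy_Schwarz_ineq2[of "u - a *\<^sub>R v" "w - b *\<^sub>R v"] na nb by simp
    ultimately have "a * b - sqrt (1 - a\<^sup>2) * sqrt (1 - b\<^sup>2) \<le> u \<bullet> w"
      by linarith
    moreover have "cos (arccos a + arccos b) = a * b - sqrt (1 - a\<^sup>2) * sqrt (1 - b\<^sup>2)"
      using a b by (simp add: cos_add sin_arccos_abs cos_arccos_abs)
    ultimately have "cos (arccos a + arccos b) \<le> cos (arccos (u \<bullet> w))"
      using c by (simp add: cos_arccos_abs)
    moreover have "0 \<le> arccos a + arccos b"
      using a b by (simp add: arccos_lbound abs_le_iff)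
    moreover have "0 \<le> arccos (u \<bullet> w)" "arccos (u \<bullet> w) \<le> pi"
      using c by (simp_all add: arccos_lbound arccos_ubound abs_le_iff)
    ultimately show ?thesis
      using True cos_mono_le_eq[of "arccos a + arccos b" "arccos (u \<bullet> w)"]
      by (simp add: a_def b_def)
  next
    case False
    moreover have "arccos (u \<bullet> w) \<le> pi"
      using c by (simp add: arccos_ubound abs_le_iff)
    ultimately show ?thesis by (simp add: a_def b_def)
  qed
qed

text \<open>
  The spherical metric is the great-circle distance on the unit sphere, i.e. the length distance
  of the Riemannian metric \<open>2 |dz| / (1 + |z|\<^sup>2)\<close>.
\<close>

instantiation riemann_sphere :: metric_space
begin

definition dist_riemann_sphere :: "riemann_sphere \<Rightarrow> riemann_sphere \<Rightarrow> real" where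
  "dist p q = arccos (stereo p \<bullet> stereo q)"

definition uniformity_riemann_sphere :: "(riemann_sphere \<times> riemann_sphere) filter" where
  "uniformity_riemann_sphere = (INF e\<in>{0<..}. principal {(x, y). dist x y < e})"

definition open_riemann_sphere :: "riemann_sphere set \<Rightarrow> bool" where
  "open_riemann_sphere U \<longleftrightarrow>
     (\<forall>x\<in>U. eventually (\<lambda>(x', y). x' = x \<longrightarrow> y \<in> U) uniformity)"

instance
proof
  fix p q r :: riemann_sphere
  have bnd: "\<bar>stereo p \<bullet> stereo q\<bar> \<le> 1"
    using Cauchy_Schwarz_ineq2[of "stereo p" "stereo q"] by simp
  show "dist p q = 0 \<longleftrightarrow> p = q"
  proof
    assume "dist p q = 0"
    then have "stereo p \<bullet> stereo q = 1"
      using cos_arccos_abs[OF bnd] by (simp add: dist_riemann_sphere_def)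
    then have "(norm (stereo p - stereo q))\<^sup>2 = 0"
      by (simp add: power2_norm_eq_inner inner_diff_left inner_diff_right
          inner_commute[of "stereo q" "stereo p"])
    then show "p = q" using inj_stereo by (simp add: inj_eq)
  qed (simp add: dist_riemann_sphere_def)
  show "dist p q \<le> dist p r + dist q r"
    using arccos_inner_triangle[of "stereo p" "stereo r" "stereo q"]
    by (simp add: dist_riemann_sphere_def inner_commute[of "stereo q" "stereo r"])
qed (simp_all add: uniformity_riemann_sphere_def open_riemann_sphere_def)

end

definition sphere_inversion :: "riemann_sphere \<Rightarrow> riemann_sphere" where
  "sphere_inversion p =
     (case p of Plane z \<Rightarrow> if z = 0 then Infty else Plane (1 / z) | Infty \<Rightarrow> Plane 0)"

lemma stereo_inversion:
  "stereo (sphere_inversion p) = (cnj (fst (stereo p)), - snd (stereo p))"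
proof (cases p)
  case (Plane z)
  show ?thesis
  proof (cases "z = 0")
    case False
    define s where "s = (cmod z)\<^sup>2"
    have s: "s > 0" using False by (simp add: s_def)
    have zz: "z * cnj z = complex_of_real s"
      using complex_norm_square[of z] by (simp add: s_def)
    have "1 / z = cnj z / complex_of_real s"
      using False zz s by (simp add: field_simps)
    then have inv: "1 / z = (1 / s) *\<^sub>R cnj z"
      by (simp add: scaleR_conv_of_real)
    have n: "(cmod (1 / z))\<^sup>2 = 1 / s"
      by (simp add: norm_divide power_divide s_def)
    have c: "2 / (1 + 1 / s) * (1 / s) = 2 / (1 + s)"
      using s by (simp add: field_simps)
    have d: "(1 / s - 1) / (1 / s + 1) = - ((s - 1) / (s + 1))"
    proof -
      have "1 / s - 1 = (1 - s) / s" "1 / s + 1 = (s + 1) / s"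
        using s by (simp_all add: field_simps)
      then show ?thesis using s by (simp add: minus_divide_left)
    qed
    have "stereo (sphere_inversion p) =
        ((2 / (1 + 1 / s)) *\<^sub>R ((1 / s) *\<^sub>R cnj z), (1 / s - 1) / (1 / s + 1))"
      using False by (simp only: Plane sphere_inversion_def riemann_sphere.case if_False stereo.simps n)
        (simp only: inv)
    also have "\<dots> = ((2 / (1 + s)) *\<^sub>R cnj z, - ((s - 1) / (s + 1)))"
      by (simp only: scaleR_scaleR c d)
    finally show ?thesis by (simp add: Plane s_def)
  qed (simp add: Plane sphere_inversion_def)
qed (simp add: sphere_inversion_def)

lemma dist_inversion: "dist (sphere_inversion p) (sphere_inversion q) = dist p q"
  by (simp add: dist_riemann_sphere_def stereo_inversion inner_prod_def inner_complex_def)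

section \<open>Rational maps\<close>

definition rational_map :: "complex poly \<Rightarrow> complex poly \<Rightarrow> riemann_sphere \<Rightarrow> riemann_sphere" where
  "rational_map P Q p =
     (case p of
        Plane z \<Rightarrow> if poly Q z = 0 then Infty else Plane (poly P z / poly Q z)
      | Infty \<Rightarrow>
          (let d = max (degree P) (degree Q) in
           if coeff Q d = 0 then Infty else Plane (coeff P d / coeff Q d)))"

definition rational_map_of_degree :: "nat \<Rightarrow> (riemann_sphere \<Rightarrow> riemann_sphere) \<Rightarrow> bool" where
  "rational_map_of_degree d f \<longleftrightarrow>
     (\<exists>P Q. coprime P Q \<and> max (degree P) (degree Q) = d \<and> f = rational_map P Q)"

text \<open>
  The local coordinate at \<open>p\<close> is \<open>z\<close> if \<open>p\<close> is finite and \<open>1 / z\<close> at infinity. The value \<open>0\<close> given to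
  the point outside the coordinate domain is irrelevant, since only germs at \<open>p\<close> are used below.
\<close>

primrec affine_coord :: "riemann_sphere \<Rightarrow> complex" where
  "affine_coord (Plane z) = z"
| "affine_coord Infty = 0"

definition chart :: "riemann_sphere \<Rightarrow> riemann_sphere \<Rightarrow> complex" where
  "chart p = (if p = Infty then affine_coord \<circ> sphere_inversion else affine_coord)"

definition chart_inv :: "riemann_sphere \<Rightarrow> complex \<Rightarrow> riemann_sphere" where
  "chart_inv p = (if p = Infty then sphere_inversion \<circ> Plane else Plane)"

text \<open>
  The norm \<open>|f'(p)|\<close> of the derivative with respect to the spherical metric. As inversion is an
  isometry (lemma \<open>dist_inversion\<close>), the metric is \<open>2 |dz| / (1 + |z|\<^sup>2)\<close> in both coordinates.
\<close>

definition spherical_deriv :: "(riemann_sphere \<Rightarrow> riemann_sphere) \<Rightarrow> riemann_sphere \<Rightarrow> real" where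
  "spherical_deriv f p =
     cmod (deriv (chart (f p) \<circ> f \<circ> chart_inv p) (chart p p))
       * (1 + (cmod (chart p p))\<^sup>2) / (1 + (cmod (chart (f p) (f p)))\<^sup>2)"

section \<open>Julia set and the Topological Collet-Eckmann condition\<close>

definition normal_family_on ::
  "(riemann_sphere \<Rightarrow> riemann_sphere) set \<Rightarrow> riemann_sphere set \<Rightarrow> bool" where
  "normal_family_on F U \<longleftrightarrow>
     (\<forall>g. (\<forall>n::nat. g n \<in> F) \<longrightarrow>
        (\<exists>r l. strict_mono (r :: nat \<Rightarrow> nat) \<and>
           (\<forall>K. compact K \<and> K \<subseteq> U \<longrightarrow> uniform_limit K (g \<circ> r) l sequentially)))"

definition fatou_set :: "(riemann_sphere \<Rightarrow> riemann_sphere) \<Rightarrow> riemann_sphere set" where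
  "fatou_set f = {p. \<exists>U. open U \<and> p \<in> U \<and> normal_family_on (range (\<lambda>n. f ^^ n)) U}"

definition julia_set :: "(riemann_sphere \<Rightarrow> riemann_sphere) \<Rightarrow> riemann_sphere set" where
  "julia_set f = - fatou_set f"

definition topological_collet_eckmann :: "(riemann_sphere \<Rightarrow> riemann_sphere) \<Rightarrow> bool" where
  "topological_collet_eckmann f \<longleftrightarrow>
     (\<exists>\<theta>>1. \<exists>r\<^sub>0>0. \<forall>x\<in>julia_set f. \<forall>n\<ge>1.
        \<forall>W\<in>components ((f ^^ n) -` ball x r\<^sub>0). diameter W \<le> \<theta> powi (- int n))"

section \<open>Measures\<close>

definition conformal_measure ::
  "(riemann_sphere \<Rightarrow> riemann_sphere) \<Rightarrow> riemann_sphere measure \<Rightarrow> bool" where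
  "conformal_measure f \<mu> \<longleftrightarrow>
     sets \<mu> = sets borel \<and> finite_measure \<mu> \<and> emeasure \<mu> (space \<mu>) \<noteq> 0 \<and>
     (\<exists>t>0. \<forall>U\<in>sets borel. inj_on f U \<longrightarrow>
        emeasure \<mu> (f ` U) = (\<integral>\<^sup>+x\<in>U. ennreal (spherical_deriv f x powr t) \<partial>\<mu>))"

definition invariant_probability ::
  "(riemann_sphere \<Rightarrow> riemann_sphere) \<Rightarrow> riemann_sphere measure \<Rightarrow> bool" where
  "invariant_probability f \<nu> \<longleftrightarrow>
     sets \<nu> = sets borel \<and> prob_space \<nu> \<and> f \<in> measurable \<nu> \<nu> \<and> distr \<nu> \<nu> f = \<nu>"

definition lip_norm ::
  "(riemann_sphere \<Rightarrow> riemann_sphere) \<Rightarrow> (riemann_sphere \<Rightarrow> real) \<Rightarrow> real" where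
  "lip_norm f \<psi> =
     (SUP z\<in>julia_set f. \<bar>\<psi> z\<bar>) +
     (SUP (z, z')\<in>{(z, z'). z \<in> julia_set f \<and> z' \<in> julia_set f \<and> z \<noteq> z'}.
        \<bar>\<psi> z - \<psi> z'\<bar> / dist z z')"

definition exponentially_mixing ::
  "(riemann_sphere \<Rightarrow> riemann_sphere) \<Rightarrow> riemann_sphere measure \<Rightarrow> bool" where
  "exponentially_mixing f \<nu> \<longleftrightarrow>
     (\<exists>C>0. \<exists>\<rho>. 0 < \<rho> \<and> \<rho> < 1 \<and>
       (\<forall>\<phi> \<psi> n. \<phi> \<in> borel_measurable borel \<and> bounded (range \<phi>) \<and>
            (\<exists>L. L-lipschitz_on UNIV \<psi>) \<and> n \<ge> 1 \<longrightarrow>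
          \<bar>(\<integral>x. \<phi> ((f ^^ n) x) * \<psi> x \<partial>\<nu>) - (\<integral>x. \<phi> x \<partial>\<nu>) * (\<integral>x. \<psi> x \<partial>\<nu>)\<bar>
            \<le> C * (SUP z\<in>julia_set f. \<bar>\<phi> z\<bar>) * lip_norm f \<psi> * \<rho> ^ n))"

end

theory Submission imports Defs begin

text \<open>
  Let \<open>X\<close> be the support of \<open>\<mu>\<close>. Mixing, tested on a bump function near \<open>u\<close> and on the complement of
  a ball containing \<open>f\<^sup>n(B(u, 2\<delta>))\<close>, shows that \<open>\<nu>(B(u, \<delta>))\<close> is at most of order \<open>\<rho>\<^sup>n / \<delta>\<close>; with Cauchy's
  estimate for the derivative, conformality gives \<open>\<mu>(f\<^sup>n(B(u, \<delta>))) \<le> C \<rho>\<^sup>n \<delta>\<^sup>-\<^sup>t\<^sup>-\<^sup>1\<close>. If \<open>u\<close> lies in \<open>X\<close>, some image of a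
  comparable scale contains a ball of definite size, so \<open>\<delta> \<le> C \<kappa>\<^sup>n\<close> with \<open>\<kappa> = \<rho>\<^sup>1\<^sup>/\<^sup>(\<^sup>t\<^sup>+\<^sup>1\<^sup>)\<close> whenever \<open>f\<^sup>j(B(u, \<delta>))\<close> stays
  small for \<open>j \<le> n\<close>.

  Let \<open>W\<close> be a component of the preimage under \<open>f\<^sup>n\<close> of a small disc centred in \<open>X\<close> and suppose that
  \<open>W\<close> and its images are small. Then \<open>W\<close> is simply connected, the degree \<open>D\<close> of \<open>f\<^sup>n\<close> on \<open>W\<close> grows at most
  like a small exponential because critical points in \<open>X\<close> are not periodic, and
  the preimages in \<open>W\<close> of a point of \<open>X\<close> are exponentially close to the boundary of \<open>W\<close>. Uniformizing \<open>W\<close>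
  turns \<open>f\<^sup>n\<close> into a Blaschke product of degree \<open>D\<close>, and a growth estimate for univalent functions shows that
  every point over the half disc is within a polynomial in \<open>D\<close> times that distance of such a preimage. Hence
  the pullback of the half disc is exponentially small. Halving the radius every \<open>l\<close> steps keeps all
  pullbacks small up to a time at which they fit into the current disc around another point of \<open>X\<close>; from then on
  the radius needs no further shrinking. Finally \<open>J(f) \<subseteq> X\<close>: the iterates on an open null set
  omit all points of \<open>X\<close>, and are normal by Schottky's theorem.
\<close>

section \<open>Coordinates on the sphere\<close>

text \<open>The difficulty is circular. A pullback \<open>W\<close> can be compared with a disc by a
  Riemann map, and the degree on it can be bounded, only once \<open>W\<close> and its forward
  images are known to be small, while smallness is what has to be proved. Neither expansion nor
  bounded distortion is available, as critical points may lie in \<open>X\<close>. What mixing does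
  control is a ball centred in \<open>X\<close> and contained in \<open>W\<close>: its radius is
  exponentially small. This bounds a distance to the boundary of \<open>W\<close>, not a diameter.
  The passage from the one to the other loses only a power of the degree, which is affordable
  because the degree grows like an arbitrarily small exponential. All complex analysis is carried
  out in the two charts \<open>crd True\<close> and \<open>crd False\<close>; radii are kept so
  small that every set in question fits into the disc of radius 3 of one chart, where distances are
  distorted by bounded factors.\<close>

definition chord :: "riemann_sphere \<Rightarrow> riemann_sphere \<Rightarrow> real" where
  "chord p q = norm (stereo p - stereo q)"

lemma chord_sq: "(chord p q)\<^sup>2 = 2 - 2 * (stereo p \<bullet> stereo q)"
  by (simp add: chord_def power2_norm_eq_inner inner_diff_left inner_diff_right
      inner_commute[of "stereo q" "stereo p"])

lemma abs_inner_stereo: "\<bar>stereo p \<bullet> stereo q\<bar> \<le> 1"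
  using Cauchy_Schwarz_ineq2[of "stereo p" "stereo q"] by simp

lemma chord_eq_sin: "chord p q = 2 * sin (dist p q / 2)"
proof -
  let ?d = "dist p q"
  have c: "cos ?d = stereo p \<bullet> stereo q"
    by (simp add: dist_riemann_sphere_def cos_arccos_abs abs_inner_stereo)
  have d: "0 \<le> ?d" "?d \<le> pi"
    using abs_inner_stereo[of p q] by (simp_all add: dist_riemann_sphere_def arccos_ubound arccos_lbound abs_le_iff)
  have "cos ?d = 1 - 2 * (sin (?d/2))\<^sup>2"
    using cos_double_sin[of "?d/2"] by simp
  then have "(chord p q)\<^sup>2 = (2 * sin (?d/2))\<^sup>2"
    using c chord_sq[of p q] by (simp add: power2_eq_square)
  moreover have "0 \<le> sin (?d/2)" using d pi_gt_zero by (intro sin_ge_zero; linarith)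
  ultimately show ?thesis
    using power2_eq_iff_nonneg[of "chord p q" "2 * sin (?d/2)"] by (simp add: chord_def)
qed

lemma dist_le_pi: "dist p (q::riemann_sphere) \<le> pi"
  using abs_inner_stereo[of p q] by (simp add: dist_riemann_sphere_def arccos_ubound abs_le_iff)

lemma chord_le_dist: "chord p q \<le> dist p q"
  using sin_x_le_x[of "dist p q / 2"] by (simp add: chord_eq_sin)

lemma half_le_sin:
  fixes x :: real
  assumes "0 \<le> x" "x \<le> pi / 2"
  shows "x / 2 \<le> sin x"
proof (cases "x = 0")
  case False
  define h where "h = x / 2"
  have h: "0 < h" "h \<le> pi / 4" using assms False by (auto simp: h_def)
  have c: "cos h \<ge> cos (pi/4)" using h pi_gt_zero by (intro cos_monotone_0_pi_le) auto
  have c0: "cos h > 0" using h pi_gt_zero by (intro cos_gt_zero) auto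
  have "(cos h)\<^sup>2 \<ge> (cos (pi/4))\<^sup>2"
    using c by (intro power_mono) (auto simp: cos_45)
  then have c2: "(cos h)\<^sup>2 \<ge> 1/2" by (simp add: cos_45 power_divide)
  have "h \<le> tan h"
    using abs_tan_ge[of h] h by (auto simp: tan_gt_zero abs_of_pos)
  then have "h * cos h \<le> sin h" using c0 by (simp add: tan_def field_simps)
  then have "2 * (h * cos h) * cos h \<le> 2 * sin h * cos h"
    using c0 by (intro mult_right_mono) auto
  moreover have "2 * (h * cos h) * cos h = 2 * h * (cos h)\<^sup>2" by (simp add: power2_eq_square)
  moreover have "2 * h * (cos h)\<^sup>2 \<ge> 2 * h * (1/2)" using c2 h by (intro mult_left_mono) auto
  ultimately have "h \<le> sin (2 * h)" by (simp add: sin_double)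
  then show ?thesis by (simp add: h_def)
qed auto

text \<open>Together with \<open>chord_le_dist\<close> this makes the great-circle metric and the
  algebraically simpler chord metric interchangeable up to the factor 2.\<close>

lemma dist_le_chord: "dist p q \<le> 2 * chord p q"
proof -
  have "dist p q / 2 / 2 \<le> sin (dist p q / 2)"
    by (rule half_le_sin) (use dist_le_pi[of p q] in auto)
  then show ?thesis unfolding chord_eq_sin by linarith
qed

text \<open>The two charts \<open>z\<close> and \<open>1 / z\<close>, indexed by a Boolean so that
  each statement covers both at once; inversion being an isometry, they carry the same metric.
  \<open>pole b\<close> is the single point outside the range of \<open>crd b\<close>.\<close>

definition crd :: "bool \<Rightarrow> complex \<Rightarrow> riemann_sphere" where
  "crd b z = (if b then Plane z else sphere_inversion (Plane z))"

definition icrd :: "bool \<Rightarrow> riemann_sphere \<Rightarrow> complex" where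
  "icrd b p = (if b then affine_coord p else affine_coord (sphere_inversion p))"

definition pole :: "bool \<Rightarrow> riemann_sphere" where
  "pole b = (if b then Infty else Plane 0)"

lemma inversion_inversion [simp]: "sphere_inversion (sphere_inversion p) = p"
  by (cases p) (auto simp: sphere_inversion_def)

lemma icrd_crd [simp]: "icrd b (crd b z) = z"
  by (auto simp: icrd_def crd_def)

lemma crd_icrd: "p \<noteq> pole b \<Longrightarrow> crd b (icrd b p) = p"
  by (cases p) (auto simp: icrd_def crd_def pole_def sphere_inversion_def split: if_splits)

lemma crd_neq_pole [simp]: "crd b z \<noteq> pole b"
  by (auto simp: crd_def pole_def sphere_inversion_def split: if_splits)

lemma range_crd: "p \<in> range (crd b) \<longleftrightarrow> p \<noteq> pole b"
  using crd_icrd crd_neq_pole by (metis rangeE rangeI)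

lemma crd_inject [simp]: "crd b z = crd b w \<longleftrightarrow> z = w"
  by (metis icrd_crd)

lemma crd_eq_pole: "crd b z = pole (\<not> b) \<longleftrightarrow> z = 0"
  by (auto simp: crd_def pole_def sphere_inversion_def)

lemma crd_not: "z \<noteq> 0 \<Longrightarrow> crd (\<not> b) z = crd b (1 / z)"
  by (auto simp: crd_def sphere_inversion_def)

lemma chord_inversion: "chord (sphere_inversion p) (sphere_inversion q) = chord p q"
  by (simp add: chord_eq_sin dist_inversion)

text \<open>In either chart the spherical line element is \<open>2 |dz|\<close> divided by the
  square of \<open>nrm z\<close>.\<close>

definition nrm :: "complex \<Rightarrow> real" where "nrm z = sqrt (1 + (cmod z)\<^sup>2)"

lemma nrm_ge_1: "1 \<le> nrm z" by (simp add: nrm_def)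
lemma nrm_pos: "0 < nrm z" using nrm_ge_1[of z] by linarith
lemma nrm_sq: "(nrm z)\<^sup>2 = 1 + (cmod z)\<^sup>2" by (simp add: nrm_def)

lemma chord_Plane: "chord (Plane z) (Plane w) = 2 * cmod (z - w) / (nrm z * nrm w)"
proof -
  define s where "s = 1 + (cmod z)\<^sup>2"
  define t where "t = 1 + (cmod w)\<^sup>2"
  have st: "s > 0" "t > 0" by (auto simp: s_def t_def add_pos_nonneg)
  have zw: "(cmod z)\<^sup>2 = s - 1" "(cmod w)\<^sup>2 = t - 1" by (auto simp: s_def t_def)
  have i: "stereo (Plane z) \<bullet> stereo (Plane w)
     = (2/s) * (2/t) * (z \<bullet> w) + (s-2)/s * ((t-2)/t)"
    by (simp add: s_def t_def inner_prod_def add.commute)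
  have d: "(cmod (z - w))\<^sup>2 = (s-1) + (t-1) - 2 * (z \<bullet> w)"
    by (simp add: power2_norm_eq_inner inner_diff_left inner_diff_right inner_commute[of w z])
       (simp add: dot_square_norm zw)
  have "(chord (Plane z) (Plane w))\<^sup>2 = 4 * (cmod (z - w))\<^sup>2 / (s * t)"
    unfolding chord_sq i d using st by (simp add: field_simps)
  also have "\<dots> = (2 * cmod (z - w) / (nrm z * nrm w))\<^sup>2"
    by (simp add: power_divide power_mult_distrib nrm_sq s_def t_def)
  finally have "(chord (Plane z) (Plane w))\<^sup>2 = (2 * cmod (z - w) / (nrm z * nrm w))\<^sup>2" .
  moreover have "0 \<le> 2 * cmod (z - w) / (nrm z * nrm w)" using nrm_pos[of z] nrm_pos[of w] by simp
  ultimately show ?thesis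
    using power2_eq_iff_nonneg[of "chord (Plane z) (Plane w)"] by (simp add: chord_def)
qed

lemma chord_crd: "chord (crd b z) (crd b w) = 2 * cmod (z - w) / (nrm z * nrm w)"
  by (simp add: crd_def chord_inversion chord_Plane)

lemma chord_pole: "chord (pole b) (crd b w) = 2 / nrm w"
proof -
  have s: "1 + (cmod w)\<^sup>2 > 0" by (simp add: add_pos_nonneg)
  have "(chord Infty (Plane w))\<^sup>2 = (2 / nrm w)\<^sup>2"
    unfolding chord_sq power_divide nrm_sq using s by (simp add: inner_prod_def field_simps)
  moreover have "0 \<le> 2 / nrm w" using nrm_pos[of w] by simp
  ultimately have 1: "chord Infty (Plane w) = 2 / nrm w"
    using power2_eq_iff_nonneg[of "chord Infty (Plane w)"] by (simp add: chord_def)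
  have "sphere_inversion Infty = Plane 0" by (simp add: sphere_inversion_def)
  then show ?thesis using 1 chord_inversion[of Infty "Plane w"] by (auto simp: pole_def crd_def)
qed

lemma dist_crd_le: "dist (crd b z) (crd b w) \<le> 4 * cmod (z - w)"
proof -
  have "1 \<le> nrm z * nrm w" using nrm_ge_1[of z] nrm_ge_1[of w] by (simp add: mult_ge1_I)
  then have "cmod (z - w) / (nrm z * nrm w) \<le> cmod (z - w) / 1"
    by (intro divide_left_mono) (auto simp: nrm_pos)
  then show ?thesis using dist_le_chord[of "crd b z" "crd b w"] by (simp add: chord_crd)
qed

lemma dist_crd_ge:
  assumes "cmod z \<le> 3" "cmod w \<le> 3"
  shows "cmod (z - w) \<le> 5 * dist (crd b z) (crd b w)"
proof -
  have "nrm z \<le> sqrt 10" if "cmod z \<le> 3" for z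
    using power_mono[OF that, of 2] by (simp add: nrm_def)
  then have "nrm z * nrm w \<le> sqrt 10 * sqrt 10"
    using assms nrm_pos[of w] by (intro mult_mono) (auto simp: nrm_pos less_imp_le)
  then have "cmod (z - w) * (nrm z * nrm w) \<le> cmod (z - w) * 10" 
    by (intro mult_left_mono) auto
  then have "cmod (z - w) \<le> 5 * chord (crd b z) (crd b w)"
    using nrm_pos[of z] nrm_pos[of w] by (simp add: chord_crd field_simps)
  then show ?thesis using chord_le_dist[of "crd b z" "crd b w"] by linarith
qed

text \<open>The source of the recurring bound 3: seen from a point of the closed unit disc, the pole
  has chordal distance at least sqrt 2 and points of modulus at least 3 have chordal distance at
  least 2/3. On moduli up to 3 the chart is bi-Lipschitz by \<open>dist_crd_le\<close> and
  \<open>dist_crd_ge\<close>, with constants 4 and 5.\<close>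

lemma near_chart:
  assumes "cmod z \<le> 1" "dist (crd b z) q < 1/2"
  obtains w where "q = crd b w" "cmod w < 3"
proof -
  have cl: "chord (crd b z) q < 1/2" using assms chord_le_dist[of "crd b z" q] by linarith
  have nz: "nrm z \<le> sqrt 2"
    using power_mono[OF assms(1), of 2] by (simp add: nrm_def)
  have s2: "sqrt 2 < (3/2::real)" by (rule real_less_lsqrt) (auto simp: power2_eq_square)
  have "q \<noteq> pole b"
  proof
    assume "q = pole b"
    then have "2 / nrm z < 1/2"
      using cl chord_pole[of b z] by (simp add: chord_def norm_minus_commute)
    then show False using nz s2 nrm_pos[of z] by (simp add: field_simps)
  qed
  then obtain w where w: "q = crd b w" using crd_icrd by metis
  have "cmod w < 3"
  proof (rule ccontr)
    assume n: "\<not> cmod w < 3"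
    have "cmod (z - w) \<ge> cmod w - 1" using norm_triangle_ineq2[of w z] assms
      by (simp add: norm_minus_commute)
    then have d: "(cmod w - 1)/(nrm z * nrm w) \<le> cmod (z - w)/(nrm z * nrm w)"
      using nrm_pos[of z] nrm_pos[of w] by (intro divide_right_mono) auto
    have "nrm w \<le> cmod w + 1"
      unfolding nrm_def by (rule real_le_lsqrt) (auto simp: power2_eq_square algebra_simps)
    moreover have "cmod w + 1 \<le> 2 * (cmod w - 1)" using n by simp
    ultimately have "nrm w \<le> 2 * (cmod w - 1)" by (rule order_trans)
    moreover have "nrm z * nrm w \<le> 3/2 * nrm w" using nz s2 nrm_pos[of w]
      by (intro mult_right_mono) auto
    ultimately have "nrm z * nrm w \<le> 3 * (cmod w - 1)" by linarith
    then have "1/3 \<le> (cmod w - 1)/(nrm z * nrm w)"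
      using nrm_pos[of z] nrm_pos[of w] by (simp add: field_simps)
    then have "1/3 \<le> cmod (z - w)/(nrm z * nrm w)" using d by linarith
    then have "2/3 \<le> chord (crd b z) q"
      unfolding w chord_crd times_divide_eq_right[symmetric] by linarith
    then show False using cl by linarith
  qed
  then show thesis using that w by blast
qed

lemma hemisphere: obtains b z where "p = crd b z" "cmod z \<le> 1"
proof (cases p)
  case (Plane z)
  show ?thesis
  proof (cases "cmod z \<le> 1")
    case True then show ?thesis using that[of True z] Plane by (simp add: crd_def)
  next
    case False
    then have "p = crd False (1/z)" "cmod (1/z) \<le> 1"
      using Plane by (auto simp: crd_def sphere_inversion_def norm_divide divide_le_eq)
    then show ?thesis using that by blast
  qed
next
  case Infty
  then have "p = crd False 0" by (simp add: crd_def sphere_inversion_def)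
  then show ?thesis using that[of False 0] by simp
qed

lemma continuous_crd: "continuous_on A (crd b)"
proof (rule continuous_on_subset)
  have "4-lipschitz_on UNIV (crd b)"
    by (rule lipschitz_onI) (use dist_crd_le in \<open>auto simp: dist_norm\<close>)
  then show "continuous_on UNIV (crd b)" by (rule lipschitz_on_continuous_on)
qed auto

lemma isCont_crd: "isCont (crd b) z"
  using continuous_crd[of UNIV b] continuous_on_eq_continuous_at[of UNIV "crd b"] by auto

lemma compact_sphere: "compact (UNIV :: riemann_sphere set)"
proof -
  have "UNIV = crd True ` cball 0 1 \<union> crd False ` cball 0 1"
  proof (rule UNIV_eq_I)
    fix p :: riemann_sphere
    obtain b z where "p = crd b z" "cmod z \<le> 1" by (rule hemisphere)
    then show "p \<in> crd True ` cball 0 1 \<union> crd False ` cball 0 1" by (cases b) auto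
  qed
  moreover have "compact (crd True ` cball 0 1 \<union> crd False ` cball 0 1)"
    by (intro compact_Un compact_continuous_image continuous_crd compact_cball)
  ultimately show ?thesis by simp
qed

lemma closed_imp_compact: "closed (A::riemann_sphere set) \<Longrightarrow> compact A"
  using compact_Int_closed[OF compact_sphere, of A] by simp

lemma open_range_crd: "open (range (crd b))"
proof -
  have "range (crd b) = - {pole b}" using range_crd by blast
  then show ?thesis by (metis open_Compl closed_singleton)
qed

lemma continuous_stereo: "continuous_on A stereo"
proof (rule continuous_on_subset)
  have "1-lipschitz_on UNIV stereo"
    by (rule lipschitz_onI) (use chord_le_dist in \<open>auto simp: chord_def dist_norm\<close>)
  then show "continuous_on UNIV stereo" by (rule lipschitz_on_continuous_on)
qed auto

text \<open>Stereographic projection from the north pole, which makes continuity of the coordinate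
  visible. At \<open>Infty\<close> both sides are 0.\<close>

lemma affine_coord_stereo: "affine_coord p = fst (stereo p) /\<^sub>R (1 - snd (stereo p))"
proof (cases p)
  case (Plane z)
  have s: "(cmod z)\<^sup>2 + 1 \<noteq> 0" by (simp add: add_nonneg_eq_0_iff)
  have "1 - ((cmod z)\<^sup>2 - 1) / ((cmod z)\<^sup>2 + 1) = 2 / ((cmod z)\<^sup>2 + 1)"
    using s by (simp add: field_simps)
  then have "fst (stereo p) /\<^sub>R (1 - snd (stereo p))
      = (((cmod z)\<^sup>2 + 1) / 2 * (2 / ((cmod z)\<^sup>2 + 1))) *\<^sub>R z"
    by (simp only: Plane stereo.simps fst_conv snd_conv scaleR_scaleR inverse_divide add.commute)
  also have "((cmod z)\<^sup>2 + 1) / 2 * (2 / ((cmod z)\<^sup>2 + 1)) = 1" using s by simp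
  finally show ?thesis by (simp add: Plane)
qed simp

lemma isCont_icrd:
  assumes "p \<noteq> pole b"
  shows "isCont (icrd b) p"
proof -
  have st: "isCont stereo q" for q
    using continuous_stereo[of UNIV] continuous_on_eq_continuous_at[of UNIV stereo] by auto
  have iv: "isCont sphere_inversion q" for q
    unfolding isCont_def tendsto_iff dist_inversion by (auto simp: eventually_at)
  have a: "isCont affine_coord q" if "q \<noteq> Infty" for q
  proof -
    have "1 - snd (stereo q) \<noteq> 0"
    proof (cases q)
      case (Plane z)
      have s: "(cmod z)\<^sup>2 + 1 \<noteq> 0" by (simp add: add_nonneg_eq_0_iff)
      then show ?thesis by (simp add: Plane field_simps)
    qed (use that in auto)
    then have "isCont (\<lambda>q. fst (stereo q) /\<^sub>R (1 - snd (stereo q))) q"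
      by (intro continuous_intros st) auto
    then show ?thesis using affine_coord_stereo by presburger
  qed
  show ?thesis
  proof (cases b)
    case True
    then show ?thesis using a[of p] assms by (simp add: icrd_def[abs_def] pole_def)
  next
    case False
    then have "sphere_inversion p \<noteq> Infty" using assms
      by (cases p) (auto simp: sphere_inversion_def pole_def split: if_splits)
    then have "isCont (affine_coord \<circ> sphere_inversion) p"
      using a iv continuous_at_compose by blast
    then show ?thesis using False by (simp add: icrd_def[abs_def] o_def)
  qed
qed

lemma open_crd_image:
  assumes "open U"
  shows "open (crd b ` U)"
proof -
  have c: "continuous_on (range (crd b)) (icrd b)"
    using isCont_icrd range_crd continuous_at_imp_continuous_on by blast
  have "crd b ` U = icrd b -` U \<inter> range (crd b)"
    by (auto simp: image_iff) 
  then show ?thesis using continuous_on_open_vimage[OF open_range_crd] c assms by metis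
qed

lemma open_crd_vimage: "open V \<Longrightarrow> open (crd b -` V)"
  using continuous_crd[of UNIV b] by (simp add: open_vimage)

section \<open>Holomorphic maps of the sphere\<close>

text \<open>Holomorphy at a point of a map into the sphere. The existential choice of the target
  chart treats poles on the same footing as finite values.\<close>

definition sph_hol :: "(complex \<Rightarrow> riemann_sphere) \<Rightarrow> complex \<Rightarrow> bool" where
  "sph_hol g z \<longleftrightarrow>
     (\<exists>b h e. e > 0 \<and> h holomorphic_on ball z e \<and> (\<forall>w\<in>ball z e. g w = crd b (h w)))"

lemma sph_holI:
  "e > 0 \<Longrightarrow> h holomorphic_on ball z e \<Longrightarrow> (\<And>w. w \<in> ball z e \<Longrightarrow> g w = crd b (h w)) \<Longrightarrow> sph_hol g z"
  unfolding sph_hol_def by blast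

lemma sph_holE:
  assumes "sph_hol g z"
  obtains b h e where "e > 0" "h holomorphic_on ball z e" "\<And>w. w \<in> ball z e \<Longrightarrow> g w = crd b (h w)"
  using assms unfolding sph_hol_def by blast

lemma sph_hol_crd: "sph_hol (crd b) z"
  by (rule sph_holI[of 1 "\<lambda>w. w" _ _ b]) auto

lemma sph_hol_isCont:
  assumes "sph_hol g z"
  shows "isCont g z"
proof -
  obtain b h e where h: "e > 0" "h holomorphic_on ball z e" "\<And>w. w \<in> ball z e \<Longrightarrow> g w = crd b (h w)"
    using sph_holE[OF assms] by metis
  have "isCont h z" using h holomorphic_on_imp_continuous_on[OF h(2)]
    by (simp add: continuous_on_eq_continuous_at)
  then have "isCont (crd b \<circ> h) z" using isCont_crd continuous_at_compose by blast
  moreover have "\<forall>\<^sub>F w in nhds z. (crd b \<circ> h) w = g w"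
    using h eventually_nhds_in_open[of "ball z e" z] by (auto elim!: eventually_mono)
  ultimately show ?thesis using isCont_cong by blast
qed

lemma sph_hol_compose:
  assumes "sph_hol g z" and f: "\<And>b w. sph_hol (f \<circ> crd b) w"
  shows "sph_hol (f \<circ> g) z"
proof -
  obtain b h e where h: "e > 0" "h holomorphic_on ball z e" "\<And>w. w \<in> ball z e \<Longrightarrow> g w = crd b (h w)"
    using sph_holE[OF assms(1)] by metis
  obtain b' h' e' where h': "e' > 0" "h' holomorphic_on ball (h z) e'"
    "\<And>w. w \<in> ball (h z) e' \<Longrightarrow> (f \<circ> crd b) w = crd b' (h' w)"
    using sph_holE[OF f[of b "h z"]] by metis
  have "isCont h z" using h holomorphic_on_imp_continuous_on[OF h(2)]
    by (simp add: continuous_on_eq_continuous_at)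
  then obtain r where r: "r > 0" "\<And>w. dist w z < r \<Longrightarrow> dist (h w) (h z) < e'"
    using h'(1) unfolding continuous_at_eps_delta by metis
  have sub: "h ` ball z (min e r) \<subseteq> ball (h z) e'" using r by (auto simp: dist_commute)
  show ?thesis
  proof (rule sph_holI)
    show "min e r > 0" using h r by auto
    have "h holomorphic_on ball z (min e r)" using h(2) by (rule holomorphic_on_subset) auto
    then have "h' \<circ> h holomorphic_on ball z (min e r)"
      using h'(2) sub holomorphic_on_compose_gen by blast
    then show "(h' \<circ> h) holomorphic_on ball z (min e r)" .
    show "(f \<circ> g) w = crd b' ((h' \<circ> h) w)" if "w \<in> ball z (min e r)" for w
    proof -
      have "h w \<in> ball (h z) e'" using sub that by blast
      then show ?thesis using h'(3)[of "h w"] h(3)[of w] that by simp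
    qed
  qed
qed

lemma sph_hol_icrd:
  assumes "open U" and g: "\<And>z. z \<in> U \<Longrightarrow> sph_hol g z" and p: "\<And>z. z \<in> U \<Longrightarrow> g z \<noteq> pole b"
  shows "(\<lambda>z. icrd b (g z)) holomorphic_on U"
proof -
  have "(\<lambda>z. icrd b (g z)) analytic_on U"
    unfolding analytic_on_def
  proof
    fix z assume z: "z \<in> U"
    obtain b' h e where h: "e > 0" "h holomorphic_on ball z e" "\<And>w. w \<in> ball z e \<Longrightarrow> g w = crd b' (h w)"
      using sph_holE[OF g[OF z]] by metis
    obtain r where r: "r > 0" "ball z r \<subseteq> U" using assms(1) z open_contains_ball by blast
    define m where "m = min e r"
    have m: "m > 0" "ball z m \<subseteq> ball z e" "ball z m \<subseteq> U" using h r by (auto simp: m_def)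
    have hm: "h holomorphic_on ball z m" using h(2) m(2) holomorphic_on_subset by blast
    have "(\<lambda>z. icrd b (g z)) holomorphic_on ball z m"
    proof (cases "b' = b")
      case True
      have "icrd b (g w) = h w" if "w \<in> ball z m" for w
        using h(3)[of w] that m True by auto
      then show ?thesis using hm by (subst holomorphic_cong[OF refl, of _ _ h]) auto
    next
      case False
      then have b': "b' = (\<not> b)" by auto
      \<comment> \<open>In the other chart the coordinate is \<open>1 / h\<close>; avoiding the pole
        of \<open>b\<close> means exactly that \<open>h\<close> has no zero.\<close>
      have nz: "h w \<noteq> 0" if "w \<in> ball z m" for w
      proof
        assume "h w = 0"
        then have "g w = crd (\<not> b) 0" using h(3)[of w] that m b' by auto
        then show False using p[of w] that m crd_eq_pole[of "\<not> b" 0] by auto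
      qed
      have "icrd b (g w) = 1 / h w" if "w \<in> ball z m" for w
        using h(3)[of w] that m b' crd_not[OF nz[OF that], of b] by auto
      moreover have "(\<lambda>w. 1 / h w) holomorphic_on ball z m"
        using hm nz by (intro holomorphic_intros) auto
      ultimately show ?thesis by (subst holomorphic_cong[OF refl, of _ _ "\<lambda>w. 1 / h w"]) auto
    qed
    then show "\<exists>e>0. (\<lambda>z. icrd b (g z)) holomorphic_on ball z e" using m by blast
  qed
  then show ?thesis using analytic_imp_holomorphic by blast
qed

lemma sph_hol_local_Lipschitz:
  assumes "sph_hol g z"
  obtains e K where "e > 0" "\<And>w w'. w \<in> ball z e \<Longrightarrow> w' \<in> ball z e \<Longrightarrow> dist (g w) (g w') \<le> K * cmod (w - w')"
proof -
  obtain b h e where h: "e > 0" "h holomorphic_on ball z e" "\<And>w. w \<in> ball z e \<Longrightarrow> g w = crd b (h w)"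
    using sph_holE[OF assms] by metis
  have c: "continuous_on (cball z (e/2)) (deriv h)"
    by (rule continuous_on_subset[OF holomorphic_on_imp_continuous_on[OF holomorphic_deriv[OF h(2)]]])
       (use h(1) in auto)
  have "compact (deriv h ` cball z (e/2))" by (intro compact_continuous_image c compact_cball)
  then obtain B where B: "\<And>w. w \<in> cball z (e/2) \<Longrightarrow> norm (deriv h w) \<le> B"
    using compact_imp_bounded bounded_iff by (metis imageI)
  show thesis
  proof (rule that)
    show "e/2 > 0" using h by auto
    fix w w' assume w: "w \<in> ball z (e/2)" "w' \<in> ball z (e/2)"
    have "norm (h w - h w') \<le> B * norm (w - w')"
    proof (rule field_differentiable_bound)
      show "convex (ball z (e/2))" by simp
      fix x assume x: "x \<in> ball z (e/2)"
      show "(h has_field_derivative deriv h x) (at x within ball z (e/2))"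
        using h x by (intro holomorphic_derivI[of h "ball z e"]) auto
      show "norm (deriv h x) \<le> B" using B[of x] x by auto
    qed (use w in auto)
    moreover have "g w = crd b (h w)" "g w' = crd b (h w')" using h w by auto
    ultimately show "dist (g w) (g w') \<le> (4 * B) * cmod (w - w')"
      using dist_crd_le[of b "h w" "h w'"] by simp
  qed
qed

lemma finite_ball_cover:
  fixes e :: "riemann_sphere \<Rightarrow> real"
  assumes "\<And>p. e p > 0"
  shows "\<exists>S. finite S \<and> (UNIV \<subseteq> (\<Union>p\<in>S. ball p (e p)))"
proof -
  have "UNIV \<subseteq> (\<Union>p\<in>UNIV. ball p (e p))" using assms centre_in_ball by blast
  from compactE_image[OF compact_sphere _ this] show ?thesis by (metis open_ball)
qed

text \<open>A Lebesgue number of a finite subcover serves as common radius, and the largest of the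
  finitely many constants as common constant.\<close>

lemma uniform_on_sphere:
  fixes Q :: "real \<Rightarrow> riemann_sphere set \<Rightarrow> bool"
  assumes loc: "\<And>p. \<exists>e>0. \<exists>K. Q K (ball p e)"
    and mono: "\<And>K K' A B. Q K A \<Longrightarrow> K \<le> K' \<Longrightarrow> B \<subseteq> A \<Longrightarrow> Q K' B"
  shows "\<exists>e>0. \<exists>K. \<forall>p. Q K (ball p e)"
proof -
  obtain e K where e: "\<And>p. e p > 0" "\<And>p. Q (K p) (ball p (e p))" using loc by metis
  obtain S where S: "finite S" "UNIV \<subseteq> (\<Union>p\<in>S. ball p (e p))"
    using finite_ball_cover[of e] e(1) by blast
  obtain r where r: "r > 0" "\<And>x. x \<in> UNIV \<Longrightarrow> \<exists>G\<in>(\<lambda>p. ball p (e p)) ` S. ball x r \<subseteq> G"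
    using Heine_Borel_lemma[OF compact_sphere, of "(\<lambda>p. ball p (e p)) ` S"] S by auto
  have "Q (Max (K ` S)) (ball p r)" for p
  proof -
    obtain s where s: "s \<in> S" "ball p r \<subseteq> ball s (e s)" using r(2)[of p] by auto
    show ?thesis by (rule mono[OF e(2)[of s]]) (use S s in auto)
  qed
  then show ?thesis using r by blast
qed

locale hol_map =
  fixes f :: "riemann_sphere \<Rightarrow> riemann_sphere"
  assumes hol: "sph_hol (f \<circ> crd b) z"
begin

lemma isCont_f: "isCont f p"
proof -
  obtain b z where p: "p = crd b z" by (rule hemisphere)
  have np: "p \<noteq> pole b" using p by simp
  have "isCont (f \<circ> crd b) (icrd b p)" using sph_hol_isCont hol by blast
  then have "isCont ((f \<circ> crd b) \<circ> icrd b) p" using isCont_icrd[OF np] continuous_at_compose by blast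
  moreover have "\<forall>\<^sub>F q in nhds p. ((f \<circ> crd b) \<circ> icrd b) q = f q"
    using eventually_nhds_in_open[OF open_range_crd, of p b] np
    by (auto simp: range_crd crd_icrd elim!: eventually_mono)
  ultimately show ?thesis using isCont_cong by blast
qed

lemma continuous_f: "continuous_on A f"
  by (simp add: continuous_at_imp_continuous_on isCont_f)

lemma Lipschitz: "\<exists>L\<ge>2. \<forall>p q. dist (f p) (f q) \<le> L * dist p q"
proof -
  define Q where "Q K A \<longleftrightarrow> (\<forall>p\<in>A. \<forall>q\<in>A. dist (f p) (f q) \<le> K * dist p q)" for K A
  have "\<exists>e>0. \<exists>K. \<forall>p. Q K (ball p e)"
  proof (rule uniform_on_sphere)
    show "Q K' B" if "Q K A" "K \<le> K'" "B \<subseteq> A" for K K' A B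
      unfolding Q_def
    proof (intro ballI)
      fix p q assume "p \<in> B" "q \<in> B"
      then have "dist (f p) (f q) \<le> K * dist p q" using that unfolding Q_def by blast
      also have "\<dots> \<le> K' * dist p q" using that by (intro mult_right_mono) auto
      finally show "dist (f p) (f q) \<le> K' * dist p q" .
    qed
  next
    fix p
    obtain b z where p: "p = crd b z" "cmod z \<le> 1" by (rule hemisphere)
    obtain e K where e: "e > 0"
      "\<And>w w'. w \<in> ball z e \<Longrightarrow> w' \<in> ball z e \<Longrightarrow> dist ((f \<circ> crd b) w) ((f \<circ> crd b) w') \<le> K * cmod (w - w')"
      using sph_hol_local_Lipschitz[OF hol] by metis
    \<comment> \<open>Radius 1/2 keeps the ball in the chart; \<open>e/10\<close> becomes at most
      \<open>e/2\<close> after the factor 5 of \<open>dist_crd_ge\<close>.\<close>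
    define r where "r = min (1/2) (e/10)"
    have K: "Q (5 * max K 0) (ball p r)"
      unfolding Q_def
    proof (intro ballI)
      fix q q' assume q: "q \<in> ball p r" "q' \<in> ball p r"
      obtain w where w: "q = crd b w" "cmod w < 3" 
        using near_chart[OF p(2), of b q] q p by (auto simp: r_def)
      obtain w' where w': "q' = crd b w'" "cmod w' < 3" 
        using near_chart[OF p(2), of b q'] q p by (auto simp: r_def)
      have "cmod (z - w) < e" "cmod (z - w') < e"
        using dist_crd_ge[of z w b] dist_crd_ge[of z w' b] w w' p q e(1) by (auto simp: r_def)
      then have "dist (f q) (f q') \<le> K * cmod (w - w')"
        using e(2)[of w w'] w w' by (simp add: dist_norm)
      also have "\<dots> \<le> max K 0 * cmod (w - w')" by (intro mult_right_mono) auto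
      also have "\<dots> \<le> max K 0 * (5 * dist q q')"
        using dist_crd_ge[of w w' b] w w' by (intro mult_left_mono) auto
      finally show "dist (f q) (f q') \<le> 5 * max K 0 * dist q q'" by simp
    qed
    have "r > 0" using e by (auto simp: r_def)
    then show "\<exists>e>0. \<exists>K. Q K (ball p e)" using K by blast
  qed
  then obtain e K where e: "e > 0" "\<And>p. Q K (ball p e)" by blast
  \<comment> \<open>Pairs at distance at least \<open>e\<close> are covered by
    \<open>pi / e\<close>, as distances on the sphere are at most pi.\<close>
  define L where "L = max 2 (max K (pi / e))"
  have "dist (f p) (f q) \<le> L * dist p q" for p q
  proof (cases "dist p q < e")
    case True
    then have "dist (f p) (f q) \<le> K * dist p q" using e(2)[of p] e(1) by (auto simp: Q_def)
    also have "\<dots> \<le> L * dist p q" by (intro mult_right_mono) (auto simp: L_def)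
    finally show ?thesis .
  next
    case False
    have "dist (f p) (f q) \<le> (pi / e) * e" using dist_le_pi[of "f p" "f q"] e by simp
    also have "\<dots> \<le> L * dist p q" using False e by (intro mult_mono) (auto simp: L_def)
    finally show ?thesis .
  qed
  moreover have "L \<ge> 2" by (auto simp: L_def)
  ultimately show ?thesis by blast
qed

end

lemma hol_map_compose:
  assumes "hol_map f" "hol_map g"
  shows "hol_map (f \<circ> g)"
proof
  interpret f: hol_map f by fact
  interpret g: hol_map g by fact
  show "sph_hol (f \<circ> g \<circ> crd b) z" for b z
    using sph_hol_compose[OF g.hol f.hol, of b z] by (simp add: o_assoc)
qed

lemma hol_map_funpow:
  assumes "hol_map f"
  shows "hol_map (f ^^ n)"
proof (induction n)
  case 0 show ?case using sph_hol_crd by (auto simp: hol_map_def id_def o_def)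
next
  case (Suc n) then have "hol_map (f \<circ> f ^^ n)" by (rule hol_map_compose[OF assms])
  then show ?case by (simp only: funpow.simps)
qed

section \<open>The metric derivative\<close>

lemma tendsto_at_crd:
  assumes "((\<lambda>w. F (crd b w)) \<longlongrightarrow> l) (at z)"
  shows "(F \<longlongrightarrow> l) (at (crd b z))"
proof -
  have c: "(icrd b \<longlongrightarrow> z) (at (crd b z))"
    using isCont_icrd[of "crd b z" b] by (simp add: isCont_def)
  have ev: "\<forall>\<^sub>F q in at (crd b z). q \<in> range (crd b) \<and> q \<noteq> crd b z"
    using eventually_at_in_open[OF open_range_crd, of "crd b z" b] by simp
  have "filterlim (icrd b) (at z) (at (crd b z))"
    unfolding filterlim_at using c by (auto intro!: eventually_mono[OF ev])
  then have "((\<lambda>q. F (crd b (icrd b q))) \<longlongrightarrow> l) (at (crd b z))"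
    by (rule filterlim_compose[OF assms])
  moreover have "\<forall>\<^sub>F q in at (crd b z). F (crd b (icrd b q)) = F q"
    by (rule eventually_mono[OF ev]) auto
  ultimately show ?thesis by (rule Lim_transform_eventually)
qed

lemma at_sphere_neq_bot: "at (p::riemann_sphere) \<noteq> bot"
proof
  assume "at p = bot"
  obtain b z where p: "p = crd b z" by (rule hemisphere)
  have "open {p}" using \<open>at p = bot\<close> at_eq_bot_iff by blast
  then have "open (crd b -` {p})" by (rule open_crd_vimage)
  moreover have "crd b -` {p} = {z}" using p by auto
  ultimately show False using not_open_singleton by metis
qed

definition rep :: "(riemann_sphere \<Rightarrow> riemann_sphere) \<Rightarrow> bool \<Rightarrow> complex \<Rightarrow> bool \<Rightarrow> (complex \<Rightarrow> complex) \<Rightarrow> real \<Rightarrow> bool" where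
  "rep f b z b' h e \<longleftrightarrow> e > 0 \<and> h holomorphic_on ball z e \<and> (\<forall>w\<in>ball z e. f (crd b w) = crd b' (h w))"

text \<open>The limit of chord quotients does not mention charts. Uniqueness of limits therefore
  identifies the formula for any pair of charts with \<open>spherical_deriv\<close>, in place of a
  computation with transition maps.\<close>

lemma chord_deriv_rep:
  assumes "rep f b z b' h e"
  shows "((\<lambda>q. chord (f q) (f (crd b z)) / chord q (crd b z)) \<longlongrightarrow>
           cmod (deriv h z) * (nrm z)\<^sup>2 / (nrm (h z))\<^sup>2) (at (crd b z))"
proof (rule tendsto_at_crd)
  have e: "e > 0" and h: "h holomorphic_on ball z e" and r: "\<And>w. w \<in> ball z e \<Longrightarrow> f (crd b w) = crd b' (h w)"
    using assms by (auto simp: rep_def)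
  have D: "(h has_field_derivative deriv h z) (at z)"
    using h e by (intro holomorphic_derivI[of h "ball z e"]) auto
  have hc: "(h \<longlongrightarrow> h z) (at z)" using DERIV_isCont[OF D] by (simp add: isCont_def)
  have n: "((\<lambda>w. nrm (g w)) \<longlongrightarrow> nrm c) F" if "(g \<longlongrightarrow> c) F" for g c and F :: "complex filter"
    unfolding nrm_def using that by (intro tendsto_intros)
  have "((\<lambda>w. cmod ((h w - h z) / (w - z)) * (nrm w * nrm z / (nrm (h w) * nrm (h z))))
     \<longlongrightarrow> cmod (deriv h z) * (nrm z * nrm z / (nrm (h z) * nrm (h z)))) (at z)"
    using D nrm_pos[of "h z"] unfolding has_field_derivative_iff
    by (intro tendsto_intros n hc) auto
  moreover have "\<forall>\<^sub>F w in at z. cmod ((h w - h z) / (w - z)) * (nrm w * nrm z / (nrm (h w) * nrm (h z)))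
      = chord (f (crd b w)) (f (crd b z)) / chord (crd b w) (crd b z)"
  proof (rule eventually_mono[OF eventually_at_in_open[of "ball z e" z]])
    fix w assume w: "w \<in> ball z e - {z}"
    then have fw: "f (crd b w) = crd b' (h w)" "f (crd b z) = crd b' (h z)" using r e by auto
    have alg: "x / y * (m / k) = (2 * x / k) / (2 * y / m)" for x y m k :: real by simp
    show "cmod ((h w - h z) / (w - z)) * (nrm w * nrm z / (nrm (h w) * nrm (h z)))
      = chord (f (crd b w)) (f (crd b z)) / chord (crd b w) (crd b z)"
      unfolding fw chord_crd norm_divide by (rule alg)
  qed (use e in auto)
  ultimately show "((\<lambda>w. chord (f (crd b w)) (f (crd b z)) / chord (crd b w) (crd b z))
     \<longlongrightarrow> cmod (deriv h z) * (nrm z)\<^sup>2 / (nrm (h z))\<^sup>2) (at z)"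
    unfolding power2_eq_square times_divide_eq_right[symmetric] by (rule Lim_transform_eventually)
qed

context hol_map begin

lemma obtain_rep:
  obtains b' h e where "rep f b z b' h e"
proof -
  obtain b' h e where "e > 0" "h holomorphic_on ball z e" "\<And>w. w \<in> ball z e \<Longrightarrow> (f \<circ> crd b) w = crd b' (h w)"
    using sph_holE[OF hol] by metis
  then have "rep f b z b' h e" by (auto simp: rep_def)
  then show thesis using that by blast
qed

lemma rep_chart:
  assumes "f (crd b z) \<noteq> pole b'"
  obtains e where "rep f b z b' (\<lambda>w. icrd b' (f (crd b w))) e"
proof -
  have "isCont (f \<circ> crd b) z" using sph_hol_isCont hol by blast
  then have t: "((f \<circ> crd b) \<longlongrightarrow> (f \<circ> crd b) z) (nhds z)"
    by (simp only: isCont_def tendsto_at_iff_tendsto_nhds)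
  have "\<forall>\<^sub>F w in nhds z. (f \<circ> crd b) w \<in> - {pole b'}"
    by (rule topological_tendstoD[OF t]) (use assms in \<open>auto simp: open_Compl\<close>)
  then obtain e where e: "e > 0" "\<And>w. w \<in> ball z e \<Longrightarrow> f (crd b w) \<noteq> pole b'"
    unfolding eventually_nhds_metric by (auto simp: dist_commute)
  have "(\<lambda>w. icrd b' ((f \<circ> crd b) w)) holomorphic_on ball z e"
    by (rule sph_hol_icrd[OF open_ball hol]) (use e in auto)
  then have "rep f b z b' (\<lambda>w. icrd b' (f (crd b w))) e"
    using e by (auto simp: rep_def crd_icrd)
  then show thesis using that by blast
qed

lemma chord_deriv: "((\<lambda>q. chord (f q) (f p) / chord q p) \<longlongrightarrow> spherical_deriv f p) (at p)"
proof -
  define b where "b \<longleftrightarrow> p \<noteq> Infty"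
  define b' where "b' \<longleftrightarrow> f p \<noteq> Infty"
  define z where "z = icrd b p"
  have p: "p = crd b z" unfolding z_def by (rule crd_icrd[symmetric]) (auto simp: b_def pole_def)
  have ch: "chart p = icrd b" "chart_inv p = crd b" "chart (f p) = icrd b'"
    by (auto simp: fun_eq_iff b_def b'_def chart_def chart_inv_def icrd_def crd_def)
  have "f (crd b z) \<noteq> pole b'" unfolding p[symmetric] by (auto simp: b'_def pole_def)
  then obtain e where r: "rep f b z b' (\<lambda>w. icrd b' (f (crd b w))) e" by (rule rep_chart)
  have "spherical_deriv f p = cmod (deriv (\<lambda>w. icrd b' (f (crd b w))) z) * (nrm z)\<^sup>2 / (nrm (icrd b' (f (crd b z))))\<^sup>2"
    unfolding spherical_deriv_def ch by (simp add: z_def[symmetric] o_def nrm_sq p[symmetric])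
  then show ?thesis using chord_deriv_rep[OF r] by (simp add: p[symmetric])
qed

lemma spherical_deriv_rep:
  assumes "rep f b z b' h e"
  shows "spherical_deriv f (crd b z) = cmod (deriv h z) * (nrm z)\<^sup>2 / (nrm (h z))\<^sup>2"
  using tendsto_unique[OF at_sphere_neq_bot chord_deriv chord_deriv_rep[OF assms]] .

lemma spherical_deriv_nonneg: "spherical_deriv f p \<ge> 0"
  unfolding spherical_deriv_def by (simp add: add_nonneg_nonneg)

lemma rep_at:
  assumes "rep f b z b' h e" "w \<in> ball z e"
  shows "rep f b w b' h (e - dist z w)"
proof -
  have sub: "ball w (e - dist z w) \<subseteq> ball z e"
  proof
    fix x assume "x \<in> ball w (e - dist z w)"
    then show "x \<in> ball z e" using dist_triangle[of z x w] by simp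
  qed
  have "h holomorphic_on ball w (e - dist z w)"
    using assms(1) sub holomorphic_on_subset unfolding rep_def by blast
  then show ?thesis using assms sub by (auto simp: rep_def)
qed

lemma continuous_spherical_deriv: "continuous_on UNIV (spherical_deriv f)"
proof (rule continuous_at_imp_continuous_on, rule ballI)
  fix p
  obtain b z where p: "p = crd b z" by (rule hemisphere)
  obtain b' h e where r: "rep f b z b' h e" by (rule obtain_rep)
  then have e: "e > 0" and h: "h holomorphic_on ball z e" by (auto simp: rep_def)
  have eq: "spherical_deriv f (crd b w) = cmod (deriv h w) * (nrm w)\<^sup>2 / (nrm (h w))\<^sup>2" if "w \<in> ball z e" for w
    using spherical_deriv_rep[OF rep_at[OF r that]] .
  have c: "continuous_on (ball z e) h" "continuous_on (ball z e) (deriv h)"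
    using h holomorphic_deriv[OF h] by (auto intro: holomorphic_on_imp_continuous_on)
  have "continuous_on (ball z e) (\<lambda>w. cmod (deriv h w) * (nrm w)\<^sup>2 / (nrm (h w))\<^sup>2)"
    unfolding nrm_sq by (intro continuous_intros c) (auto simp: add_nonneg_eq_0_iff)
  then have "continuous_on (ball z e) (\<lambda>w. spherical_deriv f (crd b w))"
    by (subst continuous_on_cong[OF refl eq]) 
  then have "isCont (\<lambda>w. spherical_deriv f (crd b w)) z"
    using e by (simp add: continuous_on_eq_continuous_at)
  then show "isCont (spherical_deriv f) p"
    unfolding isCont_def p by (rule tendsto_at_crd)
qed

end

section \<open>Rational maps\<close>

text \<open>The polynomial \<open>z^d * P (1/z)\<close>, with the same \<open>d\<close> for
  numerator and denominator so that the power cancels in the quotient; it represents the map in the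
  chart at infinity.\<close>

definition rflct :: "nat \<Rightarrow> complex poly \<Rightarrow> complex poly" where
  "rflct d P = (\<Sum>i\<le>d. monom (coeff P (d - i)) i)"

lemma coeff_rflct: "coeff (rflct d P) i = (if i \<le> d then coeff P (d - i) else 0)"
  by (simp add: rflct_def coeff_sum if_distrib[where f = "\<lambda>x. x * _"])

lemma degree_rflct: "degree (rflct d P) \<le> d"
  by (rule degree_le) (simp add: coeff_rflct)

lemma poly_rflct:
  assumes "degree P \<le> d" "z \<noteq> 0"
  shows "poly (rflct d P) z = z ^ d * poly P (1 / z)"
proof -
  have "poly P (1/z) = (\<Sum>i\<le>d. coeff P i * (1/z) ^ i)"
    by (subst poly_as_sum_of_monoms'[OF assms(1), symmetric]) (simp add: poly_sum poly_monom)
  then have "z ^ d * poly P (1 / z) = (\<Sum>i\<le>d. coeff P i * z ^ (d - i))"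
    using assms(2) by (auto simp: sum_distrib_left power_diff field_simps intro!: sum.cong)
  also have "\<dots> = (\<Sum>i\<le>d. coeff P (d - i) * z ^ i)"
    by (rule sum.reindex_bij_witness[of _ "\<lambda>i. d - i" "\<lambda>i. d - i"]) auto
  also have "\<dots> = poly (rflct d P) z" by (simp add: rflct_def poly_sum poly_monom)
  finally show ?thesis ..
qed

definition ratio :: "complex poly \<Rightarrow> complex poly \<Rightarrow> complex \<Rightarrow> riemann_sphere" where
  "ratio P Q z = (if poly Q z = 0 then Infty else Plane (poly P z / poly Q z))"

lemma ratio_crd_True: "poly Q z \<noteq> 0 \<Longrightarrow> ratio P Q z = crd True (poly P z / poly Q z)"
  by (simp add: ratio_def crd_def)

lemma ratio_crd_False: "poly P z \<noteq> 0 \<Longrightarrow> ratio P Q z = crd False (poly Q z / poly P z)"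
  by (simp add: ratio_def crd_def sphere_inversion_def)

lemma poly_nonzero_ball:
  fixes R :: "complex poly"
  assumes "poly R z \<noteq> 0"
  shows "\<exists>e>0. \<forall>w\<in>ball z e. poly R w \<noteq> 0"
proof -
  have "isCont (poly R) z" by simp
  then show ?thesis using assms continuous_at_avoid[of z "poly R" 0] by auto
qed

locale nonconst_rat =
  fixes f :: "riemann_sphere \<Rightarrow> riemann_sphere" and d :: nat
  assumes rational: "rational_map_of_degree d f" and degree_ge_1: "d \<ge> 1"
begin

text \<open>The last clause is linear independence of numerator and denominator; it ensures that no
  fibre is described by the zero polynomial.\<close>

definition poly_pair :: "(bool \<Rightarrow> complex poly) \<Rightarrow> (bool \<Rightarrow> complex poly) \<Rightarrow> bool" where
  "poly_pair P Q \<longleftrightarrow>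
     (\<forall>b z. f (crd b z) = ratio (P b) (Q b) z) \<and>
     (\<forall>b z. poly (P b) z \<noteq> 0 \<or> poly (Q b) z \<noteq> 0) \<and>
     (\<forall>b. degree (P b) \<le> d) \<and> (\<forall>b. degree (Q b) \<le> d) \<and>
     (\<forall>b. P (\<not> b) = rflct d (P b)) \<and> (\<forall>b. Q (\<not> b) = rflct d (Q b)) \<and>
     (\<forall>\<alpha> \<beta> b. (\<alpha>, \<beta>) \<noteq> (0, 0) \<longrightarrow> smult \<alpha> (P b) + smult \<beta> (Q b) \<noteq> 0)"

lemma polys: "\<exists>P Q. poly_pair P Q"
proof -
  obtain P Q where PQ: "coprime P Q" "max (degree P) (degree Q) = d" "f = rational_map P Q"
    using rational unfolding rational_map_of_degree_def by blast
  have dPQ: "degree P \<le> d" "degree Q \<le> d" using PQ(2) by auto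
  define P' where "P' b = (if b then P else rflct d P)" for b
  define Q' where "Q' b = (if b then Q else rflct d Q)" for b
  have rr: "rflct d (rflct d R) = R" if "degree R \<le> d" for R
    using that by (auto simp: poly_eq_iff coeff_rflct coeff_eq_0)
  have top: "coeff P d \<noteq> 0 \<or> coeff Q d \<noteq> 0"
  proof -
    have "degree P = d \<or> degree Q = d" using PQ(2) by (auto simp: max_def split: if_splits)
    moreover have "coeff R d \<noteq> 0" if "degree R = d" for R :: "complex poly"
      using that degree_ge_1 by (cases "R = 0") auto
    ultimately show ?thesis by blast
  qed
  have nz: "poly P z \<noteq> 0 \<or> poly Q z \<noteq> 0" for z
    using PQ(1) coprime_poly_0 by blast
  have p0: "poly (rflct d R) 0 = coeff R d" for R
    by (simp add: poly_0_coeff_0 coeff_rflct)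
  have nz': "poly (P' b) z \<noteq> 0 \<or> poly (Q' b) z \<noteq> 0" for b z
    using nz[of z] nz[of "1/z"] top by (cases "z = 0") (auto simp: P'_def Q'_def p0 poly_rflct dPQ)
  have fz: "f (crd b z) = ratio (P' b) (Q' b) z" for b z
  proof (cases b)
    case True
    then show ?thesis by (simp add: PQ(3) rational_map_def crd_def ratio_def P'_def Q'_def)
  next
    case False
    then show ?thesis
      by (cases "z = 0")
         (auto simp: PQ rational_map_def crd_def ratio_def P'_def Q'_def sphere_inversion_def p0
            Let_def poly_rflct dPQ)
  qed
  \<comment> \<open>One of \<open>P\<close>, \<open>Q\<close> has degree \<open>d >= 1\<close> and
    hence a root; a linear relation would make it a common root.\<close>
  have lin: "smult \<alpha> P + smult \<beta> Q \<noteq> 0" if "(\<alpha>, \<beta>) \<noteq> (0, 0)" for \<alpha> \<beta>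
  proof
    assume z: "smult \<alpha> P + smult \<beta> Q = 0"
    have ex: "\<exists>w. poly R w = 0" if "degree R = d" for R :: "complex poly"
      using that degree_ge_1 fundamental_theorem_of_algebra[of R] constant_degree[of R] by auto
    have ev: "\<alpha> * poly P w + \<beta> * poly Q w = 0" for w
      using arg_cong[OF z, of "\<lambda>p. poly p w"] by simp
    have "degree P = d \<or> degree Q = d" using PQ(2) by (auto simp: max_def split: if_splits)
    then show False
    proof
      assume dP: "degree P = d"
      have "\<beta> \<noteq> 0"
      proof
        assume "\<beta> = 0"
        then have "P = 0" using z that by simp
        then show False using dP degree_ge_1 by simp
      qed
      moreover obtain w where "poly P w = 0" using ex[OF dP] ..
      ultimately show False using ev[of w] nz[of w] by auto
    next
      assume dQ: "degree Q = d"
      have "\<alpha> \<noteq> 0"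
      proof
        assume "\<alpha> = 0"
        then have "Q = 0" using z that by simp
        then show False using dQ degree_ge_1 by simp
      qed
      moreover obtain w where "poly Q w = 0" using ex[OF dQ] ..
      ultimately show False using ev[of w] nz[of w] by auto
    qed
  qed
  have lin': "smult \<alpha> (P' b) + smult \<beta> (Q' b) \<noteq> 0" if ab: "(\<alpha>, \<beta>) \<noteq> (0, 0)" for \<alpha> \<beta> b
  proof
    assume z: "smult \<alpha> (P' b) + smult \<beta> (Q' b) = 0"
    have "smult \<alpha> P + smult \<beta> Q = 0"
    proof (cases b)
      case True then show ?thesis using z by (simp add: P'_def Q'_def)
    next
      case False
      have "\<alpha> * coeff P i + \<beta> * coeff Q i = 0" for i
      proof (cases "i \<le> d")
        case True
        then show ?thesis using arg_cong[OF z, of "\<lambda>p. coeff p (d - i)"] False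
          by (simp add: P'_def Q'_def coeff_rflct)
      qed (use dPQ in \<open>simp add: coeff_eq_0\<close>)
      then show ?thesis by (simp add: poly_eq_iff)
    qed
    then show False using lin[OF ab] by blast
  qed
  have "poly_pair P' Q'" unfolding poly_pair_def
    using fz nz' lin' by (intro conjI allI) (auto simp: P'_def Q'_def dPQ degree_rflct rr)
  then show ?thesis by blast
qed

end

sublocale nonconst_rat \<subseteq> hol_map f
proof
  fix b z
  obtain P Q :: "bool \<Rightarrow> complex poly" where pair: "poly_pair P Q" using polys by blast
  have PQ: "f (crd b z) = ratio (P b) (Q b) z" "poly (P b) z \<noteq> 0 \<or> poly (Q b) z \<noteq> 0"
    "degree (P b) \<le> d" "degree (Q b) \<le> d"
    "P (\<not> b) = rflct d (P b)" "Q (\<not> b) = rflct d (Q b)"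
    "(\<alpha>, \<beta>) \<noteq> (0, 0) \<Longrightarrow> smult \<alpha> (P b) + smult \<beta> (Q b) \<noteq> 0" for b z \<alpha> \<beta>
    using pair unfolding poly_pair_def by blast+
  show "sph_hol (f \<circ> crd b) z"
  proof (cases "poly (Q b) z = 0")
    case False
    then obtain e where e: "e > 0" "\<And>w. w \<in> ball z e \<Longrightarrow> poly (Q b) w \<noteq> 0" using poly_nonzero_ball by metis
    show ?thesis
      by (rule sph_holI[OF e(1), of "\<lambda>w. poly (P b) w / poly (Q b) w" _ _ True])
         (use e in \<open>auto intro!: holomorphic_intros simp: PQ(1) ratio_crd_True\<close>)
  next
    case True
    then obtain e where e: "e > 0" "\<And>w. w \<in> ball z e \<Longrightarrow> poly (P b) w \<noteq> 0" using poly_nonzero_ball[of "P b" z] PQ(2) by metis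
    show ?thesis
      by (rule sph_holI[OF e(1), of "\<lambda>w. poly (Q b) w / poly (P b) w" _ _ False])
         (use e in \<open>auto intro!: holomorphic_intros simp: PQ(1) ratio_crd_False\<close>)
  qed
qed

locale rat = nonconst_rat +
  assumes degree_ge_2: "d \<ge> 2"
begin

definition fibre_poly :: "riemann_sphere \<Rightarrow> (bool \<Rightarrow> complex poly) \<Rightarrow> bool" where
  "fibre_poly y R \<longleftrightarrow>
     (\<forall>b z. f (crd b z) = y \<longleftrightarrow> poly (R b) z = 0) \<and> (\<forall>b. R b \<noteq> 0) \<and> (\<forall>b. degree (R b) \<le> d) \<and>
     (\<forall>b. R (\<not> b) = rflct d (R b)) \<and>
     (\<forall>b z. poly (R b) z = 0 \<longrightarrow> poly (pderiv (R b)) z = 0 \<longrightarrow>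
        (\<exists>b' h e. rep f b z b' h e \<and> deriv h z = 0))"

text \<open>A point \<open>y\<close> of the sphere is the zero of a linear form
  \<open>\<alpha> * p + \<beta> * q\<close> in homogeneous coordinates. Applied to numerator and
  denominator, the form yields a polynomial with the fibre over \<open>y\<close> as its zero
  set.\<close>

lemma ex_fibre_poly: "\<exists>R. fibre_poly y R"
proof -
  obtain P Q :: "bool \<Rightarrow> complex poly" where pair: "poly_pair P Q" using polys by blast
  have PQ: "f (crd b z) = ratio (P b) (Q b) z" "poly (P b) z \<noteq> 0 \<or> poly (Q b) z \<noteq> 0"
    "degree (P b) \<le> d" "degree (Q b) \<le> d"
    "P (\<not> b) = rflct d (P b)" "Q (\<not> b) = rflct d (Q b)"
    "(\<alpha>, \<beta>) \<noteq> (0, 0) \<Longrightarrow> smult \<alpha> (P b) + smult \<beta> (Q b) \<noteq> 0" for b z \<alpha> \<beta>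
    using pair unfolding poly_pair_def by blast+
  obtain \<alpha> \<beta> where ab: "(\<alpha>, \<beta>) \<noteq> (0, 0)"
    and y: "\<And>p q. (p, q) \<noteq> (0, 0) \<Longrightarrow> (if q = 0 then Infty else Plane (p / q)) = y \<longleftrightarrow> \<alpha> * p + \<beta> * q = 0"
  proof (cases y)
    case (Plane w)
    have "(if q = 0 then Infty else Plane (p / q)) = y \<longleftrightarrow> 1 * p + (- w) * q = 0" if "(p, q) \<noteq> (0, 0)" for p q
      using that Plane by (auto simp: field_simps)
    then show ?thesis using that[of 1 "-w"] by auto
  next
    case Infty
    then show ?thesis using that[of 0 1] by auto
  qed
  define R where "R b = smult \<alpha> (P b) + smult \<beta> (Q b)" for b
  have "fibre_poly y R"
    unfolding fibre_poly_def
  proof (intro conjI allI impI)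
    show "f (crd b z) = y \<longleftrightarrow> poly (R b) z = 0" for b z
      using y[of "poly (P b) z" "poly (Q b) z"] PQ(2)[of b z] by (simp add: PQ(1) ratio_def R_def)
    show "R b \<noteq> 0" for b using PQ(7)[OF ab] by (simp add: R_def)
    show "degree (R b) \<le> d" for b unfolding R_def
      by (intro degree_add_le order_trans[OF degree_smult_le] PQ(3,4))
    show "R (\<not> b) = rflct d (R b)" for b
      by (simp add: R_def PQ(5,6) poly_eq_iff coeff_rflct)
    fix b z assume R0: "poly (R b) z = 0" and R1: "poly (pderiv (R b)) z = 0"
    let ?P = "poly (P b) z" and ?Q = "poly (Q b) z"
    let ?P' = "poly (pderiv (P b)) z" and ?Q' = "poly (pderiv (Q b)) z"
    have e1: "\<alpha> * ?P + \<beta> * ?Q = 0" "\<alpha> * ?P' + \<beta> * ?Q' = 0"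
      using R0 R1 by (auto simp: R_def pderiv_add pderiv_smult)
    \<comment> \<open>At a double root the multiples of the Wronskian by \<open>\<alpha>\<close> and
      by \<open>\<beta>\<close> both vanish, and up to sign the Wronskian is the numerator of the
      derivative in either chart.\<close>
    have W: "?P' * ?Q - ?P * ?Q' = 0"
    proof -
      have "\<alpha> * (?P' * ?Q - ?P * ?Q') = 0" "\<beta> * (?P' * ?Q - ?P * ?Q') = 0"
        using e1 by algebra+
      then show ?thesis using ab by auto
    qed
    show "\<exists>b' h e. rep f b z b' h e \<and> deriv h z = 0"
    proof (cases "?Q = 0")
      case False
      then obtain e where e: "e > 0" "\<And>w. w \<in> ball z e \<Longrightarrow> poly (Q b) w \<noteq> 0" using poly_nonzero_ball by metis
      have "rep f b z True (\<lambda>w. poly (P b) w / poly (Q b) w) e"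
        unfolding rep_def using e
        by (auto intro!: holomorphic_intros simp: PQ(1) ratio_crd_True)
      moreover have "((\<lambda>w. poly (P b) w / poly (Q b) w) has_field_derivative (?P' * ?Q - ?P * ?Q') / (?Q * ?Q)) (at z)"
        by (intro DERIV_divide poly_DERIV False)
      then have "deriv (\<lambda>w. poly (P b) w / poly (Q b) w) z = 0" using W by (simp add: DERIV_imp_deriv)
      ultimately show ?thesis by blast
    next
      case True
      then have nP: "?P \<noteq> 0" using PQ(2) by blast
      then obtain e where e: "e > 0" "\<And>w. w \<in> ball z e \<Longrightarrow> poly (P b) w \<noteq> 0" using poly_nonzero_ball by metis
      have "rep f b z False (\<lambda>w. poly (Q b) w / poly (P b) w) e"
        unfolding rep_def using e
        by (auto intro!: holomorphic_intros simp: PQ(1) ratio_crd_False)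
      moreover have "((\<lambda>w. poly (Q b) w / poly (P b) w) has_field_derivative (?Q' * ?P - ?Q * ?P') / (?P * ?P)) (at z)"
        by (intro DERIV_divide poly_DERIV nP)
      then have "deriv (\<lambda>w. poly (Q b) w / poly (P b) w) z = 0" using W 
        by (simp add: DERIV_imp_deriv mult.commute)
      ultimately show ?thesis by blast
    qed
  qed
  then show ?thesis by blast
qed

lemma card_fibre: "finite (f -` {y})" "card (f -` {y}) \<le> d"
proof -
  obtain R :: "bool \<Rightarrow> complex poly" where fib: "fibre_poly y R"
    using ex_fibre_poly by blast
  have R: "f (crd b z) = y \<longleftrightarrow> poly (R b) z = 0" "R b \<noteq> 0" "degree (R b) \<le> d"
    "R (\<not> b) = rflct d (R b)"
    "poly (R b) z = 0 \<Longrightarrow> poly (pderiv (R b)) z = 0 \<Longrightarrow> \<exists>b' h e. rep f b z b' h e \<and> deriv h z = 0" for b z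
    using fib unfolding fibre_poly_def by blast+
  let ?Z = "{z. poly (R True) z = 0}"
  have fin: "finite ?Z" using R(2) poly_roots_finite by blast
  have sub: "f -` {y} \<subseteq> crd True ` ?Z \<union> (if f (crd False 0) = y then {crd False 0} else {})"
  proof
    fix p assume p: "p \<in> f -` {y}"
    show "p \<in> crd True ` ?Z \<union> (if f (crd False 0) = y then {crd False 0} else {})"
    proof (cases "p = pole True")
      case True then show ?thesis using p crd_eq_pole[of False 0] by auto
    next
      case False
      then have "p = crd True (icrd True p)" by (simp add: crd_icrd)
      then show ?thesis using p R(1)[of True "icrd True p"] by auto
    qed
  qed
  show "finite (f -` {y})" by (rule finite_subset[OF sub]) (use fin in auto)
  have "card (f -` {y}) \<le> card (crd True ` ?Z \<union> (if f (crd False 0) = y then {crd False 0} else {}))"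
    by (rule card_mono[OF _ sub]) (use fin in auto)
  also have "\<dots> \<le> d"
  \<comment> \<open>\<open>crd False 0\<close> is the one point missed by the chart
    \<open>True\<close>. If it lies in the fibre, the coefficient of degree \<open>d\<close>
    vanishes, and the smaller degree makes room for it in the count.\<close>
  proof (cases "f (crd False 0) = y")
    case True
    then have "coeff (R True) d = 0" using R(1)[of False 0] R(4)[of True]
      by (simp add: poly_0_coeff_0 coeff_rflct)
    then have "degree (R True) < d" using R(2,3)[of True]
      by (metis leading_coeff_neq_0 le_neq_implies_less)
    then have "card ?Z < d" using card_poly_roots_bound[OF R(2)[of True]] by linarith
    then have "Suc (card (crd True ` ?Z)) \<le> d" using card_image_le[OF fin, of "crd True"] by linarith
    then show ?thesis using True
      by (simp add: card_insert_if fin)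
  next
    case False
    then show ?thesis using card_poly_roots_bound[OF R(2)[of True]] R(3)[of True] card_image_le[OF fin, of "crd True"]
      by simp
  qed
  finally show "card (f -` {y}) \<le> d" .
qed

text \<open>The point missed by the chart is not in the fibre, so the fibre polynomial has full
  degree \<open>d\<close>. With a single root and \<open>d >= 2\<close> this root is multiple, hence
  critical. The lemma serves to exclude atoms.\<close>

lemma singleton_fibre_critical:
  assumes "f -` {y} = {q}"
  shows "spherical_deriv f q = 0"
proof -
  obtain R :: "bool \<Rightarrow> complex poly" where fib: "fibre_poly y R"
    using ex_fibre_poly by blast
  have R: "f (crd b z) = y \<longleftrightarrow> poly (R b) z = 0" "R b \<noteq> 0" "degree (R b) \<le> d"
    "R (\<not> b) = rflct d (R b)"
    "poly (R b) z = 0 \<Longrightarrow> poly (pderiv (R b)) z = 0 \<Longrightarrow> \<exists>b' h e. rep f b z b' h e \<and> deriv h z = 0" for b z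
    using fib unfolding fibre_poly_def by blast+
  obtain b z where q: "q = crd b z" by (rule hemisphere)
  have root: "poly (R b) w = 0 \<longleftrightarrow> w = z" for w
  proof -
    have "poly (R b) w = 0 \<longleftrightarrow> crd b w \<in> f -` {y}" using R(1)[of b w] by auto
    also have "\<dots> \<longleftrightarrow> w = z" unfolding assms q by auto
    finally show ?thesis .
  qed
  have "crd (\<not> b) 0 \<notin> f -` {y}" 
    unfolding assms q using crd_eq_pole[of "\<not> b" 0] crd_neq_pole[of b z] by (metis singletonD)
  then have "poly (R (\<not> b)) 0 \<noteq> 0" using R(1) by auto
  then have "coeff (R b) d \<noteq> 0" by (simp add: R(4) poly_0_coeff_0 coeff_rflct)
  then have deg: "degree (R b) = d" using R(3)[of b] le_degree[of "R b" d] by (intro le_antisym)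
  have "[:- z, 1:] dvd R b" using root poly_eq_0_iff_dvd by blast
  then obtain S where S: "R b = [:- z, 1:] * S" by (elim dvdE)
  have "S \<noteq> 0" using S R(2)[of b] by auto
  then have "degree (R b) = 1 + degree S" unfolding S by (subst degree_mult_eq) auto
  then have "degree S \<noteq> 0" using deg degree_ge_2 by simp
  then obtain w where w: "poly S w = 0"
    using fundamental_theorem_of_algebra[of S] constant_degree[of S] by auto
  then have "w = z" using root[of w] S by simp
  then have "poly (pderiv (R b)) z = 0" unfolding S using w by (simp add: pderiv_mult del: mult_pCons_left)
  then obtain b' h e where "rep f b z b' h e" "deriv h z = 0" using R(5)[of b z] root by blast
  then show ?thesis using spherical_deriv_rep q by simp
qed

end

section \<open>Local structure of a rational map: open mapping, critical points, small
  preimages\<close>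

lemma ball_crd_image:
  assumes "e > 0"
  obtains r where "r > 0" "ball (crd b z) r \<subseteq> crd b ` ball z e"
proof -
  have "open (crd b ` ball z e)" "crd b z \<in> crd b ` ball z e"
    using assms by (auto intro!: open_crd_image)
  then show thesis using that open_contains_ball by metis
qed

text \<open>The image of \<open>B\<close> under \<open>dist p\<close> contains the interval from 0
  to \<open>dist p q\<close> and is covered by \<open>card C\<close> intervals of length
  \<open>2 * e\<close>; Lebesgue measure compares the lengths.\<close>

lemma connected_cover_dist:
  fixes B :: "'a::metric_space set"
  assumes "connected B" "finite C" "B \<subseteq> (\<Union>c\<in>C. cball c e)" "p \<in> B" "q \<in> B" "e \<ge> 0"
  shows "dist p q \<le> 2 * e * card C"
proof -
  have "connected (dist p ` B)" using assms(1) by (intro connected_continuous_image continuous_intros)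
  moreover have "0 \<in> dist p ` B" "dist p q \<in> dist p ` B" using assms(4,5) by force+
  ultimately have "{0..dist p q} \<subseteq> dist p ` B" using connected_contains_Icc by blast
  also have "\<dots> \<subseteq> (\<Union>c\<in>C. {dist p c - e..dist p c + e})"
  proof
    fix x assume "x \<in> dist p ` B"
    then obtain y where y: "y \<in> B" "x = dist p y" by auto
    then obtain c where c: "c \<in> C" "dist c y \<le> e" using assms(3) by auto
    have "x \<in> {dist p c - e..dist p c + e}"
      using dist_triangle[of p y c] dist_triangle[of p c y] c y by (auto simp: dist_commute)
    then show "x \<in> (\<Union>c\<in>C. {dist p c - e..dist p c + e})" using c by blast
  qed
  finally have "emeasure lborel {0..dist p q} \<le> emeasure lborel (\<Union>c\<in>C. {dist p c - e..dist p c + e})"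
    by (intro emeasure_mono) (auto intro!: sets.finite_UN assms(2))
  also have "\<dots> \<le> (\<Sum>c\<in>C. emeasure lborel {dist p c - e..dist p c + e})"
    by (intro emeasure_subadditive_finite assms(2)) auto
  also have "\<dots> = (\<Sum>c\<in>C. ennreal (2 * e))" using assms(6) by (intro sum.cong) auto
  also have "\<dots> = ennreal (2 * e * card C)" using assms(6) by (simp add: ennreal_mult' ennreal_of_nat_eq_real_of_nat mult.commute)
  finally show ?thesis using assms(6) by simp
qed

context rat begin

lemma rep_not_constant:
  assumes "rep f b z b' h e"
  shows "\<not> h constant_on ball z e"
proof
  assume "h constant_on ball z e"
  then obtain c where c: "\<And>w. w \<in> ball z e \<Longrightarrow> h w = c" by (auto simp: constant_on_def)
  have e: "e > 0" using assms by (simp add: rep_def)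
  have "crd b ` ball z e \<subseteq> f -` {crd b' c}" using assms c by (auto simp: rep_def)
  then have "finite (crd b ` ball z e)" using card_fibre(1) finite_subset by blast
  then have "finite (ball z e)" by (rule finite_imageD) (auto simp: inj_on_def)
  then show False using e uncountable_ball uncountable_infinite by blast
qed

lemma open_map: 
  assumes "open U"
  shows "open (f ` U)"
proof (subst open_subopen, intro ballI)
  fix y assume "y \<in> f ` U"
  then obtain p where p: "p \<in> U" "y = f p" by auto
  obtain b z where z: "p = crd b z" by (rule hemisphere)
  obtain b' h e where r: "rep f b z b' h e" by (rule obtain_rep)
  then have e: "e > 0" "h holomorphic_on ball z e" "\<And>w. w \<in> ball z e \<Longrightarrow> f (crd b w) = crd b' (h w)" 
    by (auto simp: rep_def)
  let ?V = "ball z e \<inter> crd b -` U"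
  have V: "open ?V" using assms open_crd_vimage by blast
  have "open (h ` ?V)"
    by (rule open_mapping_thm[OF e(2) open_ball connected_ball V _ rep_not_constant[OF r]]) auto
  then have "open (crd b' ` h ` ?V)" by (rule open_crd_image)
  moreover have "crd b' ` h ` ?V \<subseteq> f ` U" using e(3) by force
  moreover have "y \<in> crd b' ` h ` ?V" using p z e by force
  ultimately show "\<exists>T. open T \<and> y \<in> T \<and> T \<subseteq> f ` U" by blast
qed

lemma open_map_funpow: "open U \<Longrightarrow> open ((f ^^ n) ` U)"
proof (induction n)
  case (Suc n)
  have "(f ^^ Suc n) ` U = f ` (f ^^ n) ` U" by auto
  then show ?case using Suc open_map by metis
qed simp

lemma locally_injective:
  assumes "spherical_deriv f p \<noteq> 0"
  obtains e where "e > 0" "inj_on f (ball p e)"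
proof -
  obtain b z where z: "p = crd b z" by (rule hemisphere)
  obtain b' h e where r: "rep f b z b' h e" by (rule obtain_rep)
  then have e: "e > 0" "h holomorphic_on ball z e" "\<And>w. w \<in> ball z e \<Longrightarrow> f (crd b w) = crd b' (h w)" 
    by (auto simp: rep_def)
  have "deriv h z \<noteq> 0" using spherical_deriv_rep[OF r] assms z by auto
  then obtain s where s: "s > 0" "ball z s \<subseteq> ball z e" "inj_on h (ball z s)"
    using has_complex_derivative_locally_injective[OF e(2) _ open_ball, of z] e(1) by auto
  obtain t where t: "t > 0" "ball p t \<subseteq> crd b ` ball z s" using ball_crd_image[OF s(1)] z by metis
  have "inj_on f (crd b ` ball z s)"
  proof (rule inj_onI)
    fix x y assume xy: "x \<in> crd b ` ball z s" "y \<in> crd b ` ball z s" "f x = f y"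
    then obtain v w where vw: "x = crd b v" "y = crd b w" "v \<in> ball z s" "w \<in> ball z s" by auto
    then have "h v = h w" using xy(3) e(3)[of v] e(3)[of w] s(2) by (metis crd_inject subsetD)
    then show "x = y" using s(3) vw by (auto simp: inj_on_def)
  qed
  then show thesis using that t inj_on_subset by metis
qed

definition crit :: "riemann_sphere set" where "crit = {p. spherical_deriv f p = 0}"

lemma crit_isolated: "\<exists>e>0. \<forall>q\<in>ball p e. q \<noteq> p \<longrightarrow> q \<notin> crit"
proof -
  obtain b z where z: "p = crd b z" by (rule hemisphere)
  obtain b' h e where r: "rep f b z b' h e" by (rule obtain_rep)
  then have e: "e > 0" "h holomorphic_on ball z e" "\<And>w. w \<in> ball z e \<Longrightarrow> f (crd b w) = crd b' (h w)" 
    by (auto simp: rep_def)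
  have "\<exists>s>0. \<forall>w\<in>ball z s. w \<noteq> z \<longrightarrow> w \<in> ball z e \<and> deriv h w \<noteq> 0"
  proof (cases "\<exists>\<beta>\<in>ball z e. deriv h \<beta> \<noteq> 0")
    case True
    then obtain \<beta> where be: "\<beta> \<in> ball z e" "deriv h \<beta> \<noteq> 0" by auto
    have "\<forall>\<^sub>F w in at z. deriv h w \<noteq> 0 \<and> w \<in> ball z e"
      by (rule non_zero_neighbour_alt[OF holomorphic_deriv[OF e(2) open_ball] open_ball connected_ball _ be])
         (use e in auto)
    then show ?thesis unfolding eventually_at by (auto simp: dist_commute)
  next
    case False
    have "h constant_on ball z e"
      by (rule has_field_derivative_0_imp_constant_on[OF _ connected_ball open_ball])
         (use False e(2) in \<open>metis holomorphic_derivI open_ball\<close>)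
    then show ?thesis using rep_not_constant[OF r] by blast
  qed
  then obtain s where s: "s > 0" "\<And>w. w \<in> ball z s \<Longrightarrow> w \<noteq> z \<Longrightarrow> w \<in> ball z e \<and> deriv h w \<noteq> 0" by blast
  obtain t where t: "t > 0" "ball p t \<subseteq> crd b ` ball z s" using ball_crd_image[OF s(1)] z by metis
  have "q \<notin> crit" if q: "q \<in> ball p t" "q \<noteq> p" for q
  proof -
    obtain w where w: "w \<in> ball z s" "q = crd b w" using q t by blast
    then have w': "w \<in> ball z e" "deriv h w \<noteq> 0" using s(2)[of w] q z by auto
    show ?thesis
      using spherical_deriv_rep[OF rep_at[OF r w'(1)]] w' nrm_pos[of w] nrm_pos[of "h w"] w by (auto simp: crit_def)
  qed
  then show ?thesis using t by blast
qed

lemma finite_crit: "finite crit"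
proof (rule ccontr)
  assume "infinite crit"
  then obtain p where "p islimpt crit"
    using Heine_Borel_imp_Bolzano_Weierstrass[OF compact_sphere, of crit] by auto
  moreover obtain e where "e > 0" "\<forall>q\<in>ball p e. q \<noteq> p \<longrightarrow> q \<notin> crit" using crit_isolated by blast
  ultimately show False unfolding islimpt_approachable by (metis dist_commute mem_ball)
qed

text \<open>\<open>Q\<close> is trivial on the ball of radius \<open>\<kappa>\<close> about a
  critical point and holds near every other point by local injectivity; compactness makes it
  uniform.\<close>

lemma uniformly_injective:
  assumes "\<kappa> > 0"
  obtains \<delta> where "\<delta> > 0"
    "\<And>p q. p \<notin> (\<Union>c\<in>crit. ball c \<kappa>) \<Longrightarrow> dist p q < \<delta> \<Longrightarrow> f p = f q \<Longrightarrow> p = q"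
proof -
  define Q where "Q (K::real) A \<longleftrightarrow> (\<forall>p\<in>A. \<forall>q\<in>A. p \<notin> (\<Union>c\<in>crit. ball c \<kappa>) \<longrightarrow> f p = f q \<longrightarrow> p = q)" for K A
  have "\<exists>e>0. \<exists>K. \<forall>p. Q K (ball p e)"
  proof (rule uniform_on_sphere)
    show "Q K' B" if "Q K A" "K \<le> K'" "B \<subseteq> A" for K K' A B
      using that unfolding Q_def by (meson subsetD)
    fix p
    show "\<exists>e>0. \<exists>K. Q K (ball p e)"
    proof (cases "p \<in> crit")
      case True
      then have "Q 0 (ball p \<kappa>)" unfolding Q_def by blast
      then show ?thesis using assms by blast
    next
      case False
      then obtain e where "e > 0" "inj_on f (ball p e)" using locally_injective[of p] by (auto simp: crit_def)
      moreover from this have "Q 0 (ball p e)" unfolding Q_def inj_on_def by blast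
      ultimately show ?thesis by blast
    qed
  qed
  then obtain e K where e: "e > 0" "\<And>p. Q K (ball p e)" by blast
  show thesis
  proof (rule that[OF e(1)])
    fix p q assume "p \<notin> (\<Union>c\<in>crit. ball c \<kappa>)" "dist p q < e" "f p = f q"
    then show "p = q" using e(1) e(2)[of p, unfolded Q_def, rule_format, of p q] by auto
  qed
qed

text \<open>The preimage of a small ball about \<open>y\<close> lies within \<open>e\<close> of the
  at most \<open>d\<close> points of the fibre, and a connected set covered by \<open>d\<close>
  balls of radius \<open>e\<close> has diameter at most \<open>2 * e * d\<close>. This dictates
  \<open>e = \<eta> / (2 * d)\<close>.\<close>

lemma connected_preimage_small:
  assumes "\<eta> > 0"
  obtains \<delta> where "\<delta> > 0"
    "\<And>B x p q. connected B \<Longrightarrow> f ` B \<subseteq> ball x \<delta> \<Longrightarrow> p \<in> B \<Longrightarrow> q \<in> B \<Longrightarrow> dist p q \<le> \<eta>"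
proof -
  define Q where "Q (K::real) A \<longleftrightarrow> (\<forall>B. connected B \<longrightarrow> f ` B \<subseteq> A \<longrightarrow> (\<forall>p\<in>B. \<forall>q\<in>B. dist p q \<le> \<eta>))" for K A
  have "\<exists>e>0. \<exists>K. \<forall>p. Q K (ball p e)"
  proof (rule uniform_on_sphere)
    show "Q K' B" if "Q K A" "K \<le> K'" "B \<subseteq> A" for K K' A B
      using that unfolding Q_def by (meson subset_trans)
    fix y
    define e where "e = \<eta> / (2 * d)"
    have e: "e > 0" using assms degree_ge_2 by (simp add: e_def)
    let ?F = "f -` {y}"
    let ?K = "- (\<Union>c\<in>?F. ball c e)"
    have "compact (f ` ?K)"
      by (intro compact_continuous_image continuous_f closed_imp_compact closed_Compl open_UN ballI open_ball)
    then have "open (- (f ` ?K))" by (simp add: compact_imp_closed open_Compl)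
    moreover have "y \<in> - (f ` ?K)"
    proof
      assume "y \<in> f ` ?K"
      then obtain x where "x \<in> ?K" "y = f x" by blast
      then show False using centre_in_ball[of x e] e by blast
    qed
    ultimately obtain \<delta> where \<delta>: "\<delta> > 0" "ball y \<delta> \<subseteq> - (f ` ?K)" using open_contains_ball by metis
    have "Q 0 (ball y \<delta>)"
      unfolding Q_def
    proof (intro allI impI ballI)
      fix B p q assume B: "connected B" "f ` B \<subseteq> ball y \<delta>" "p \<in> B" "q \<in> B"
      have "B \<subseteq> (\<Union>c\<in>?F. cball c e)"
      proof
        fix z assume "z \<in> B"
        then have "f z \<notin> f ` ?K" using B(2) \<delta>(2) by blast
        then have "z \<notin> ?K" by blast
        then show "z \<in> (\<Union>c\<in>?F. cball c e)" using ball_subset_cball by blast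
      qed
      then have "dist p q \<le> 2 * e * card ?F"
        using connected_cover_dist[OF B(1) card_fibre(1) _ B(3,4)] e by auto
      also have "\<dots> \<le> 2 * e * d" using card_fibre(2)[of y] e by (intro mult_left_mono) auto
      also have "\<dots> = \<eta>" using degree_ge_2 by (simp add: e_def)
      finally show "dist p q \<le> \<eta>" .
    qed
    then show "\<exists>e>0. \<exists>K. Q K (ball y e)" using \<delta> by blast
  qed
  then obtain e K where e: "e > 0" "\<And>p. Q K (ball p e)" by blast
  show thesis
    by (rule that[OF e(1)]) (use e(2) in \<open>auto simp: Q_def\<close>)
qed

end

section \<open>Conformal measures under iteration\<close>

context rat begin

sublocale iter: hol_map "f ^^ n" for n
  by (rule hol_map_funpow) unfold_locales

definition sdn :: "nat \<Rightarrow> riemann_sphere \<Rightarrow> real" where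
  "sdn n p = (\<Prod>i<n. spherical_deriv f ((f ^^ i) p))"

text \<open>The chain rule as a product of chord quotients. The limit being free of charts,
  \<open>sdn_eq\<close> can identify the product of derivatives along an orbit with the derivative
  of the iterate.\<close>

lemma chord_deriv_funpow: "((\<lambda>q. chord ((f ^^ n) q) ((f ^^ n) p) / chord q p) \<longlongrightarrow> sdn n p) (at p)"
proof (induction n)
  case 0
  have "\<forall>\<^sub>F q in at p. 1 = chord q p / chord q p"
    using eventually_at_in_open[OF open_UNIV, of p] inj_stereo
    by (auto elim!: eventually_mono simp: chord_def inj_eq)
  then have "((\<lambda>q. chord q p / chord q p) \<longlongrightarrow> 1) (at p)"
    by (rule Lim_transform_eventually[OF tendsto_const])
  then show ?case by (simp add: sdn_def)
next
  case (Suc n)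
  let ?y = "(f ^^ n) p"
  \<comment> \<open>The quotient is completed by its limit at \<open>?y\<close>, since
    \<open>(f ^^ n) q\<close> may equal \<open>?y\<close> and the composition needs continuity
    there.\<close>
  define r where "r y = (if y = ?y then spherical_deriv f ?y else chord (f y) (f ?y) / chord y ?y)" for y
  have "(r \<longlongrightarrow> spherical_deriv f ?y) (at ?y)"
    using chord_deriv[of ?y] by (rule Lim_transform_eventually) (auto simp: r_def eventually_at_filter)
  then have "isCont r ?y" by (simp add: isCont_def r_def)
  moreover have "isCont (f ^^ n) p" by (rule iter.isCont_f)
  ultimately have "isCont (r \<circ> (f ^^ n)) p" using continuous_at_compose by blast
  moreover have "r ?y = spherical_deriv f ?y" by (simp add: r_def)
  ultimately have "((\<lambda>q. r ((f ^^ n) q)) \<longlongrightarrow> spherical_deriv f ?y) (at p)"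
    unfolding isCont_def o_def by simp
  from tendsto_mult[OF this Suc]
  have "((\<lambda>q. r ((f ^^ n) q) * (chord ((f ^^ n) q) ?y / chord q p)) \<longlongrightarrow> sdn (Suc n) p) (at p)"
    by (simp add: sdn_def mult.commute)
  moreover have "r ((f ^^ n) q) * (chord ((f ^^ n) q) ?y / chord q p)
      = chord ((f ^^ Suc n) q) ((f ^^ Suc n) p) / chord q p" for q
  proof (cases "(f ^^ n) q = ?y")
    case False
    then have "chord ((f ^^ n) q) ?y \<noteq> 0" using inj_stereo by (auto simp: chord_def inj_eq)
    then show ?thesis using False by (simp add: r_def)
  qed (simp add: chord_def)
  ultimately show ?case by (simp only:)
qed

lemma sdn_eq: "sdn n p = spherical_deriv (f ^^ n) p"
  using tendsto_unique[OF at_sphere_neq_bot chord_deriv_funpow iter.chord_deriv] .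

lemma sdn_nonneg: "sdn n p \<ge> 0"
  unfolding sdn_def by (intro prod_nonneg) (auto simp: spherical_deriv_nonneg)

text \<open>Cauchy's estimate in charts. The chart disc of radius \<open>\<delta>/4\<close> is
  mapped into \<open>ball u (2 * \<delta>)\<close>, where the iterate has coordinates of modulus
  below 3. The circle of radius \<open>\<delta>/8\<close> gives \<open>24 / \<delta>\<close>, and
  the metric factor, at most 10, gives 240.\<close>

lemma sdn_bound:
  assumes sub: "(f ^^ n) ` ball u (2 * \<delta>) \<subseteq> ball y R" and R: "R \<le> 1/2" and \<delta>: "0 < \<delta>" "\<delta> \<le> 1/4"
    and p: "p \<in> ball u \<delta>"
  shows "sdn n p \<le> 240 / \<delta>"
proof -
  obtain b a where u: "u = crd b a" "cmod a \<le> 1" by (rule hemisphere)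
  obtain b' a' where y: "y = crd b' a'" "cmod a' \<le> 1" by (rule hemisphere)
  obtain z where z: "p = crd b z" "cmod z < 3" using near_chart[OF u(2), of b p] p u \<delta> by auto
  define g where "g w = icrd b' ((f ^^ n) (crd b w))" for w
  have im: "\<exists>v. (f ^^ n) (crd b w) = crd b' v \<and> cmod v < 3" if "w \<in> ball z (\<delta>/4)" for w
  proof -
    have "dist u (crd b w) \<le> dist u p + dist (crd b z) (crd b w)" using z dist_triangle by metis
    also have "\<dots> < 2 * \<delta>" using dist_crd_le[of b z w] that p by (auto simp: dist_norm)
    finally have "dist (crd b' a') ((f ^^ n) (crd b w)) < 1/2" using sub R y by force
    then show ?thesis using near_chart[OF y(2)] by metis
  qed
  have g3: "cmod (g w) < 3" "(f ^^ n) (crd b w) = crd b' (g w)" if "w \<in> ball z (\<delta>/4)" for w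
    using im[OF that] by (auto simp: g_def)
  have hg: "g holomorphic_on ball z (\<delta>/4)"
    unfolding g_def
    by (rule sph_hol_icrd[of _ "\<lambda>w. (f ^^ n) (crd b w)", OF open_ball])
       (use iter.hol[of n b] g3(2) in \<open>auto simp: o_def\<close>)
  have rp: "rep (f ^^ n) b z b' g (\<delta>/4)" unfolding rep_def using \<delta> hg g3(2) by auto
  have "cmod ((deriv ^^ 1) g z) \<le> fact 1 * 3 / (\<delta>/8) ^ 1"
  proof (rule Cauchy_inequality)
    show "g holomorphic_on ball z (\<delta>/8)" using hg by (rule holomorphic_on_subset) (use \<delta> in auto)
    show "continuous_on (cball z (\<delta>/8)) g"
      by (rule continuous_on_subset[OF holomorphic_on_imp_continuous_on[OF hg]]) (use \<delta> in auto)
    fix x assume x: "norm (z - x) = \<delta>/8"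
    then have "x \<in> ball z (\<delta>/4)" using \<delta> by (simp add: dist_norm)
    then show "cmod (g x) \<le> 3" using g3(1) by (simp add: less_imp_le)
  qed (use \<delta> in auto)
  then have d: "cmod (deriv g z) \<le> 24 / \<delta>" by simp
  have "(cmod z)\<^sup>2 \<le> 3\<^sup>2" by (rule power_mono) (use z in auto)
  then have n1: "(nrm z)\<^sup>2 \<le> 10" by (simp add: nrm_sq)
  have n2: "(nrm (g z))\<^sup>2 \<ge> 1" by (simp add: nrm_sq)
  have "sdn n p = cmod (deriv g z) * (nrm z)\<^sup>2 / (nrm (g z))\<^sup>2"
    unfolding sdn_eq z(1) by (rule iter.spherical_deriv_rep[OF rp])
  also have "\<dots> \<le> cmod (deriv g z) * (nrm z)\<^sup>2 / 1" using n2 by (intro divide_left_mono) auto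
  also have "\<dots> = cmod (deriv g z) * (nrm z)\<^sup>2" by simp
  also have "\<dots> \<le> 24 / \<delta> * 10" using d n1 \<delta> by (intro mult_mono) auto
  finally show ?thesis by simp
qed

end

section \<open>Change of variables for a conformal measure\<close>

lemma open_Union_closed_nat:
  fixes V :: "'a::metric_space set"
  assumes "open V"
  obtains C :: "nat \<Rightarrow> 'a set" where "\<And>n. closed (C n)" "V = (\<Union>n. C n)"
proof
  define C where "C n = {x. \<forall>y\<in>-V. dist x y \<ge> 1 / Suc n}" for n
  have "C n = (\<Inter>y\<in>-V. {x. dist x y \<ge> 1 / Suc n})" for n by (auto simp: C_def)
  then show "closed (C n)" for n by (auto intro!: closed_INT closed_Collect_le continuous_intros)
  show "V = (\<Union>n. C n)"
  proof (intro equalityI subsetI)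
    fix x assume "x \<in> V"
    then obtain e where e: "e > 0" "ball x e \<subseteq> V" using assms open_contains_ball by metis
    then obtain n where n: "1 / Suc n < e" using nat_approx_posE by blast
    have "dist x y \<ge> 1 / Suc n" if "y \<notin> V" for y
      using e(2) that n by (meson less_le_trans linear mem_ball not_less subsetD)
    then show "x \<in> (\<Union>n. C n)" by (auto simp: C_def)
  next
    fix x assume "x \<in> (\<Union>n. C n)"
    then obtain n where n: "x \<in> C n" by auto
    show "x \<in> V"
    proof (rule ccontr)
      assume "x \<notin> V"
      then have "dist x x \<ge> 1 / Suc n" using n unfolding C_def by blast
      then show False by simp
    qed
  qed
qed

locale conf = rat +
  fixes \<mu> :: "riemann_sphere measure" and t :: real
  assumes sets_mu [simp, measurable_cong]: "sets \<mu> = sets borel"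
    and finite_mu: "finite_measure \<mu>"
    and t_pos: "t > 0"
    and conformal: "\<And>U. U \<in> sets borel \<Longrightarrow> inj_on f U \<Longrightarrow>
        emeasure \<mu> (f ` U) = (\<integral>\<^sup>+x\<in>U. ennreal (spherical_deriv f x powr t) \<partial>\<mu>)"
begin

lemma space_mu [simp]: "space \<mu> = UNIV"
  using sets_eq_imp_space_eq[OF sets_mu] by simp

lemma borel_f [measurable]: "f \<in> borel_measurable borel"
  by (rule borel_measurable_continuous_onI[OF continuous_f])

lemma borel_funpow [measurable]: "f ^^ n \<in> borel_measurable borel"
  by (rule borel_measurable_continuous_onI[OF iter.continuous_f])

lemma borel_sd [measurable]: "spherical_deriv f \<in> borel_measurable borel"
  by (rule borel_measurable_continuous_onI[OF continuous_spherical_deriv])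

lemma borel_sdn [measurable]: "sdn n \<in> borel_measurable borel"
  unfolding sdn_def[abs_def] by measurable

lemma conformal_point: "emeasure \<mu> {f q} = ennreal (spherical_deriv f q powr t) * emeasure \<mu> {q}"
proof -
  have "emeasure \<mu> (f ` {q}) = (\<integral>\<^sup>+x\<in>{q}. ennreal (spherical_deriv f x powr t) \<partial>\<mu>)"
    by (rule conformal) auto
  also have "\<dots> = ennreal (spherical_deriv f q powr t) * emeasure \<mu> {q}"
    by (rule nn_integral_indicator_singleton) simp
  finally show ?thesis by simp
qed

text \<open>Such an intersection is a countable union of compact sets, and their continuous images
  are closed.\<close>

lemma borel_image_Int:
  assumes "compact K" "open V"
  shows "f ` (K \<inter> V) \<in> sets borel"
proof -
  obtain C :: "nat \<Rightarrow> riemann_sphere set" where C: "\<And>n. closed (C n)" "V = (\<Union>n. C n)"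
    using open_Union_closed_nat[OF assms(2)] by metis
  have "f ` (K \<inter> V) = (\<Union>n. f ` (K \<inter> C n))" unfolding C(2) by blast
  also have "\<dots> \<in> sets borel"
    by (intro sets.countable_UN'' borel_closed compact_imp_closed compact_continuous_image
        continuous_f compact_Int_closed assms C) auto
  finally show ?thesis .
qed

text \<open>Conformality speaks only of sets on which \<open>f\<close> is injective, so the
  complement of the critical set is cut into countably many of them. The change of variables also
  needs the Borel images.\<close>

lemma injective_pieces:
  "\<exists>P::nat \<Rightarrow> riemann_sphere set. disjoint_family P \<and> (\<Union>i. P i) \<union> crit = UNIV \<and>
     (\<forall>i. P i \<in> sets borel \<and> inj_on f (P i) \<and> (\<forall>U. open U \<longrightarrow> f ` (P i \<inter> U) \<in> sets borel))"
proof -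
  define F where "F n = - (\<Union>c\<in>crit. ball c (1 / Suc n))" for n
  have cF: "compact (F n)" for n unfolding F_def
    by (intro closed_imp_compact closed_Compl open_UN ballI open_ball)
  have "\<exists>\<K>. finite \<K> \<and> (\<forall>K\<in>\<K>. compact K \<and> inj_on f K) \<and> \<Union>\<K> = F n" for n
  proof -
    obtain \<delta> where \<delta>: "\<delta> > 0"
      "\<And>p q. p \<notin> (\<Union>c\<in>crit. ball c (1 / Suc n)) \<Longrightarrow> dist p q < \<delta> \<Longrightarrow> f p = f q \<Longrightarrow> p = q"
      using uniformly_injective[of "1 / Suc n"] by auto
    \<comment> \<open>Two points of a closed ball of radius \<open>\<delta>/3\<close> are closer
      than \<open>\<delta>\<close>, so \<open>f\<close> is injective on the part of it that belongs
      to \<open>F n\<close>.\<close>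
    obtain S :: "riemann_sphere set" where S: "finite S" "UNIV \<subseteq> (\<Union>p\<in>S. ball p (\<delta>/3))"
      using finite_ball_cover[of "\<lambda>_. \<delta>/3"] \<delta>(1) by auto
    have "inj_on f (cball p (\<delta>/3) \<inter> F n)" for p
    proof (rule inj_onI)
      fix x y assume xy: "x \<in> cball p (\<delta>/3) \<inter> F n" "y \<in> cball p (\<delta>/3) \<inter> F n" "f x = f y"
      have "dist x y \<le> dist p x + dist p y" by (metis dist_commute dist_triangle)
      then have "dist x y < \<delta>" using xy \<delta>(1) by auto
      then show "x = y" using \<delta>(2)[of x y] xy unfolding F_def by blast
    qed
    moreover have "compact (cball p (\<delta>/3) \<inter> F n)" for p
      by (intro closed_Int_compact closed_cball cF)
    moreover have "\<Union>((\<lambda>p. cball p (\<delta>/3) \<inter> F n) ` S) = F n"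
    proof (intro equalityI subsetI)
      fix x assume x: "x \<in> F n"
      obtain p where "p \<in> S" "x \<in> ball p (\<delta>/3)" using S(2) by blast
      then show "x \<in> \<Union>((\<lambda>p. cball p (\<delta>/3) \<inter> F n) ` S)" using x ball_subset_cball by blast
    qed blast
    ultimately show ?thesis using S(1)
      by (intro exI[of _ "(\<lambda>p. cball p (\<delta>/3) \<inter> F n) ` S"]) auto
  qed
  then obtain \<K> where \<K>: "\<And>n. finite (\<K> n)" "\<And>n K. K \<in> \<K> n \<Longrightarrow> compact K \<and> inj_on f K" "\<And>n. \<Union>(\<K> n) = F n"
    by metis
  \<comment> \<open>The empty set is added so that \<open>from_nat_into\<close> enumerates a
    nonempty set.\<close>
  define A where "A = insert {} (\<Union>n. \<K> n)"
  have cA: "countable A" unfolding A_def using \<K>(1) by (auto intro: countable_finite)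
  define K where "K = from_nat_into A"
  have rK: "range K = A" unfolding K_def by (rule range_from_nat_into) (use cA in \<open>auto simp: A_def\<close>)
  have K: "compact (K i)" "inj_on f (K i)" for i
    using rK \<K>(2) unfolding A_def by (metis UN_E compact_empty inj_on_empty insertE rangeI)+
  have UK: "(\<Union>i. K i) = - crit"
  proof -
    have "(\<Union>i. K i) = \<Union>A" using rK by simp
    also have "\<dots> = (\<Union>n. \<Union>(\<K> n))" unfolding A_def by auto
    also have "\<dots> = (\<Union>n. F n)" by (simp only: \<K>(3))
    also have "\<dots> = - crit"
    proof (intro equalityI subsetI)
      fix p assume "p \<in> (\<Union>n. F n)"
      then obtain n where n: "p \<in> F n" by auto
      show "p \<in> - crit"
      proof
        assume "p \<in> crit"
        moreover have "p \<in> ball p (1 / Suc n)" by simp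
        ultimately show False using n unfolding F_def by blast
      qed
    next
      fix p assume p: "p \<in> - crit"
      have "open (- crit)" using finite_crit finite_imp_closed open_Compl by blast
      then obtain e where e: "e > 0" "ball p e \<subseteq> - crit" using p open_contains_ball by metis
      then obtain n where n: "1 / Suc n < e" using nat_approx_posE by blast
      have "p \<in> F n"
        unfolding F_def
      proof (rule ComplI)
        assume "p \<in> (\<Union>c\<in>crit. ball c (1 / Suc n))"
        then obtain c where c: "c \<in> crit" "dist c p < 1 / Suc n" by auto
        then have "c \<in> ball p e" using n by (simp add: dist_commute)
        then show False using c e(2) by blast
      qed
      then show "p \<in> (\<Union>n. F n)" by blast
    qed
    finally show ?thesis .
  qed
  show ?thesis
  proof (intro exI[of _ "disjointed K"] conjI allI impI)
    show "disjoint_family (disjointed K)" by (rule disjoint_family_disjointed)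
    show "(\<Union>i. disjointed K i) \<union> crit = UNIV" using UN_disjointed_eq[of K] UK by auto
    show "disjointed K i \<in> sets borel" for i
    proof -
      have "range (disjointed K) \<subseteq> sets borel"
        by (rule sets.range_disjointed_sets) (use borel_closed[OF compact_imp_closed[OF K(1)]] in auto)
      then show ?thesis by blast
    qed
    show "inj_on f (disjointed K i)" for i
      using K(2)[of i] disjointed_subset[of K i] inj_on_subset by blast
    show "f ` (disjointed K i \<inter> U) \<in> sets borel" if "open U" for i U
    proof -
      have "closed (\<Union>j\<in>{0..<i}. K j)" by (intro closed_UN) (auto intro: compact_imp_closed K)
      then have "open (U \<inter> - (\<Union>j\<in>{0..<i}. K j))" using that by (intro open_Int open_Compl)
      moreover have "disjointed K i \<inter> U = K i \<inter> (U \<inter> - (\<Union>j\<in>{0..<i}. K j))"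
        by (auto simp: disjointed_def)
      ultimately show ?thesis using borel_image_Int[OF K(1)] by metis
    qed
  qed
qed

text \<open>Conformality, applied to the part of \<open>P\<close> over a Borel set, shows that the
  measures \<open>?M\<close> and \<open>?N\<close> agree; integrating \<open>g\<close> against both
  gives the formula.\<close>

lemma nn_integral_image_inj:
  assumes P: "P \<in> sets borel" "inj_on f P" "f ` P \<in> sets borel" and [measurable]: "g \<in> borel_measurable borel"
  shows "(\<integral>\<^sup>+x\<in>f ` P. g x \<partial>\<mu>) = (\<integral>\<^sup>+x\<in>P. g (f x) * ennreal (spherical_deriv f x powr t) \<partial>\<mu>)"
proof -
  have [measurable]: "P \<in> sets borel" "f ` P \<in> sets borel" by fact+
  let ?s = "\<lambda>x. ennreal (spherical_deriv f x powr t)"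
  let ?M = "distr (density \<mu> (\<lambda>x. ?s x * indicator P x)) borel f"
  let ?N = "density \<mu> (indicator (f ` P))"
  have "?M = ?N"
  proof (rule measure_eqI)
    fix A assume "A \<in> sets ?M"
    then have [measurable]: "A \<in> sets borel" by simp
    have [measurable]: "f -` A \<in> sets borel" using measurable_sets[OF borel_f, of A] by simp
    have "emeasure ?M A = (\<integral>\<^sup>+x. ?s x * indicator P x * indicator (f -` A) x \<partial>\<mu>)"
      by (simp add: emeasure_distr emeasure_density)
    also have "\<dots> = (\<integral>\<^sup>+x\<in>(P \<inter> f -` A). ?s x \<partial>\<mu>)"
      by (intro nn_integral_cong) (auto split: split_indicator)
    also have "\<dots> = emeasure \<mu> (f ` (P \<inter> f -` A))"
      by (rule conformal[symmetric]) (use P in \<open>auto intro: inj_on_subset\<close>)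
    also have "f ` (P \<inter> f -` A) = f ` P \<inter> A" by blast
    also have "emeasure \<mu> (f ` P \<inter> A) = (\<integral>\<^sup>+x. indicator (f ` P \<inter> A) x \<partial>\<mu>)" by simp
    also have "\<dots> = (\<integral>\<^sup>+x. indicator (f ` P) x * indicator A x \<partial>\<mu>)"
      by (intro nn_integral_cong) (auto split: split_indicator)
    also have "\<dots> = emeasure ?N A" by (simp add: emeasure_density)
    finally show "emeasure ?M A = emeasure ?N A" .
  qed simp
  have "(\<integral>\<^sup>+x\<in>f ` P. g x \<partial>\<mu>) = (\<integral>\<^sup>+x. g x \<partial>?N)"
    by (subst nn_integral_density) (auto simp: mult.commute)
  also have "\<dots> = (\<integral>\<^sup>+x. g x \<partial>?M)" using \<open>?M = ?N\<close> by simp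
  also have "\<dots> = (\<integral>\<^sup>+x\<in>P. g (f x) * ?s x \<partial>\<mu>)"
    by (simp add: nn_integral_distr nn_integral_density) (auto intro!: nn_integral_cong simp: ac_simps)
  finally show ?thesis .
qed

text \<open>Conformality at a single point gives a critical value the mass 0, even over an atom,
  because the derivative vanishes.\<close>

lemma null_image_crit: "f ` crit \<in> null_sets \<mu>"
proof (rule null_setsI)
  show "f ` crit \<in> sets \<mu>" using finite_crit by (simp add: borel_closed finite_imp_closed)
  have "emeasure \<mu> (f ` crit) = (\<Sum>x\<in>f ` crit. emeasure \<mu> {x})"
    by (rule emeasure_eq_sum_singleton) (use finite_crit in auto)
  also have "\<dots> = 0"
    by (rule sum.neutral) (auto simp: crit_def conformal_point)
  finally show "emeasure \<mu> (f ` crit) = 0" .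
qed

text \<open>Summing over the injective pieces counts an image point once for every piece that
  contains a preimage, hence an inequality only. Critical values, which the pieces may miss, form a
  null set.\<close>

lemma nn_integral_image_le:
  assumes "open U" and [measurable]: "g \<in> borel_measurable borel"
  shows "(\<integral>\<^sup>+x\<in>f ` U. g x \<partial>\<mu>) \<le> (\<integral>\<^sup>+x\<in>U. g (f x) * ennreal (spherical_deriv f x powr t) \<partial>\<mu>)"
proof -
  obtain P :: "nat \<Rightarrow> riemann_sphere set" where
    P: "disjoint_family P" "(\<Union>i. P i) \<union> crit = UNIV" and
    P': "\<forall>i. P i \<in> sets borel \<and> inj_on f (P i) \<and> (\<forall>U. open U \<longrightarrow> f ` (P i \<inter> U) \<in> sets borel)"
    using injective_pieces by blast
  have [measurable]: "P i \<inter> U \<in> sets borel" "f ` (P i \<inter> U) \<in> sets borel" for i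
    using P' assms(1) by auto
  let ?s = "\<lambda>x. ennreal (spherical_deriv f x powr t)"
  have "AE x in \<mu>. x \<notin> f ` crit" using null_image_crit by (rule AE_not_in)
  then have "AE x in \<mu>. g x * indicator (f ` U) x \<le> (\<Sum>i. g x * indicator (f ` (P i \<inter> U)) x)"
  proof (rule AE_mp, intro AE_I2 impI)
    fix x assume x: "x \<notin> f ` crit"
    show "g x * indicator (f ` U) x \<le> (\<Sum>i. g x * indicator (f ` (P i \<inter> U)) x)"
    proof (cases "x \<in> f ` U")
      case True
      then obtain i where i: "x \<in> f ` (P i \<inter> U)" using x P(2) by blast
      have "g x * indicator (f ` U) x \<le> (\<Sum>i\<in>{i}. g x * indicator (f ` (P i \<inter> U)) x)" using i True by simp
      also have "\<dots> \<le> (\<Sum>i. g x * indicator (f ` (P i \<inter> U)) x)" by (rule sum_le_suminf) auto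
      finally show ?thesis .
    qed simp
  qed
  then have "(\<integral>\<^sup>+x\<in>f ` U. g x \<partial>\<mu>) \<le> (\<integral>\<^sup>+x. (\<Sum>i. g x * indicator (f ` (P i \<inter> U)) x) \<partial>\<mu>)"
    by (rule nn_integral_mono_AE)
  also have "\<dots> = (\<Sum>i. \<integral>\<^sup>+x\<in>f ` (P i \<inter> U). g x \<partial>\<mu>)" by (rule nn_integral_suminf) simp
  also have "\<dots> = (\<Sum>i. \<integral>\<^sup>+x\<in>P i \<inter> U. g (f x) * ?s x \<partial>\<mu>)"
    by (intro suminf_cong nn_integral_image_inj) (use P' in \<open>auto intro: inj_on_subset\<close>)
  also have "\<dots> = (\<integral>\<^sup>+x. (\<Sum>i. g (f x) * ?s x * indicator (P i \<inter> U) x) \<partial>\<mu>)"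
    by (rule nn_integral_suminf[symmetric]) simp
  also have "\<dots> \<le> (\<integral>\<^sup>+x\<in>U. g (f x) * ?s x \<partial>\<mu>)"
  proof (intro nn_integral_mono)
    fix x
    have "disjoint_family (\<lambda>i. P i \<inter> U)" using P(1) by (auto simp: disjoint_family_on_def)
    then have "(\<Sum>i. g (f x) * ?s x * indicator (P i \<inter> U) x) = g (f x) * ?s x * indicator (\<Union>i. P i \<inter> U) x"
      by (simp add: suminf_indicator)
    also have "\<dots> \<le> g (f x) * ?s x * indicator U x"
      by (intro mult_left_mono) (auto split: split_indicator)
    finally show "(\<Sum>i. g (f x) * ?s x * indicator (P i \<inter> U) x) \<le> g (f x) * ?s x * indicator U x" .
  qed
  finally show ?thesis .
qed

lemma nn_integral_funpow_le:
  assumes "open U" and "g \<in> borel_measurable borel"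
  shows "(\<integral>\<^sup>+x\<in>(f ^^ n) ` U. g x \<partial>\<mu>) \<le> (\<integral>\<^sup>+x\<in>U. g ((f ^^ n) x) * ennreal (sdn n x powr t) \<partial>\<mu>)"
  using assms(2)
proof (induction n arbitrary: g)
  case 0 then show ?case by (simp add: sdn_def)
next
  case (Suc n)
  have [measurable]: "g \<in> borel_measurable borel" by fact
  have "(\<integral>\<^sup>+x\<in>(f ^^ Suc n) ` U. g x \<partial>\<mu>) = (\<integral>\<^sup>+x\<in>f ` ((f ^^ n) ` U). g x \<partial>\<mu>)" by (simp add: image_comp)
  also have "\<dots> \<le> (\<integral>\<^sup>+x\<in>(f ^^ n) ` U. g (f x) * ennreal (spherical_deriv f x powr t) \<partial>\<mu>)"
    by (rule nn_integral_image_le[OF open_map_funpow[OF assms(1)]]) measurable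
  also have "\<dots> \<le> (\<integral>\<^sup>+x\<in>U. g (f ((f ^^ n) x)) * ennreal (spherical_deriv f ((f ^^ n) x) powr t) * ennreal (sdn n x powr t) \<partial>\<mu>)"
    by (rule Suc.IH) measurable
  also have "\<dots> = (\<integral>\<^sup>+x\<in>U. g ((f ^^ Suc n) x) * ennreal (sdn (Suc n) x powr t) \<partial>\<mu>)"
    by (intro nn_integral_cong)
       (simp add: sdn_def powr_mult prod_nonneg spherical_deriv_nonneg ennreal_mult mult.assoc mult.commute[of "ennreal (spherical_deriv f _ powr t)"])
  finally show ?case .
qed

lemma emeasure_funpow_le:
  assumes "open U" and K: "\<And>x. x \<in> U \<Longrightarrow> sdn n x \<le> K"
  shows "emeasure \<mu> ((f ^^ n) ` U) \<le> ennreal (K powr t) * emeasure \<mu> U"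
proof -
  have [measurable]: "U \<in> sets borel" "(f ^^ n) ` U \<in> sets borel" using assms(1) open_map_funpow by auto
  have "emeasure \<mu> ((f ^^ n) ` U) = (\<integral>\<^sup>+x\<in>(f ^^ n) ` U. 1 \<partial>\<mu>)" by simp
  also have "\<dots> \<le> (\<integral>\<^sup>+x\<in>U. 1 * ennreal (sdn n x powr t) \<partial>\<mu>)"
    by (rule nn_integral_funpow_le[OF assms(1)]) simp
  also have "\<dots> \<le> (\<integral>\<^sup>+x\<in>U. ennreal (K powr t) \<partial>\<mu>)"
    using K t_pos by (intro nn_integral_mono) 
      (auto split: split_indicator intro!: ennreal_leI powr_mono2 sdn_nonneg)
  also have "\<dots> = ennreal (K powr t) * emeasure \<mu> U" by (simp add: nn_integral_cmult_indicator)
  finally show ?thesis .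
qed

end

section \<open>Mixing and the size of small balls\<close>

text \<open>Working form of the hypotheses: mixing is tested on indicators and on Lipschitz
  functions with values in [0,1], and the lower bound on the density is an inequality between
  measures.\<close>

locale mix = conf +
  fixes \<nu> :: "riemann_sphere measure" and c C \<rho> :: real
  assumes sets_nu [simp, measurable_cong]: "sets \<nu> = sets borel"
    and prob_nu: "prob_space \<nu>"
    and invariant: "distr \<nu> \<nu> f = \<nu>"
    and ac: "\<And>A. A \<in> sets borel \<Longrightarrow> emeasure \<mu> A = 0 \<Longrightarrow> emeasure \<nu> A = 0"
    and dens: "\<And>A. A \<in> sets borel \<Longrightarrow> ennreal c * emeasure \<mu> A \<le> emeasure \<nu> A"
    and c_pos: "c > 0" and C_pos: "C > 0" and rho: "0 < \<rho>" "\<rho> < 1"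
    and mixing: "\<And>A \<psi> K n. A \<in> sets borel \<Longrightarrow> (\<And>x. 0 \<le> \<psi> x \<and> \<psi> x \<le> 1) \<Longrightarrow> K-lipschitz_on UNIV \<psi> \<Longrightarrow> n \<ge> 1 \<Longrightarrow>
        \<bar>(\<integral>x. indicator A ((f ^^ n) x) * \<psi> x \<partial>\<nu>) - measure \<nu> A * (\<integral>x. \<psi> x \<partial>\<nu>)\<bar> \<le> C * (1 + K) * \<rho> ^ n"
begin

sublocale nu: prob_space \<nu> by (rule prob_nu)
sublocale mu: finite_measure \<mu> by (rule finite_mu)

lemma space_nu [simp]: "space \<nu> = UNIV"
  using sets_eq_imp_space_eq[OF sets_nu] by simp

lemma dens': "A \<in> sets borel \<Longrightarrow> c * measure \<mu> A \<le> measure \<nu> A"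
  using dens[of A] c_pos
  by (simp add: mu.emeasure_eq_measure nu.emeasure_eq_measure ennreal_mult[symmetric])

lemma ac': "A \<in> sets borel \<Longrightarrow> measure \<mu> A = 0 \<Longrightarrow> measure \<nu> A = 0"
  using ac[of A] by (simp add: mu.emeasure_eq_measure nu.emeasure_eq_measure)

lemma nu_vimage: "A \<in> sets borel \<Longrightarrow> measure \<nu> (f -` A) = measure \<nu> A"
  using measure_distr[of f \<nu> \<nu> A] invariant by simp

lemma ball_mass:
  assumes sub: "(f ^^ n) ` ball u (2 * \<delta>) \<subseteq> E" and E [measurable]: "E \<in> sets borel" "measure \<nu> E \<le> 1/2"
    and \<delta>: "0 < \<delta>" "\<delta> \<le> 4"
  shows "measure \<nu> (ball u \<delta>) \<le> (10 * C + 4) * \<rho> ^ n / \<delta>"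
\<comment> \<open>Mixing starts at \<open>n = 1\<close>. For \<open>n = 0\<close> the summand 4 of
  the constant makes the bound at least 1, as \<open>\<delta> <= 4\<close>.\<close>
proof (cases "n = 0")
  case True
  have "measure \<nu> (ball u \<delta>) \<le> 1" by (rule nu.prob_le_1)
  also have "1 \<le> 4 / \<delta>" using \<delta> by simp
  also have "\<dots> \<le> (10 * C + 4) / \<delta>" using \<delta> C_pos by (intro divide_right_mono) auto
  finally show ?thesis using True by simp
next
  case False
  \<comment> \<open>A bump function: 1 on \<open>ball u \<delta>\<close> and 0 outside
    \<open>ball u (2 * \<delta>)\<close>, with Lipschitz constant \<open>1/\<delta>\<close>. Where
    it is nonzero, the iterate lies in \<open>E\<close>, so its correlation with the complement of
    \<open>E\<close> vanishes.\<close>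
  define \<psi> where "\<psi> z = max 0 (min 1 (2 - dist u z / \<delta>))" for z
  have Lip: "(1/\<delta>)-lipschitz_on UNIV \<psi>"
  proof (rule lipschitz_onI)
    fix x y :: riemann_sphere
    have "\<bar>dist u x / \<delta> - dist u y / \<delta>\<bar> \<le> dist x y / \<delta>"
    proof -
      have "\<bar>dist u x - dist u y\<bar> \<le> dist x y" by metric
      then show ?thesis using \<delta> by (simp add: diff_divide_distrib[symmetric] divide_right_mono)
    qed
    then show "dist (\<psi> x) (\<psi> y) \<le> 1 / \<delta> * dist x y"
      unfolding \<psi>_def dist_real_def by (auto simp: max_def min_def abs_if split: if_splits)
  qed (use \<delta> in auto)
  have bd: "0 \<le> \<psi> x \<and> \<psi> x \<le> 1" for x by (auto simp: \<psi>_def)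
  have [measurable]: "\<psi> \<in> borel_measurable borel"
    by (rule borel_measurable_continuous_onI[OF lipschitz_on_continuous_on[OF Lip]])
  have int: "integrable \<nu> \<psi>"
    by (rule nu.integrable_const_bound[of _ 1]) (use bd in auto)
  have z: "indicator (- E) ((f ^^ n) x) * \<psi> x = 0" for x
  proof (cases "dist u x < 2 * \<delta>")
    case True
    then have "(f ^^ n) x \<in> E" using sub by force
    then show ?thesis by simp
  next
    case False
    then have "dist u x / \<delta> \<ge> 2" using \<delta> by (simp add: field_simps)
    then show ?thesis by (simp add: \<psi>_def)
  qed
  have "\<bar>(\<integral>x. indicator (- E) ((f ^^ n) x) * \<psi> x \<partial>\<nu>) - measure \<nu> (- E) * (\<integral>x. \<psi> x \<partial>\<nu>)\<bar> \<le> C * (1 + 1/\<delta>) * \<rho> ^ n"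
    by (rule mixing) (use bd Lip False in auto)
  then have "measure \<nu> (- E) * (\<integral>x. \<psi> x \<partial>\<nu>) \<le> C * (1 + 1/\<delta>) * \<rho> ^ n"
    unfolding z by simp
  moreover have "measure \<nu> (- E) \<ge> 1/2" using nu.prob_compl[of E] E by (simp add: Compl_eq_Diff_UNIV)
  moreover have "(\<integral>x. \<psi> x \<partial>\<nu>) \<ge> measure \<nu> (ball u \<delta>)"
  proof -
    have "measure \<nu> (ball u \<delta>) = (\<integral>x. indicator (ball u \<delta>) x \<partial>\<nu>)" by simp
    also have "\<dots> \<le> (\<integral>x. \<psi> x \<partial>\<nu>)"
    proof (rule integral_mono[OF _ int])
      fix x show "indicator (ball u \<delta>) x \<le> \<psi> x"
      proof (cases "dist u x < \<delta>")
        case True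
        then have "dist u x / \<delta> \<le> 1" using \<delta> by simp
        then show ?thesis using True by (simp add: \<psi>_def)
      qed (use bd in auto)
    qed (rule nu.integrable_const_bound[of _ 1], auto intro!: borel_measurable_indicator)
    finally show ?thesis .
  qed
  ultimately have "1/2 * measure \<nu> (ball u \<delta>) \<le> C * (1 + 1/\<delta>) * \<rho> ^ n"
    by (meson mult_mono order_trans measure_nonneg zero_le_divide_1_iff zero_le_numeral)
  also have "\<dots> \<le> C * (5/\<delta>) * \<rho> ^ n"
    using \<delta> C_pos rho by (intro mult_right_mono mult_left_mono) (auto simp: field_simps)
  finally have "measure \<nu> (ball u \<delta>) \<le> 10 * C * \<rho> ^ n / \<delta>" by simp
  also have "\<dots> \<le> (10 * C + 4) * \<rho> ^ n / \<delta>"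
    using \<delta> rho by (intro divide_right_mono mult_right_mono) auto
  finally show ?thesis .
qed

lemma finite_heavy_atoms:
  assumes "m > 0"
  shows "finite {p. measure \<nu> {p} \<ge> m}"
proof (rule ccontr)
  assume inf: "infinite {p. measure \<nu> {p} \<ge> m}"
  obtain N :: nat where N: "1 / m < N" using reals_Archimedean2 by blast
  obtain S where S: "S \<subseteq> {p. measure \<nu> {p} \<ge> m}" "finite S" "card S = N"
    using infinite_arbitrarily_large[OF inf] by blast
  have "N * m = (\<Sum>p\<in>S. m)" using S by simp
  also have "\<dots> \<le> (\<Sum>p\<in>S. measure \<nu> {p})" by (rule sum_mono) (use S in auto)
  also have "\<dots> = measure \<nu> S"
    by (rule nu.finite_measure_eq_sum_singleton[symmetric]) (use S in \<open>auto intro!: borel_closed finite_imp_closed\<close>)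
  also have "\<dots> \<le> 1" by (rule nu.prob_le_1)
  finally show False using N assms by (simp add: field_simps)
qed

text \<open>The atoms of maximal mass would be permuted by the map, and their other preimages would be
  null sets, hence do not exist; then the remaining preimage is critical, which contradicts conformality.\<close>

lemma no_atoms: "measure \<nu> {p} = 0"
proof (rule ccontr)
  assume "measure \<nu> {p} \<noteq> 0"
  then have mp: "measure \<nu> {p} > 0" using measure_nonneg[of \<nu> "{p}"] by linarith
  define F where "F = {q. measure \<nu> {q} \<ge> measure \<nu> {p}}"
  have F: "finite F" "p \<in> F" using finite_heavy_atoms[OF mp] by (auto simp: F_def)
  define b where "b = Max ((\<lambda>q. measure \<nu> {q}) ` F)"
  define A where "A = {q. measure \<nu> {q} = b}"
  have b: "b \<ge> measure \<nu> {p}" unfolding b_def using F by (intro Max_ge) auto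
  have b_max: "measure \<nu> {q} \<le> b" for q
  proof (cases "q \<in> F")
    case True then show ?thesis unfolding b_def using F by (intro Max_ge) auto
  next
    case False then show ?thesis using b by (auto simp: F_def)
  qed
  have "b \<in> (\<lambda>q. measure \<nu> {q}) ` F" unfolding b_def using F by (intro Max_in) auto
  then obtain a where a: "a \<in> A" by (auto simp: A_def)
  have "A \<subseteq> F" using b by (auto simp: A_def F_def)
  then have finA: "finite A" using F finite_subset by blast
  have fib: "measure \<nu> (f -` {y}) = measure \<nu> {y}" for y by (rule nu_vimage) simp
  have meas: "S \<in> sets \<nu>" if "S \<subseteq> f -` {y}" for S y
    using borel_closed[OF finite_imp_closed[OF finite_subset[OF that card_fibre(1)]]] by simp
  have fA: "f q \<in> A" if "q \<in> A" for q
  proof -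
    have "b = measure \<nu> {q}" using that by (simp add: A_def)
    also have "\<dots> \<le> measure \<nu> (f -` {f q})" by (rule nu.finite_measure_mono[OF _ meas]) auto
    finally show ?thesis using fib[of "f q"] b_max[of "f q"] by (simp add: A_def)
  qed
  \<comment> \<open>Two points of positive mass in one fibre, one of them of maximal mass, would
    give their image more than the maximal mass.\<close>
  have two: "q = q'" if "q \<in> A" "measure \<nu> {q'} > 0" "f q = f q'" for q q'
  proof (rule ccontr)
    assume ne: "q \<noteq> q'"
    have "b + measure \<nu> {q'} = measure \<nu> {q} + measure \<nu> {q'}" using that by (simp add: A_def)
    also have "\<dots> = measure \<nu> ({q} \<union> {q'})" by (rule nu.finite_measure_Union[symmetric]) (use ne in auto)
    also have "\<dots> \<le> measure \<nu> (f -` {f q})" by (rule nu.finite_measure_mono[OF _ meas]) (use that in auto)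
    also have "\<dots> \<le> b" using fib b_max by simp
    finally show False using that by simp
  qed
  have b0: "b > 0" using b mp by simp
  have "inj_on f A" by (rule inj_onI) (use two b0 in \<open>auto simp: A_def\<close>)
  then have "f ` A = A" using fA finA endo_inj_surj by blast
  then have "a \<in> f ` A" using a by simp
  then obtain q where q: "q \<in> A" "f q = a" by auto
  have mu_pos: "emeasure \<mu> {a} \<noteq> 0" using ac[of "{a}"] a b0 by (auto simp: A_def nu.emeasure_eq_measure)
  have "f -` {a} = {q}"
  proof (intro equalityI subsetI)
    fix q' assume q': "q' \<in> f -` {a}"
    show "q' \<in> {q}"
    proof (rule ccontr)
      assume ne: "q' \<notin> {q}"
      have "\<not> measure \<nu> {q'} > 0"
      proof
        assume "measure \<nu> {q'} > 0"
        then have "q = q'" by (rule two[OF q(1)]) (use q(2) q' in simp)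
        then show False using ne by simp
      qed
      \<comment> \<open>The density bound turns the \<nu>-null point \<open>q'\<close> into a
        \<mu>-null one, and conformality then makes its image \<open>a\<close> a \<mu>-null point,
        against \<open>mu_pos\<close>.\<close>
      then have "measure \<nu> {q'} = 0" using measure_nonneg[of \<nu> "{q'}"] by linarith
      then have "c * measure \<mu> {q'} \<le> 0" using dens'[of "{q'}"] by simp
      then have "measure \<mu> {q'} = 0" using c_pos measure_nonneg[of \<mu> "{q'}"] by (simp add: mult_le_0_iff)
      then have "emeasure \<mu> {f q'} = 0" unfolding conformal_point by (simp add: mu.emeasure_eq_measure)
      then show False using mu_pos q' by simp
    qed
  qed (use q in auto)
  then have "spherical_deriv f q = 0" by (rule singleton_fibre_critical)
  then have "emeasure \<mu> {f q} = 0" unfolding conformal_point by simp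
  then show False using mu_pos q by simp
qed

lemma ex_R0: "\<exists>R>0. R \<le> 1/4 \<and> (\<forall>y. measure \<nu> (ball y R) \<le> 1/2)"
proof -
  \<comment> \<open>Phrased with an open superset, the property passes to arbitrary subsets,
    measurable or not.\<close>
  define Q where "Q (K::real) A \<longleftrightarrow> (\<exists>U. open U \<and> A \<subseteq> U \<and> measure \<nu> U \<le> 1/2)" for K A
  have "\<exists>e>0. \<exists>K. \<forall>p. Q K (ball p e)"
  proof (rule uniform_on_sphere)
    show "Q K' B" if "Q K A" "K \<le> K'" "B \<subseteq> A" for K K' A B
      using that unfolding Q_def by blast
    fix p
    have "(\<lambda>n. measure \<nu> (ball p (1 / Suc n))) \<longlonglongrightarrow> measure \<nu> (\<Inter>n. ball p (1 / Suc n))"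
    proof (rule nu.finite_Lim_measure_decseq)
      show "decseq (\<lambda>n. ball p (1 / Suc n))"
        by (intro decseq_SucI subset_ball) (auto simp: field_simps)
    qed auto
    moreover have "(\<Inter>n. ball p (1 / Suc n)) = {p}"
    proof (intro equalityI subsetI)
      fix q assume q: "q \<in> (\<Inter>n. ball p (1 / Suc n))"
      have "dist p q \<le> e" if "e > 0" for e
      proof -
        obtain n where "1 / Suc n < e" using nat_approx_posE[OF \<open>e > 0\<close>] by blast
        moreover have "dist p q < 1 / Suc n" using q by auto
        ultimately show ?thesis by linarith
      qed
      then have "dist p q \<le> 0" using field_le_epsilon[of "dist p q" 0] by simp
      then show "q \<in> {p}" by simp
    qed auto
    ultimately have "(\<lambda>n. measure \<nu> (ball p (1 / Suc n))) \<longlonglongrightarrow> 0" using no_atoms by simp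
    then have "\<forall>\<^sub>F n in sequentially. measure \<nu> (ball p (1 / Suc n)) < 1/2"
      by (rule order_tendstoD) simp
    then obtain n where "measure \<nu> (ball p (1 / Suc n)) < 1/2" by (auto simp: eventually_sequentially)
    then have "Q 0 (ball p (1 / Suc n))" unfolding Q_def by (intro exI[of _ "ball p (1 / Suc n)"]) auto
    then show "\<exists>e>0. \<exists>K. Q K (ball p e)"
      by (intro exI[of _ "1 / real (Suc n)"] conjI exI[of _ 0]) auto
  qed
  then obtain e K where e: "e > 0" "\<And>p. Q K (ball p e)" by blast
  have "measure \<nu> (ball y (min e (1/4))) \<le> 1/2" for y
  proof -
    obtain U where U: "open U" "ball y e \<subseteq> U" "measure \<nu> U \<le> 1/2" using e(2)[of y] unfolding Q_def by blast
    have "measure \<nu> (ball y (min e (1/4))) \<le> measure \<nu> U"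
      by (rule nu.finite_measure_mono) (use U subset_ball[of "min e (1/4)" e y] in auto)
    then show ?thesis using U by simp
  qed
  then show ?thesis using e(1) by (intro exI[of _ "min e (1/4)"]) auto
qed

definition R0 :: real where "R0 = (SOME R. R > 0 \<and> R \<le> 1/4 \<and> (\<forall>y. measure \<nu> (ball y R) \<le> 1/2))"

lemma R0: "R0 > 0" "R0 \<le> 1/4" "measure \<nu> (ball y R0) \<le> 1/2"
  using someI_ex[OF ex_R0] unfolding R0_def[symmetric] by auto

text \<open>A ball of radius \<open>R0\<close> has at most half of the \<nu>-mass, as the mixing
  estimate requires, and fits into one chart, as Cauchy's estimate requires.\<close>

definition small :: "riemann_sphere set \<Rightarrow> bool" where
  "small A \<longleftrightarrow> (\<exists>y. A \<subseteq> ball y R0)"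

lemma small_subset: "small A \<Longrightarrow> B \<subseteq> A \<Longrightarrow> small B"
  unfolding small_def by blast

lemma ball_mass_small:
  assumes "small ((f ^^ n) ` ball u (2 * \<delta>))" "0 < \<delta>" "\<delta> \<le> 4"
  shows "measure \<nu> (ball u \<delta>) \<le> (10 * C + 4) * \<rho> ^ n / \<delta>"
proof -
  obtain y where "(f ^^ n) ` ball u (2 * \<delta>) \<subseteq> ball y R0" using assms by (auto simp: small_def)
  then show ?thesis using ball_mass[OF _ _ R0(3)] assms by auto
qed

definition C3 :: real where "C3 = 240 powr t * (10 * C + 4) / c"

lemma C3_pos: "C3 > 0"
  using c_pos C_pos by (auto simp: C3_def intro!: divide_pos_pos mult_pos_pos)

text \<open>The exponent \<open>t + 1\<close> is the sum of \<open>t\<close>, from the derivative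
  bound \<open>240 / \<delta>\<close> raised to the power \<open>t\<close>, and of 1, from the
  Lipschitz constant \<open>1 / \<delta>\<close> of the bump function.\<close>

lemma image_mass:
  assumes s: "small ((f ^^ n) ` ball u (2 * \<delta>))" and \<delta>: "0 < \<delta>" "\<delta> \<le> 1/4"
  shows "\<delta> powr (t + 1) * measure \<mu> ((f ^^ n) ` ball u \<delta>) \<le> C3 * \<rho> ^ n"
proof -
  obtain y where y: "(f ^^ n) ` ball u (2 * \<delta>) \<subseteq> ball y R0" using s by (auto simp: small_def)
  have "emeasure \<mu> ((f ^^ n) ` ball u \<delta>) \<le> ennreal ((240 / \<delta>) powr t) * emeasure \<mu> (ball u \<delta>)"
  proof (rule emeasure_funpow_le)
    show "sdn n x \<le> 240 / \<delta>" if "x \<in> ball u \<delta>" for x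
      by (rule sdn_bound[OF y _ _ _ that]) (use R0(2) \<delta> in auto)
  qed simp
  then have 1: "measure \<mu> ((f ^^ n) ` ball u \<delta>) \<le> (240 / \<delta>) powr t * measure \<mu> (ball u \<delta>)"
    by (simp add: mu.emeasure_eq_measure ennreal_mult[symmetric])
  have 2: "c * measure \<mu> (ball u \<delta>) \<le> (10 * C + 4) * \<rho> ^ n / \<delta>"
    using dens'[of "ball u \<delta>"] ball_mass_small[OF s] \<delta> by auto
  have "\<delta> powr (t + 1) * measure \<mu> ((f ^^ n) ` ball u \<delta>)
      \<le> \<delta> powr (t + 1) * ((240 / \<delta>) powr t * measure \<mu> (ball u \<delta>))"
    by (intro mult_left_mono 1) auto
  also have "\<dots> = 240 powr t * \<delta> / c * (c * measure \<mu> (ball u \<delta>))"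
    using \<delta> c_pos by (simp add: powr_divide powr_add)
  also have "\<dots> \<le> 240 powr t * \<delta> / c * ((10 * C + 4) * \<rho> ^ n / \<delta>)"
    using \<delta> c_pos by (intro mult_left_mono 2) auto
  also have "\<dots> = C3 * \<rho> ^ n" using \<delta> c_pos by (simp add: C3_def)
  finally show ?thesis .
qed

section \<open>The common support of the two measures and its invariance\<close>

definition X :: "riemann_sphere set" where "X = {x. \<forall>r>0. measure \<mu> (ball x r) > 0}"

lemma X_D: "x \<in> X \<Longrightarrow> r > 0 \<Longrightarrow> measure \<mu> (ball x r) > 0"
  by (simp add: X_def)

lemma nu_pos: "x \<in> X \<Longrightarrow> r > 0 \<Longrightarrow> measure \<nu> (ball x r) > 0"
  using dens'[of "ball x r"] mult_pos_pos[OF c_pos X_D[of x r]] by auto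

text \<open>With \<open>nu_pos\<close> for the converse, \<mu> and \<nu> have the same support, so
  that the invariance of \<nu> becomes available for \<open>X\<close>.\<close>

lemma X_if_nu: 
  assumes "\<And>r. r > 0 \<Longrightarrow> measure \<nu> (ball x r) > 0"
  shows "x \<in> X"
  unfolding X_def
proof safe
  fix r :: real assume "r > 0"
  then have "measure \<mu> (ball x r) \<noteq> 0" using ac'[of "ball x r"] assms[of r] by auto
  then show "0 < measure \<mu> (ball x r)" using measure_nonneg[of \<mu> "ball x r"] by linarith
qed

lemma X_nonempty_Int:
  assumes "compact K" "measure \<nu> K > 0"
  shows "\<exists>x\<in>K. x \<in> X"
proof (rule ccontr)
  assume neg: "\<not> (\<exists>x\<in>K. x \<in> X)"
  have "\<exists>r>0. measure \<nu> (ball x r) = 0" if "x \<in> K" for x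
  proof -
    have "x \<notin> X" using neg that by blast
    then obtain r where "r > 0" "\<not> measure \<nu> (ball x r) > 0" using X_if_nu by blast
    then show ?thesis using measure_nonneg[of \<nu> "ball x r"] by force
  qed
  then obtain r where r: "\<And>x. x \<in> K \<Longrightarrow> r x > 0 \<and> measure \<nu> (ball x (r x)) = 0" by metis
  have "K \<subseteq> (\<Union>x\<in>K. ball x (r x))" using r by force
  then obtain S where S: "S \<subseteq> K" "finite S" "K \<subseteq> (\<Union>x\<in>S. ball x (r x))"
    using compactE_image[OF assms(1), of K "\<lambda>x. ball x (r x)"] by auto
  have "measure \<nu> K \<le> measure \<nu> (\<Union>x\<in>S. ball x (r x))"
    by (rule nu.finite_measure_mono) (use S in auto)
  also have "\<dots> \<le> (\<Sum>x\<in>S. measure \<nu> (ball x (r x)))"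
    by (rule nu.finite_measure_subadditive_finite) (use S in auto)
  also have "\<dots> = 0" using r S by (intro sum.neutral) auto
  finally show False using assms by simp
qed

text \<open>The least positive mass among finitely many balls of radius \<open>\<eta>/2\<close>
  covering the sphere will do: the one that contains \<open>y\<close> has positive mass and lies in
  \<open>ball y \<eta>\<close>.\<close>

lemma mass_lower_bound:
  assumes "\<eta> > 0"
  obtains m where "m > 0" "\<And>y. y \<in> X \<Longrightarrow> measure \<mu> (ball y \<eta>) \<ge> m"
proof -
  obtain S :: "riemann_sphere set" where S: "finite S" "UNIV \<subseteq> (\<Union>p\<in>S. ball p (\<eta>/2))"
    using finite_ball_cover[of "\<lambda>_. \<eta>/2"] assms by auto
  define T where "T = {p \<in> S. measure \<mu> (ball p (\<eta>/2)) > 0}"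
  define m where "m = Min (insert 1 ((\<lambda>p. measure \<mu> (ball p (\<eta>/2))) ` T))"
  have fT: "finite T" using S by (simp add: T_def)
  have "m > 0" unfolding m_def using fT by (subst Min_gr_iff) (auto simp: T_def)
  moreover have "measure \<mu> (ball y \<eta>) \<ge> m" if y: "y \<in> X" for y
  proof -
    obtain p where p: "p \<in> S" "y \<in> ball p (\<eta>/2)" using S by blast
    obtain r where r: "r > 0" "ball y r \<subseteq> ball p (\<eta>/2)" using openE[OF open_ball p(2)] by blast
    have "0 < measure \<mu> (ball y r)" using X_D y r by blast
    also have "\<dots> \<le> measure \<mu> (ball p (\<eta>/2))" by (rule mu.finite_measure_mono) (use r in auto)
    finally have "p \<in> T" using p by (simp add: T_def)
    then have "m \<le> measure \<mu> (ball p (\<eta>/2))" unfolding m_def using fT by (intro Min_le) auto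
    also have "\<dots> \<le> measure \<mu> (ball y \<eta>)"
    proof (rule mu.finite_measure_mono)
      show "ball p (\<eta>/2) \<subseteq> ball y \<eta>"
      proof
        fix z assume "z \<in> ball p (\<eta>/2)"
        then show "z \<in> ball y \<eta>" using p dist_triangle[of y z p] by (simp add: dist_commute)
      qed
    qed simp
    finally show ?thesis .
  qed
  ultimately show thesis using that by blast
qed

lemma X_forward: "x \<in> X \<Longrightarrow> f x \<in> X"
proof (rule X_if_nu)
  fix r :: real assume x: "x \<in> X" and r: "r > 0"
  have "open (f -` ball (f x) r)" using continuous_f[of UNIV] by (simp add: open_vimage)
  then obtain s where s: "s > 0" "ball x s \<subseteq> f -` ball (f x) r"
    using openE[of "f -` ball (f x) r" x] r by auto
  have "0 < measure \<nu> (ball x s)" using nu_pos x s by blast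
  also have "\<dots> \<le> measure \<nu> (f -` ball (f x) r)"
    by (rule nu.finite_measure_mono) (use s \<open>open (f -` ball (f x) r)\<close> in auto)
  finally show "0 < measure \<nu> (ball (f x) r)" by (simp add: nu_vimage)
qed

lemma X_forward_funpow: "x \<in> X \<Longrightarrow> (f ^^ n) x \<in> X"
  by (induction n) (auto intro: X_forward)

lemma null_image:
  assumes "open U" "measure \<mu> U = 0"
  shows "measure \<mu> ((f ^^ n) ` U) = 0"
proof -
  have "emeasure \<mu> ((f ^^ n) ` U) = (\<integral>\<^sup>+x\<in>(f ^^ n) ` U. 1 \<partial>\<mu>)"
    using open_map_funpow[OF assms(1), of n] by simp
  also have "\<dots> \<le> (\<integral>\<^sup>+x\<in>U. 1 * ennreal (sdn n x powr t) \<partial>\<mu>)"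
    by (rule nn_integral_funpow_le[OF assms(1)]) simp
  also have "\<dots> = 0"
    by (rule nn_integral_null_set) (use assms in \<open>auto simp: null_sets_def mu.emeasure_eq_measure\<close>)
  finally show ?thesis by (simp add: mu.emeasure_eq_measure)
qed

text \<open>Conformality maps open null sets to open null sets, so a null ball around
  \<open>x\<close> would give a null neighbourhood of \<open>(f ^^ n) x\<close>. With
  \<open>X_forward\<close>, the set \<open>X\<close> is completely invariant.\<close>

lemma X_backward_funpow:
  assumes "(f ^^ n) x \<in> X"
  shows "x \<in> X"
  unfolding X_def
proof safe
  fix r :: real assume r: "r > 0"
  have o: "open ((f ^^ n) ` ball x r)" by (simp add: open_map_funpow)
  then obtain s where s: "s > 0" "ball ((f ^^ n) x) s \<subseteq> (f ^^ n) ` ball x r"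
    using openE[of "(f ^^ n) ` ball x r" "(f ^^ n) x"] r by auto
  have "0 < measure \<mu> (ball ((f ^^ n) x) s)" using X_D assms s by blast
  also have "\<dots> \<le> measure \<mu> ((f ^^ n) ` ball x r)"
    by (rule mu.finite_measure_mono) (use s o in auto)
  finally have "measure \<mu> (ball x r) \<noteq> 0" using null_image[of "ball x r" n] by auto
  then show "0 < measure \<mu> (ball x r)" using measure_nonneg[of \<mu> "ball x r"] by linarith
qed

lemma null_misses_X: "open U \<Longrightarrow> measure \<mu> U = 0 \<Longrightarrow> U \<inter> X = {}"
proof (rule ccontr)
  assume U: "open U" "measure \<mu> U = 0" "U \<inter> X \<noteq> {}"
  then obtain x where x: "x \<in> U" "x \<in> X" by blast
  obtain r where r: "r > 0" "ball x r \<subseteq> U" using U(1) x(1) open_contains_ball by blast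
  have "0 < measure \<mu> (ball x r)" using X_D x r by blast
  also have "\<dots> \<le> measure \<mu> U" by (rule mu.finite_measure_mono) (use r U in auto)
  finally show False using U by simp
qed

text \<open>In the absence of atoms \<open>U\<close> minus a finite set keeps positive \<nu>-mass;
  so does some closed subset of it, which therefore meets \<open>X\<close>.\<close>

lemma X_avoid_finite:
  assumes "open U" "x \<in> U" "x \<in> X" "finite S"
  obtains y where "y \<in> U" "y \<in> X" "y \<notin> S"
proof -
  let ?V = "U - S"
  have bS: "S \<in> sets borel" using assms(4) by (intro borel_closed finite_imp_closed)
  have oV: "open ?V" using assms finite_imp_closed by (intro open_Diff) auto
  then obtain K :: "nat \<Rightarrow> riemann_sphere set" where K: "\<And>n. closed (K n)" "?V = (\<Union>n. K n)"
    using open_Union_closed_nat[OF oV] by metis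
  have "measure \<nu> ?V > 0"
  proof -
    obtain r where r: "r > 0" "ball x r \<subseteq> U" using assms open_contains_ball by blast
    have "measure \<nu> S = (\<Sum>p\<in>S. measure \<nu> {p})"
      by (rule nu.finite_measure_eq_sum_singleton) (use assms in auto)
    then have S0: "measure \<nu> S = 0" using no_atoms by simp
    have "0 < measure \<nu> (ball x r)" using nu_pos assms r by blast
    also have "\<dots> \<le> measure \<nu> ((U - S) \<union> S)"
      by (rule nu.finite_measure_mono) (use r borel_open[OF assms(1)] bS in auto)
    also have "\<dots> \<le> measure \<nu> ?V + measure \<nu> S"
      by (rule measure_Un_le) (use oV bS in auto)
    finally show ?thesis using S0 by simp
  qed
  moreover have "measure \<nu> ?V = 0" if "\<And>n. measure \<nu> (K n) = 0"
  proof -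
    have "emeasure \<nu> (\<Union>n. K n) = 0"
      by (rule emeasure_UN_eq_0) (use that K in \<open>auto simp: nu.emeasure_eq_measure\<close>)
    then show ?thesis using K(2) by (simp add: nu.emeasure_eq_measure)
  qed
  ultimately obtain n where "measure \<nu> (K n) \<noteq> 0" by auto
  then have "measure \<nu> (K n) > 0" using measure_nonneg[of \<nu> "K n"] by linarith
  then obtain y where "y \<in> K n" "y \<in> X" using X_nonempty_Int[OF closed_imp_compact[OF K(1)[of n]]] by blast
  then show thesis using that[of y] K(2) by blast
qed

end

section \<open>Tools from complex analysis\<close>

text \<open>Harnack's inequality on the half disc: the Cayley transform based at \<open>p a\<close>
  leads into the unit disc, where Schwarz's lemma gives the bound 1/2.\<close>

lemma Re_pos_third:
  assumes p: "p holomorphic_on ball a r" and pos: "\<And>z. z \<in> ball a r \<Longrightarrow> Re (p z) > 0"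
    and z: "z \<in> ball a (r/2)"
  shows "Re (p a) / 3 \<le> Re (p z)"
proof -
  have r: "r > 0" using z by (metis ball_eq_empty empty_iff half_gt_zero_iff not_less)
  define w0 where "w0 = p a"
  define q :: "complex \<Rightarrow> complex" where "q \<zeta> = p (a + r * \<zeta>)" for \<zeta> :: complex
  define \<phi> :: "complex \<Rightarrow> complex" where "\<phi> \<zeta> = (q \<zeta> - w0) / (q \<zeta> + cnj w0)" for \<zeta>
  have inb: "a + r * \<zeta> \<in> ball a r" if "norm \<zeta> < 1" for \<zeta> :: complex
    using that r by (simp add: dist_norm norm_mult)
  have qpos: "Re (q \<zeta>) > 0" if "norm \<zeta> < 1" for \<zeta> using pos[OF inb[OF that]] by (simp add: q_def)
  have w0: "Re w0 > 0" using pos[of a] r by (simp add: w0_def)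
  have nz: "q \<zeta> + cnj w0 \<noteq> 0" if "norm \<zeta> < 1" for \<zeta>
    using qpos[OF that] w0 by (auto simp: complex_eq_iff)
  have "(p \<circ> (\<lambda>\<zeta>. a + r * \<zeta>)) holomorphic_on ball 0 1"
    by (rule holomorphic_on_compose_gen[OF _ p]) (use inb in \<open>auto intro!: holomorphic_intros\<close>)
  then have hq: "q holomorphic_on ball 0 1" by (simp add: q_def[abs_def] o_def)
  have h\<phi>: "\<phi> holomorphic_on ball 0 1" unfolding \<phi>_def using nz by (intro holomorphic_intros hq) auto
  have lt: "norm (\<phi> \<zeta>) < 1" if "norm \<zeta> < 1" for \<zeta>
  proof -
    have "(norm (q \<zeta> - w0))\<^sup>2 < (norm (q \<zeta> + cnj w0))\<^sup>2"
      using mult_pos_pos[OF qpos[OF that] w0] unfolding cmod_power2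
      by (simp add: power2_eq_square algebra_simps)
    then have "norm (q \<zeta> - w0) < norm (q \<zeta> + cnj w0)" by (rule power_less_imp_less_base) simp
    then show ?thesis using nz[OF that] by (simp add: \<phi>_def norm_divide)
  qed
  define \<zeta> where "\<zeta> = (z - a) / r"
  have \<zeta>: "norm \<zeta> < 1/2" "z = a + r * \<zeta>" 
    using z r by (auto simp: \<zeta>_def norm_divide dist_norm norm_minus_commute field_simps)
  have "\<phi> 0 = 0" by (simp add: \<phi>_def q_def w0_def)
  then have "norm (\<phi> \<zeta>) \<le> norm \<zeta>" using Schwarz_Lemma(1)[OF h\<phi> _ lt] \<zeta> by simp
  then have "norm (\<phi> \<zeta>) \<le> 1/2" using \<zeta> by linarith
  then have "norm (q \<zeta> - w0) \<le> 1/2 * norm (q \<zeta> + cnj w0)"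
    using nz[of \<zeta>] \<zeta> by (simp add: \<phi>_def norm_divide field_simps)
  then have "(norm (q \<zeta> - w0))\<^sup>2 \<le> (1/2 * norm (q \<zeta> + cnj w0))\<^sup>2" by (intro power_mono) auto
  then have "(Re (q \<zeta>) - Re w0)\<^sup>2 + (Im (q \<zeta>) - Im w0)\<^sup>2 \<le>
      1/4 * ((Re (q \<zeta>) + Re w0)\<^sup>2 + (Im (q \<zeta>) - Im w0)\<^sup>2)"
    unfolding power_mult_distrib cmod_power2 by (simp add: power2_eq_square)
  then have "3 * (Im (q \<zeta>) - Im w0)\<^sup>2 + (Re (q \<zeta>) - Re w0)\<^sup>2 * 4 \<le> (Re (q \<zeta>) + Re w0)\<^sup>2" by simp
  moreover have "(Im (q \<zeta>) - Im w0)\<^sup>2 \<ge> 0" by simp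
  ultimately have "(Re (q \<zeta>) - Re w0)\<^sup>2 * 4 \<le> (Re (q \<zeta>) + Re w0)\<^sup>2" by linarith
  then have "(Re (q \<zeta>) - Re w0)\<^sup>2 \<le> ((Re (q \<zeta>) + Re w0) / 2)\<^sup>2"
    by (simp add: power_divide)
  then have "\<bar>Re (q \<zeta>) - Re w0\<bar> \<le> (Re (q \<zeta>) + Re w0) / 2"
    using qpos[of \<zeta>] \<zeta> w0 by (simp add: abs_le_square_iff[symmetric])
  then have "Re w0 / 3 \<le> Re (q \<zeta>)" by (simp add: abs_if split: if_splits)
  then show ?thesis using \<zeta> by (simp add: w0_def q_def)
qed

text \<open>As \<open>v\<close> is omitted, \<open>(g - v) / 7\<close> has a logarithm; its real
  part is negative since \<open>|g - v| < 3 + 4\<close>. Harnack's inequality then bounds the cube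
  of \<open>|h z|\<close> by \<open>|h a|\<close>, whence the cube in the choice of
  \<open>\<epsilon>\<close>.\<close>

lemma omitted_value_small:
  assumes "\<eta> > 0"
  obtains \<epsilon> where "\<epsilon> > 0"
    "\<And>g a r v z. g holomorphic_on ball a r \<Longrightarrow> (\<And>z. z \<in> ball a r \<Longrightarrow> cmod (g z) < 3) \<Longrightarrow>
      v \<notin> g ` ball a r \<Longrightarrow> cmod (g a - v) < \<epsilon> \<Longrightarrow> z \<in> ball a (r/2) \<Longrightarrow> cmod (g z - g a) < \<eta>"
proof
  define \<epsilon> where "\<epsilon> = min (min 1 (\<eta>/2)) ((\<eta>/14)^3)"
  show e0: "\<epsilon> > 0" using assms by (simp add: \<epsilon>_def)
  fix g :: "complex \<Rightarrow> complex" and a v z :: complex and r :: real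
  assume g: "g holomorphic_on ball a r" and b: "\<And>z. z \<in> ball a r \<Longrightarrow> cmod (g z) < 3"
    and v: "v \<notin> g ` ball a r" and ev: "cmod (g a - v) < \<epsilon>" and z: "z \<in> ball a (r/2)"
  have r: "r > 0" using z by (metis ball_eq_empty empty_iff half_gt_zero_iff not_less)
  have v4: "cmod v < 4"
    using b[of a] r ev norm_triangle_ineq2[of v "g a"] by (simp add: \<epsilon>_def norm_minus_commute)
  define h where "h z = (g z - v) / 7" for z
  have hh: "h holomorphic_on ball a r" unfolding h_def by (intro holomorphic_intros g) auto
  have hnz: "h z \<noteq> 0" if "z \<in> ball a r" for z using v that by (auto simp: h_def)
  have hlt: "cmod (h z) < 1" if "z \<in> ball a r" for z
    using b[OF that] v4 norm_triangle_ineq4[of "g z" v] by (simp add: h_def norm_divide)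
  obtain l where l: "l holomorphic_on ball a r" "\<And>z. z \<in> ball a r \<Longrightarrow> h z = exp (l z)"
    using contractible_imp_holomorphic_log[OF hh convex_imp_contractible[OF convex_ball] hnz] by metis
  have neg: "Re (- l z) > 0" if "z \<in> ball a r" for z
    using hlt[OF that] l(2)[OF that] by simp
  have "Re (- l a) / 3 \<le> Re (- l z)"
    by (rule Re_pos_third[of _ a r]) (use l neg z in \<open>auto intro!: holomorphic_intros\<close>)
  then have "exp (3 * Re (l z)) \<le> exp (Re (l a))" by simp
  moreover have "z \<in> ball a r" using z r by auto
  moreover from this have "cmod (h z) ^ 3 = exp (3 * Re (l z))"
    using l(2)[of z] exp_of_nat_mult[of 3 "Re (l z)"] by simp
  moreover have "cmod (h a) = exp (Re (l a))" using l(2)[of a] r by simp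
  ultimately have "cmod (h z) ^ 3 \<le> cmod (h a)" by metis
  moreover have "cmod (h a) < (\<eta>/14)^3"
  proof -
    have "cmod (h a) = cmod (g a - v) / 7" by (simp add: h_def norm_divide)
    also have "\<dots> \<le> cmod (g a - v)" by simp
    also have "\<dots> < (\<eta>/14)^3" using ev by (simp add: \<epsilon>_def)
    finally show ?thesis .
  qed
  ultimately have "cmod (h z) ^ 3 < (\<eta>/14)^3" by linarith
  then have "cmod (h z) < \<eta>/14" by (rule power_less_imp_less_base) (use assms in simp)
  then have "cmod (g z - v) < \<eta>/2" by (simp add: h_def norm_divide)
  moreover have "cmod (g a - v) < \<eta>/2" using ev by (simp add: \<epsilon>_def)
  ultimately show "cmod (g z - g a) < \<eta>"
    using norm_triangle_ineq4[of "g z - v" "g a - v"] by simp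
qed

text \<open>If \<^term>\<open>v\<close> is omitted by a univalent function \<^term>\<open>g\<close>, then \<open>log (g - v)\<close> omits all of its
  translates by \<open>2\<pi>i\<close>; its image thus contains no large disc and Bloch's theorem bounds its derivative.\<close>

lemma univalent_growth:
  assumes g: "g holomorphic_on ball 0 1" and inj: "inj_on g (ball 0 1)" and v: "v \<notin> g ` ball 0 1"
    and \<zeta>: "\<zeta> \<in> ball 0 1"
  shows "cmod (g 0 - v) \<le> cmod (g \<zeta> - v) * (1 / (1 - cmod \<zeta>)) ^ 48"
proof -
  have nz: "g z - v \<noteq> 0" if "z \<in> ball 0 1" for z using v that by auto
  define gv where "gv z = g z - v" for z
  have gv: "gv holomorphic_on ball 0 1" unfolding gv_def by (intro holomorphic_intros g)
  have gvnz: "gv z \<noteq> 0" if "z \<in> ball 0 1" for z using nz[OF that] by (simp add: gv_def)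
  obtain l where l0: "l holomorphic_on ball 0 1" "\<And>z. z \<in> ball 0 1 \<Longrightarrow> gv z = exp (l z)"
    using contractible_imp_holomorphic_log[OF gv convex_imp_contractible[OF convex_ball] gvnz] by metis
  then have l: "l holomorphic_on ball 0 1" "\<And>z. z \<in> ball 0 1 \<Longrightarrow> g z - v = exp (l z)"
    by (auto simp: gv_def)
  have bound: "norm (deriv l z) \<le> 48 / (1 - norm z)" if z: "z \<in> ball 0 1" for z
  proof (rule ccontr)
    assume "\<not> norm (deriv l z) \<le> 48 / (1 - norm z)"
    \<comment> \<open>Bloch's theorem with constant 1/12 yields a disc of radius 4 in the image. As
      4 exceeds pi, it contains \<open>b - pi * \<i>\<close> and \<open>b + pi * \<i>\<close>, which
      have the same exponential; hence 48 = 12 * 4.\<close>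
    then have big: "4 \<le> (1 - norm z) * norm (deriv l z) / 12" using z by (simp add: field_simps)
    have sub: "ball z (1 - norm z) \<subseteq> ball 0 1"
    proof
      fix w assume "w \<in> ball z (1 - norm z)"
      then show "w \<in> ball 0 1" using norm_triangle_sub[of w z] by (simp add: dist_norm norm_minus_commute)
    qed
    have "l holomorphic_on ball z (1 - norm z)" using l(1) sub holomorphic_on_subset by blast
    then obtain b where b: "ball b 4 \<subseteq> l ` ball z (1 - norm z)"
      using Bloch[OF _ _ big] z by auto
    have "b - pi * \<i> \<in> ball b 4" "b + pi * \<i> \<in> ball b 4"
      using pi_less_4 by (auto simp: dist_norm norm_mult)
    then have "b - pi * \<i> \<in> l ` ball z (1 - norm z)" "b + pi * \<i> \<in> l ` ball z (1 - norm z)"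
      using b by (auto simp only: subset_iff)
    then obtain z1 z2 where z1: "b - pi * \<i> = l z1" "z1 \<in> ball z (1 - norm z)"
      and z2: "b + pi * \<i> = l z2" "z2 \<in> ball z (1 - norm z)" by (elim imageE)
    then have z12: "z1 \<in> ball 0 1" "z2 \<in> ball 0 1" "l z1 = b - pi * \<i>" "l z2 = b + pi * \<i>"
      using subsetD[OF sub z1(2)] subsetD[OF sub z2(2)] by simp_all
    have "l z2 = l z1 + 2 * of_real pi * \<i>" using z12 by simp
    then have "exp (l z2) = exp (l z1)" by (simp add: exp_add)
    then have "g z1 - v = g z2 - v" using l(2)[OF z12(1)] l(2)[OF z12(2)] by simp
    then have "z1 = z2" using inj_onD[OF inj _ z12(1,2)] by simp
    then have "b - pi * \<i> = b + pi * \<i>" using z1 z2 by simp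
    then show False by (simp add: complex_eq_iff)
  qed
  define R where "R = norm \<zeta>"
  have R: "0 \<le> R" "R < 1" using \<zeta> by (auto simp: R_def)
  have inb: "of_real x * \<zeta> \<in> ball 0 1" if "0 \<le> x" "x \<le> 1" for x :: real
    using that R mult_left_le_one_le[of R x] by (simp add: norm_mult R_def)
  have R1: "x * R < 1" if "0 \<le> x" "x \<le> 1" for x
    using that R mult_left_le_one_le[of R x] by linarith
  \<comment> \<open>Integrating the bound on \<open>deriv l\<close> along the radius to
    \<open>\<zeta>\<close> gives \<open>- 48 * ln (1 - R)\<close>, the logarithm of the factor in
    the statement.\<close>
  have "norm (l (of_real 1 * \<zeta>) - l (of_real 0 * \<zeta>)) \<le> - 48 * ln (1 - 1 * R) - (- 48 * ln (1 - 0 * R))"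
  proof (rule differentiable_bound_general[of 0 1 "\<lambda>x. l (of_real x * \<zeta>)" "\<lambda>x. - 48 * ln (1 - x * R)"
        "\<lambda>x. \<zeta> * deriv l (of_real x * \<zeta>)" "\<lambda>x. 48 * R / (1 - x * R)"])
    show "continuous_on {0..1} (\<lambda>x. l (complex_of_real x * \<zeta>))"
      by (rule continuous_on_compose2[OF holomorphic_on_imp_continuous_on[OF l(1)]])
         (use inb in \<open>auto intro!: continuous_intros\<close>)
    show "continuous_on {0..1} (\<lambda>x. - 48 * ln (1 - x * R))"
      using R1 by (intro continuous_intros) (auto simp: less_imp_neq)
    fix x :: real assume x: "0 < x" "x < 1"
    have "(l has_field_derivative deriv l (of_real x * \<zeta>)) (at (of_real x * \<zeta>))"
      by (rule holomorphic_derivI[OF l(1)]) (use inb x in auto)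
    moreover have "((\<lambda>x. of_real x * \<zeta>) has_vector_derivative \<zeta>) (at x)"
      by (auto intro!: derivative_eq_intros)
    ultimately show "((\<lambda>x. l (of_real x * \<zeta>)) has_vector_derivative \<zeta> * deriv l (of_real x * \<zeta>)) (at x)"
      using field_vector_diff_chain_at by (fastforce simp: o_def)
    have "((\<lambda>x. - 48 * ln (1 - x * R)) has_real_derivative 48 * R / (1 - x * R)) (at x)"
      using R1[of x] x by (auto intro!: derivative_eq_intros)
    then show "((\<lambda>x. - 48 * ln (1 - x * R)) has_vector_derivative 48 * R / (1 - x * R)) (at x)"
      by (simp add: has_real_derivative_iff_has_vector_derivative)
    have "norm (deriv l (of_real x * \<zeta>)) \<le> 48 / (1 - x * R)"
      using bound[OF inb[of x]] x by (auto simp: norm_mult R_def)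
    from mult_left_mono[OF this R(1)]
    have "norm (\<zeta> * deriv l (of_real x * \<zeta>)) \<le> R * (48 / (1 - x * R))"
      by (simp add: norm_mult R_def)
    then show "norm (\<zeta> * deriv l (of_real x * \<zeta>)) \<le> 48 * R / (1 - x * R)" by (simp add: mult.commute)
  qed simp
  then have "norm (l \<zeta> - l 0) \<le> - 48 * ln (1 - R)" by simp
  then have "Re (l 0) \<le> Re (l \<zeta>) + - 48 * ln (1 - R)"
    using abs_Re_le_cmod[of "l \<zeta> - l 0"] by simp
  then have "exp (Re (l 0)) \<le> exp (Re (l \<zeta>)) * exp (- 48 * ln (1 - R))" by (simp add: exp_add[symmetric])
  moreover have "exp (- 48 * ln (1 - R)) = (1 / (1 - R)) ^ 48"
  proof -
    have "exp (- 48 * ln (1 - R)) = exp (of_nat 48 * ln (1 / (1 - R)))" using R by (simp add: ln_div)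
    also have "\<dots> = (1 / (1 - R)) ^ 48" using R by (subst exp_of_nat_mult) simp
    finally show ?thesis .
  qed
  ultimately show ?thesis using l(2)[of 0] l(2)[OF \<zeta>] by (simp add: R_def)
qed

section \<open>Blaschke products and simply connected plane domains\<close>

lemma compact_in_ball:
  fixes K :: "complex set"
  assumes "compact K" "K \<subseteq> ball 0 1"
  obtains s where "0 < s" "s < 1" "K \<subseteq> ball 0 s"
proof (cases "K = {}")
  case True then show ?thesis using that[of "1/2"] by auto
next
  case False
  obtain x where x: "x \<in> K" "\<And>y. y \<in> K \<Longrightarrow> norm y \<le> norm x"
    using continuous_attains_sup[OF assms(1) False continuous_on_norm_id] by auto
  have "norm x < 1" using x assms by auto
  then have "norm y < (1 + norm x) / 2" if "y \<in> K" for y using x(2)[OF that] by simp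
  then have "K \<subseteq> ball 0 ((1 + norm x) / 2)" by auto
  moreover have "0 < (1 + norm x) / 2" by (simp add: add_pos_nonneg)
  ultimately show ?thesis using that[of "(1 + norm x) / 2"] \<open>norm x < 1\<close> by simp
qed

lemma factor_zeros:
  assumes "finite Z" "open S" "G holomorphic_on S" "Z \<subseteq> S" "\<And>z. z \<in> Z \<Longrightarrow> G z = 0"
  shows "\<exists>H. H holomorphic_on S \<and> (\<forall>z\<in>S. G z = (\<Prod>\<zeta>\<in>Z. z - \<zeta>) * H z)"
  using assms
proof (induction Z rule: finite_induct)
  case empty then show ?case by auto
next
  case (insert x Z)
  obtain H where H: "H holomorphic_on S" "\<And>z. z \<in> S \<Longrightarrow> G z = (\<Prod>\<zeta>\<in>Z. z - \<zeta>) * H z"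
    using insert by auto
  have "(\<Prod>\<zeta>\<in>Z. x - \<zeta>) \<noteq> 0" using insert by auto
  then have Hx: "H x = 0" using H(2)[of x] insert by auto
  define K where "K z = (if z = x then deriv H x else (H z - H x) / (z - x))" for z
  have "K holomorphic_on S" unfolding K_def by (rule pole_lemma_open) (use H insert in auto)
  moreover have "G z = (\<Prod>\<zeta>\<in>insert x Z. z - \<zeta>) * K z" if "z \<in> S" for z
    using H(2)[OF that] insert Hx by (auto simp: K_def)
  ultimately show ?case by blast
qed

text \<open>By \<open>bdry\<close> the modulus of \<open>G\<close> tends to 1 at the circle, so the
  maximum principle bounds the Blaschke product with zeros \<open>Z\<close>, divided by
  \<open>G\<close>, by 1; evaluation at 0 gives the claim.\<close>

lemma Blaschke_bound:
  assumes G: "G holomorphic_on ball 0 1"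
    and Z: "finite Z" "Z = {z \<in> ball 0 1. G z = 0}" and simple: "\<And>z. z \<in> Z \<Longrightarrow> deriv G z \<noteq> 0"
    and bdry: "\<And>\<epsilon>. \<epsilon> > 0 \<Longrightarrow> \<exists>K. compact K \<and> K \<subseteq> ball 0 1 \<and> (\<forall>z\<in>ball 0 1 - K. cmod (G z) \<ge> 1 - \<epsilon>)"
  shows "(\<Prod>\<zeta>\<in>Z. cmod \<zeta>) \<le> cmod (G 0)"
proof -
  obtain H where H: "H holomorphic_on ball 0 1" "\<And>z. z \<in> ball 0 1 \<Longrightarrow> G z = (\<Prod>\<zeta>\<in>Z. z - \<zeta>) * H z"
    using factor_zeros[OF Z(1) open_ball G] Z(2) by blast
  \<comment> \<open>A zero of \<open>H\<close> would be a multiple zero of \<open>G\<close>.\<close>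
  have Hnz: "H z \<noteq> 0" if z: "z \<in> ball 0 1" for z
  proof
    assume H0: "H z = 0"
    then have "G z = 0" using H(2)[OF z] by simp
    then have "z \<in> Z" using z Z by auto
    define P where "P w = (\<Prod>\<zeta>\<in>Z. w - \<zeta>)" for w
    have "P z = 0" using \<open>z \<in> Z\<close> Z(1) by (auto simp: P_def)
    have hP: "P holomorphic_on UNIV" unfolding P_def by (intro holomorphic_intros)
    have "((\<lambda>w. P w * H w) has_field_derivative P z * deriv H z + deriv P z * H z) (at z)"
      using DERIV_mult'[OF holomorphic_derivI[OF hP open_UNIV] holomorphic_derivI[OF H(1) open_ball z]] by simp
    then have "((\<lambda>w. P w * H w) has_field_derivative 0) (at z)" using H0 \<open>P z = 0\<close> by simp
    then have "(G has_field_derivative 0) (at z)"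
      by (rule has_field_derivative_transform_within_open[OF _ open_ball z]) (use H(2) in \<open>auto simp: P_def\<close>)
    then show False using simple[OF \<open>z \<in> Z\<close>] DERIV_imp_deriv by blast
  qed
  have cz: "1 - cnj \<zeta> * z \<noteq> 0" if "cmod \<zeta> < 1" "cmod z \<le> 1" for \<zeta> z
  proof
    assume "1 - cnj \<zeta> * z = 0"
    then have "cmod \<zeta> * cmod z = 1" by (metis complex_mod_cnj eq_iff_diff_eq_0 norm_mult norm_one)
    then show False using that mult_left_le[of "cmod z" "cmod \<zeta>"] by simp
  qed
  have Z1: "cmod \<zeta> < 1" if "\<zeta> \<in> Z" for \<zeta> using that Z by auto
  \<comment> \<open>\<open>Q * G\<close> is the Blaschke product with zero set \<open>Z\<close>;
    writing \<open>Q\<close> through \<open>H\<close> removes the common zeros.\<close>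
  define Q where "Q z = 1 / (H z * (\<Prod>\<zeta>\<in>Z. 1 - cnj \<zeta> * z))" for z
  have den: "H z * (\<Prod>\<zeta>\<in>Z. 1 - cnj \<zeta> * z) \<noteq> 0" if "z \<in> ball 0 1" for z
    using Hnz[OF that] cz Z1 that Z(1) by simp
  have hQ: "Q holomorphic_on ball 0 1" unfolding Q_def using den by (intro holomorphic_intros H(1)) auto
  have Qle: "cmod (Q z) \<le> 1 / cmod (G z)" if z: "z \<in> ball 0 1" "G z \<noteq> 0" for z
  proof -
    have zZ: "z \<notin> Z" using z Z by auto
    have m: "cmod (z - \<zeta>) \<le> cmod (1 - cnj \<zeta> * z)" if "\<zeta> \<in> Z" for \<zeta>
    proof -
      have "cmod ((z - \<zeta>) / (1 - cnj \<zeta> * z)) < 1"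
        using Moebius_function_norm_lt_1[OF Z1[OF that], of z 0] z by (simp add: Moebius_function_simple)
      then show ?thesis using cz[OF Z1[OF that], of z] z by (simp add: norm_divide)
    qed
    have "cmod (G z) = (\<Prod>\<zeta>\<in>Z. cmod (z - \<zeta>)) * cmod (H z)"
      using H(2)[OF z(1)] by (simp add: norm_mult prod_norm)
    also have "\<dots> \<le> (\<Prod>\<zeta>\<in>Z. cmod (1 - cnj \<zeta> * z)) * cmod (H z)"
      by (intro mult_right_mono prod_mono) (use m in auto)
    finally have "cmod (G z) \<le> cmod (H z * (\<Prod>\<zeta>\<in>Z. 1 - cnj \<zeta> * z))"
      by (simp add: norm_mult prod_norm mult.commute)
    moreover have "0 < cmod (H z * (\<Prod>\<zeta>\<in>Z. 1 - cnj \<zeta> * z))" unfolding zero_less_norm_iff by (rule den[OF z(1)])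
    moreover have "0 < cmod (G z)" using z by simp
    ultimately show ?thesis unfolding Q_def norm_divide norm_one by (intro divide_left_mono mult_pos_pos) auto
  qed
  have "cmod (Q 0) * (1 - \<epsilon>) \<le> 1" if \<epsilon>: "0 < \<epsilon>" "\<epsilon> < 1" for \<epsilon>
  proof -
    obtain K where K: "compact K" "K \<subseteq> ball 0 1" "\<And>z. z \<in> ball 0 1 - K \<Longrightarrow> cmod (G z) \<ge> 1 - \<epsilon>"
      using bdry[OF \<epsilon>(1)] by blast
    obtain s where s: "s > 0" "s < 1" "K \<subseteq> ball 0 s" by (rule compact_in_ball[OF K(1,2)])
    have fr: "cmod (Q z) \<le> 1 / (1 - \<epsilon>)" if "z \<in> frontier (ball 0 s)" for z
    proof -
      have nz: "norm z = s" using that s by (simp add: frontier_ball)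
      then have z: "z \<in> ball 0 1 - K" using s by (auto simp: subset_iff)
      then have G1: "cmod (G z) \<ge> 1 - \<epsilon>" by (rule K(3))
      then have "cmod (G z) > 0" using \<epsilon> by linarith
      then have "cmod (Q z) \<le> 1 / cmod (G z)" using Qle[of z] z by simp
      moreover note G1
      ultimately show ?thesis using \<epsilon> frac_le[of 1 1 "1 - \<epsilon>" "cmod (G z)"] by linarith
    qed
    have "cmod (Q 0) \<le> 1 / (1 - \<epsilon>)"
    proof (rule maximum_modulus_frontier[of Q "ball 0 s"])
      show "Q holomorphic_on interior (ball 0 s)" using hQ by (rule holomorphic_on_subset) (use s in auto)
      show "continuous_on (closure (ball 0 s)) Q"
        by (rule continuous_on_subset[OF holomorphic_on_imp_continuous_on[OF hQ]]) (use s in auto)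
    qed (use fr s in auto)
    then show ?thesis using \<epsilon> by (simp add: field_simps)
  qed
  then have ev: "\<forall>\<^sub>F \<epsilon> in at_right 0. cmod (Q 0) * (1 - \<epsilon>) \<le> 1"
    by (intro eventually_at_rightI[of 0 1]) auto
  have "((\<lambda>\<epsilon>. cmod (Q 0) * (1 - \<epsilon>)) \<longlongrightarrow> cmod (Q 0) * (1 - 0)) (at_right 0)"
    by (intro tendsto_intros)
  then have "cmod (Q 0) * (1 - 0) \<le> 1" using ev by (rule tendsto_upperbound) simp
  then have "1 / cmod (H 0) \<le> 1" by (simp add: Q_def norm_divide)
  then have "1 \<le> cmod (H 0)" using Hnz[of 0] by (simp add: field_simps)
  moreover have "cmod (G 0) = (\<Prod>\<zeta>\<in>Z. cmod \<zeta>) * cmod (H 0)"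
    using H(2)[of 0] by (simp add: norm_mult prod_norm[symmetric])
  moreover have "(\<Prod>\<zeta>\<in>Z. cmod \<zeta>) \<ge> 0" by (intro prod_nonneg) auto
  ultimately show ?thesis using mult_left_mono[of 1 "cmod (H 0)" "\<Prod>\<zeta>\<in>Z. cmod \<zeta>"] by simp
qed

text \<open>Points outside \<open>S\<close> are never in the inside of a loop in \<open>S\<close>,
  so the winding numbers about them vanish.\<close>

lemma simply_connected_if_inside:
  fixes S :: "complex set"
  assumes "open S" "connected S"
    and inside: "\<And>T. compact T \<Longrightarrow> connected T \<Longrightarrow> T \<subseteq> S \<Longrightarrow> inside T \<subseteq> S"
  shows "simply_connected S"
proof -
  have "winding_number g z = 0"
    if g: "path g" "path_image g \<subseteq> S" "pathfinish g = pathstart g" "z \<notin> S" for g z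
  proof (rule winding_number_zero_in_outside[OF g(1,3)])
    have "inside (path_image g) \<subseteq> S"
      by (rule inside) (use g in \<open>auto simp: compact_path_image connected_path_image\<close>)
    then show "z \<in> outside (path_image g)"
      using g inside_Un_outside[of "path_image g"] by blast
  qed
  then show ?thesis unfolding simply_connected_eq_winding_number_zero[OF assms(1)] using assms(2) by blast
qed

text \<open>The maximum principle on the inside of \<open>T\<close>; the bound stays strict because
  the maximum over the compact set \<open>T\<close> is attained.\<close>

lemma inside_maximum_modulus:
  fixes g :: "complex \<Rightarrow> complex"
  assumes T: "compact T" and U: "open U" "T \<union> inside T \<subseteq> U" and g: "g holomorphic_on U"
    and le: "\<And>z. z \<in> T \<Longrightarrow> dist a (g z) < r" and z: "z \<in> inside T"
  shows "dist a (g z) < r"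
proof -
  have op: "open (inside T)" using T by (simp add: compact_imp_closed open_inside)
  have fr: "frontier (inside T) \<subseteq> T" using T by (simp add: compact_imp_closed frontier_inside_subset)
  have cl: "closure (inside T) \<subseteq> T \<union> inside T" using fr op by (auto simp: frontier_def interior_open)
  have "T \<noteq> {}" using z by auto
  have cg: "continuous_on T (\<lambda>z. dist a (g z))"
    by (intro continuous_intros continuous_on_subset[OF holomorphic_on_imp_continuous_on[OF g]]) (use U in auto)
  obtain x where x: "x \<in> T" "\<And>y. y \<in> T \<Longrightarrow> dist a (g y) \<le> dist a (g x)"
    using continuous_attains_sup[OF T \<open>T \<noteq> {}\<close> cg] by auto
  have "norm (g z - a) \<le> dist a (g x)"
  proof (rule maximum_modulus_frontier[of "\<lambda>z. g z - a" "inside T"])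
    show "(\<lambda>z. g z - a) holomorphic_on interior (inside T)"
      by (intro holomorphic_intros holomorphic_on_subset[OF g]) (use U interior_subset in blast)
    show "continuous_on (closure (inside T)) (\<lambda>z. g z - a)"
      by (intro continuous_intros continuous_on_subset[OF holomorphic_on_imp_continuous_on[OF g]]) (use U cl in blast)
    show "bounded (inside T)" using T by (simp add: bounded_inside compact_imp_bounded)
    show "norm (g w - a) \<le> dist a (g x)" if "w \<in> frontier (inside T)" for w
      using x(2)[of w] fr that by (auto simp: dist_norm norm_minus_commute)
  qed (use z in auto)
  then show ?thesis using le[OF x(1)] by (simp add: dist_norm norm_minus_commute)
qed

text \<open>The Riemann map of \<^term>\<open>S\<close> centred at \<^term>\<open>p\<close> turns \<^term>\<open>F\<close> into a finite Blaschke product, which has a zero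
  at distance at least \<open>1 / (5 D)\<close> from the unit circle; \<open>univalent_growth\<close> compares this zero with \<^term>\<open>p\<close>.\<close>

lemma near_preimage:
  fixes S :: "complex set" and F :: "complex \<Rightarrow> complex"
  assumes S: "open S" "simply_connected S" "S \<noteq> UNIV" and F: "F holomorphic_on S" and R: "R > 0"
    and FS: "F ` S \<subseteq> ball a R" and proper: "\<And>r. r < R \<Longrightarrow> compact {z \<in> S. dist a (F z) \<le> r}"
    and y: "dist a y \<le> R / 8" and Z: "Z = {z \<in> S. F z = y}" "finite Z" "card Z \<le> D"
    and simple: "\<And>z. z \<in> Z \<Longrightarrow> deriv F z \<noteq> 0"
    and p: "p \<in> S" "dist a (F p) \<le> R / 2"
    and \<eta>: "\<And>z. z \<in> Z \<Longrightarrow> \<exists>v. v \<notin> S \<and> cmod (z - v) \<le> \<eta>"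
  shows "\<exists>z\<in>Z. cmod (p - z) \<le> 2 * \<eta> * (5 * real D) ^ 48"
proof -
  have "S \<noteq> {}" using p by auto
  then obtain f0 g0 where f0: "f0 holomorphic_on S" and g0: "g0 holomorphic_on ball 0 1"
    and fg: "\<And>z. z \<in> S \<Longrightarrow> f0 z \<in> ball 0 1 \<and> g0 (f0 z) = z" "\<And>z. z \<in> ball 0 1 \<Longrightarrow> g0 z \<in> S \<and> f0 (g0 z) = z"
    using Riemann_mapping_theorem[of S] S by blast
  define w0 where "w0 = f0 p"
  have w0: "cmod w0 < 1" using fg(1)[OF p(1)] by (simp add: w0_def)
  \<comment> \<open>Moebius maps of the disc re-centre the Riemann map so that
    \<open>g 0 = p\<close>.\<close>
  define M where "M = Moebius_function 0 (- w0)"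
  define N where "N = Moebius_function 0 w0"
  have hM: "M holomorphic_on ball 0 1" "N holomorphic_on ball 0 1"
    using w0 by (auto simp: M_def N_def intro!: Moebius_function_holomorphic)
  have M1: "M z \<in> ball 0 1" "N z \<in> ball 0 1" if "z \<in> ball 0 1" for z
    using that w0 by (auto simp: M_def N_def intro!: Moebius_function_norm_lt_1)
  have MN: "M (N z) = z" "N (M z) = z" if "z \<in> ball 0 1" for z
    using that w0 unfolding M_def N_def by (auto intro!: Moebius_function_compose)
  define g where "g \<zeta> = g0 (M \<zeta>)" for \<zeta>
  define k where "k z = N (f0 z)" for z
  have gk: "g (k z) = z" "k z \<in> ball 0 1" if "z \<in> S" for z
    using fg(1)[OF that] MN M1 by (auto simp: g_def k_def simp del: mem_ball mem_ball_0)
  have kg: "k (g \<zeta>) = \<zeta>" "g \<zeta> \<in> S" if "\<zeta> \<in> ball 0 1" for \<zeta>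
    using fg(2)[OF M1(1)[OF that]] MN[OF that] by (auto simp: g_def k_def)
  have "(g0 \<circ> M) holomorphic_on ball 0 1" by (rule holomorphic_on_compose_gen[OF hM(1) g0]) (use M1 in blast)
  then have hg: "g holomorphic_on ball 0 1" by (simp add: g_def[abs_def] o_def)
  have "(N \<circ> f0) holomorphic_on S" by (rule holomorphic_on_compose_gen[OF f0 hM(2)]) (use fg(1) in blast)
  then have ck: "continuous_on S k" by (simp add: k_def[abs_def] o_def holomorphic_on_imp_continuous_on)
  have g_0: "g 0 = p" using fg(1)[OF p(1)] by (simp add: g_def M_def Moebius_function_of_zero w0_def)
  have injg: "inj_on g (ball 0 1)" using kg(1) by (metis inj_onI)
  define y' where "y' = (y - a) / R"
  have y': "cmod y' \<le> 1/8" using y R by (simp add: y'_def norm_divide dist_norm norm_minus_commute field_simps)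
  define h where "h \<zeta> = (F (g \<zeta>) - a) / R" for \<zeta>
  have h1: "h \<zeta> \<in> ball 0 1" if "\<zeta> \<in> ball 0 1" for \<zeta>
  proof -
    have "dist a (F (g \<zeta>)) < R" using FS kg(2)[OF that] by auto
    then show ?thesis using R by (simp add: h_def norm_divide dist_norm norm_minus_commute)
  qed
  \<comment> \<open>\<open>m\<close> moves the normalised target \<open>y'\<close> to 0, so the
    zeros of \<open>G\<close> are exactly the points of the disc over \<open>y\<close>.\<close>
  define m where "m = Moebius_function 0 y'"
  define m' where "m' = Moebius_function 0 (- y')"
  have y1: "cmod y' < 1" using y' by linarith
  have hm: "m holomorphic_on ball 0 1" "m' holomorphic_on ball 0 1"
    using y1 by (auto simp: m_def m'_def intro!: Moebius_function_holomorphic)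
  have mm: "m' (m z) = z" "m z \<in> ball 0 1" "m' z \<in> ball 0 1" if "z \<in> ball 0 1" for z
    using that y1 unfolding m_def m'_def by (auto intro!: Moebius_function_compose Moebius_function_norm_lt_1)
  define G where "G \<zeta> = m (h \<zeta>)" for \<zeta>
  have "(F \<circ> g) holomorphic_on ball 0 1" by (rule holomorphic_on_compose_gen[OF hg F]) (use kg in blast)
  then have hh: "h holomorphic_on ball 0 1" unfolding h_def using R by (intro holomorphic_intros) (auto simp: o_def)
  have "(m \<circ> h) holomorphic_on ball 0 1" by (rule holomorphic_on_compose_gen[OF hh hm(1)]) (use h1 in blast)
  then have hG: "G holomorphic_on ball 0 1" by (simp add: G_def[abs_def] o_def)
  have m0: "m z = 0 \<longleftrightarrow> z = y'" if "z \<in> ball 0 1" for z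
    using mm(1)[OF that] mm(1)[of y'] y1 by (auto simp: m_def Moebius_function_eq_zero)
  have hy: "h \<zeta> = y' \<longleftrightarrow> F (g \<zeta>) = y" for \<zeta> using R by (simp add: h_def y'_def)
  have G0: "G \<zeta> = 0 \<longleftrightarrow> g \<zeta> \<in> Z" if "\<zeta> \<in> ball 0 1" for \<zeta>
    using m0[OF h1[OF that]] hy[of \<zeta>] kg(2)[OF that] by (simp add: G_def Z)
  define ZG where "ZG = {\<zeta> \<in> ball 0 1. G \<zeta> = 0}"
  have ZGk: "ZG \<subseteq> k ` Z"
  proof
    fix \<zeta> assume "\<zeta> \<in> ZG"
    then have "\<zeta> = k (g \<zeta>)" "g \<zeta> \<in> Z" using kg(1) G0 by (auto simp: ZG_def simp del: mem_ball mem_ball_0)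
    then show "\<zeta> \<in> k ` Z" by blast
  qed
  have finZG: "finite ZG" using ZGk Z(2) finite_surj by blast
  have "card ZG \<le> card (k ` Z)" by (rule card_mono[OF _ ZGk]) (use Z in auto)
  also have "\<dots> \<le> D" using card_image_le[OF Z(2), of k] Z(3) by linarith
  finally have cardZG: "card ZG \<le> D" .
  have dG: "deriv G \<zeta> \<noteq> 0" if "\<zeta> \<in> ZG" for \<zeta>
  proof -
    have \<zeta>: "\<zeta> \<in> ball 0 1" "g \<zeta> \<in> Z" using that G0 by (auto simp: ZG_def simp del: mem_ball mem_ball_0)
    have d1: "(g has_field_derivative deriv g \<zeta>) (at \<zeta>)" by (rule holomorphic_derivI[OF hg open_ball \<zeta>(1)])
    have n1: "deriv g \<zeta> \<noteq> 0" by (rule holomorphic_injective_imp_regular[OF hg open_ball injg \<zeta>(1)])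
    have d2: "(F has_field_derivative deriv F (g \<zeta>)) (at (g \<zeta>))"
      by (rule holomorphic_derivI[OF F S(1)]) (use \<zeta> Z in auto)
    have hz: "h \<zeta> = y'" using hy \<zeta> Z by auto
    have injm: "inj_on m (ball 0 1)" using mm(1) by (metis inj_onI)
    have d3: "(m has_field_derivative deriv m (h \<zeta>)) (at (h \<zeta>))"
      by (rule holomorphic_derivI[OF hm(1) open_ball h1[OF \<zeta>(1)]])
    have n3: "deriv m (h \<zeta>) \<noteq> 0" by (rule holomorphic_injective_imp_regular[OF hm(1) open_ball injm h1[OF \<zeta>(1)]])
    have "((\<lambda>z. F (g z)) has_field_derivative deriv F (g \<zeta>) * deriv g \<zeta>) (at \<zeta>)"
      by (rule DERIV_chain2[OF d2 d1])
    then have "(h has_field_derivative (deriv F (g \<zeta>) * deriv g \<zeta>) / R) (at \<zeta>)"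
      unfolding h_def using R by (auto intro!: derivative_eq_intros)
    from DERIV_chain2[OF d3 this]
    have "(G has_field_derivative deriv m (h \<zeta>) * ((deriv F (g \<zeta>) * deriv g \<zeta>) / R)) (at \<zeta>)"
      by (simp add: G_def[abs_def])
    then show ?thesis using n1 n3 simple[OF \<zeta>(2)] R by (simp add: DERIV_imp_deriv)
  qed
  \<comment> \<open>Properness of \<open>F\<close>: where \<open>G\<close> has modulus below
    \<open>1 - \<epsilon>\<close>, \<open>F\<close> takes values in a smaller concentric disc, and
    the part of \<open>S\<close> over that disc is compact.\<close>
  have bdry: "\<exists>K. compact K \<and> K \<subseteq> ball 0 1 \<and> (\<forall>z\<in>ball 0 1 - K. cmod (G z) \<ge> 1 - \<epsilon>)" if \<epsilon>: "\<epsilon> > 0" for \<epsilon>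
  proof -
    let ?Kw = "m' ` cball 0 (1 - \<epsilon>)"
    have sub: "cball 0 (1 - \<epsilon>) \<subseteq> ball (0::complex) 1" using \<epsilon> by auto
    have Kw: "compact ?Kw"
      by (intro compact_continuous_image compact_cball continuous_on_subset[OF holomorphic_on_imp_continuous_on[OF hm(2)] sub])
    have Kw1: "?Kw \<subseteq> ball 0 1" using mm(3) sub by blast
    obtain s where "0 < s" and s: "s < 1" "?Kw \<subseteq> ball 0 s" by (rule compact_in_ball[OF Kw Kw1])
    let ?C = "{z \<in> S. dist a (F z) \<le> s * R}"
    have "compact ?C" by (rule proper) (use s R in auto)
    then have "compact (k ` ?C)" by (intro compact_continuous_image continuous_on_subset[OF ck]) auto
    moreover have "k ` ?C \<subseteq> ball 0 1" using gk by blast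
    moreover have "cmod (G \<zeta>) \<ge> 1 - \<epsilon>" if \<zeta>: "\<zeta> \<in> ball 0 1 - k ` ?C" for \<zeta>
    proof (rule ccontr)
      assume "\<not> cmod (G \<zeta>) \<ge> 1 - \<epsilon>"
      then have "m (h \<zeta>) \<in> cball 0 (1 - \<epsilon>)" by (simp add: G_def)
      then have "m' (m (h \<zeta>)) \<in> ?Kw" by blast
      then have "h \<zeta> \<in> ball 0 s" using s(2) mm(1)[OF h1] \<zeta> by auto
      then have "dist a (F (g \<zeta>)) \<le> s * R"
        using R by (simp add: h_def norm_divide dist_norm norm_minus_commute field_simps)
      then have "g \<zeta> \<in> ?C" using kg(2) \<zeta> by blast
      moreover have "k (g \<zeta>) = \<zeta>" using kg(1) \<zeta> by blast
      ultimately have "\<zeta> \<in> k ` ?C" by force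
      then show False using \<zeta> by blast
    qed
    ultimately show ?thesis by blast
  qed
  have prod_le: "(\<Prod>\<zeta>\<in>ZG. cmod \<zeta>) \<le> cmod (G 0)"
    by (rule Blaschke_bound[OF hG finZG ZG_def dG bdry])
  \<comment> \<open>The bounds 1/2 for \<open>h 0\<close> and 1/8 for \<open>y'\<close> lead to
    \<open>(5/8) / (15/16) = 2/3\<close> for \<open>G 0\<close>, below 4/5.\<close>
  have h0: "cmod (h 0) \<le> 1/2"
    using p(2) R by (simp add: h_def g_0 norm_divide dist_norm norm_minus_commute field_simps)
  have num: "cmod (h 0 - y') \<le> 5/8" using norm_triangle_ineq4[of "h 0" y'] h0 y' by linarith
  have "cmod y' * cmod (h 0) \<le> 1/8 * (1/2)" using y' h0 by (intro mult_mono) auto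
  then have den: "15/16 \<le> cmod (1 - cnj y' * h 0)"
    using norm_triangle_ineq2[of 1 "cnj y' * h 0"] by (simp add: norm_mult)
  have "cmod (G 0) = cmod (h 0 - y') / cmod (1 - cnj y' * h 0)"
    by (simp add: G_def m_def Moebius_function_simple norm_divide)
  also have "\<dots> \<le> (5/8) / (15/16)" by (rule frac_le[OF _ num _ den]) auto
  finally have "cmod (G 0) \<le> (5/8) / (15/16)" .
  then have G0le: "cmod (G 0) < 4/5" by simp
  \<comment> \<open>Were all zeros closer to the circle, their product would be at least the
    \<open>D\<close>-th power of \<open>1 - 1 / (5 * D)\<close>, hence at least 4/5 by Bernoulli's
    inequality.\<close>
  have ex: "\<exists>\<zeta>\<in>ZG. 1 - cmod \<zeta> \<ge> 1 / (5 * real D)"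
  proof (rule ccontr)
    assume "\<not> ?thesis"
    then have c: "cmod \<zeta> \<ge> 1 - 1 / (5 * real D)" if "\<zeta> \<in> ZG" for \<zeta> using that by force
    define q where "q = 1 - 1 / (5 * real D)"
    have q: "0 \<le> q" "q \<le> 1" by (auto simp: q_def divide_le_eq)
    have "q ^ D \<le> q ^ card ZG" by (rule power_decreasing[OF cardZG q])
    also have "q ^ card ZG = (\<Prod>\<zeta>\<in>ZG. q)" by simp
    also have "\<dots> \<le> (\<Prod>\<zeta>\<in>ZG. cmod \<zeta>)"
      by (rule prod_mono) (use c q in \<open>auto simp: q_def\<close>)
    finally have less: "q ^ D < 4/5" using prod_le G0le by linarith
    have "1 + D * - (1 / (5 * real D)) \<le> (1 + - (1 / (5 * real D))) ^ D"
      by (rule Bernoulli_inequality) (auto simp: divide_le_eq)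
    then have "1 + D * - (1 / (5 * real D)) \<le> q ^ D" by (simp add: q_def)
    moreover have "1 + D * - (1 / (5 * real D)) \<ge> 4/5" by (cases "D = 0") auto
    ultimately show False using less by linarith
  qed
  then obtain \<zeta> where \<zeta>: "\<zeta> \<in> ZG" "1 - cmod \<zeta> \<ge> 1 / (5 * real D)" by blast
  have D1: "D \<ge> 1" using cardZG \<zeta>(1) finZG by (metis One_nat_def Suc_leI card_gt_0_iff empty_iff le_trans)
  have \<zeta>1: "\<zeta> \<in> ball 0 1" "g \<zeta> \<in> Z" using \<zeta>(1) G0 by (auto simp: ZG_def simp del: mem_ball mem_ball_0)
  obtain v where v: "v \<notin> S" "cmod (g \<zeta> - v) \<le> \<eta>" using \<eta>[OF \<zeta>1(2)] by blast
  have "v \<notin> g ` ball 0 1" using kg(2) v(1) by blast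
  from univalent_growth[OF hg injg this \<zeta>1(1)]
  have "cmod (p - v) \<le> cmod (g \<zeta> - v) * (1 / (1 - cmod \<zeta>)) ^ 48" by (simp add: g_0)
  also have "\<dots> \<le> \<eta> * (5 * real D) ^ 48"
  proof (intro mult_mono power_mono v(2))
    have "0 < 1 - cmod \<zeta>" using \<zeta>1 by simp
    then have "1 / (1 - cmod \<zeta>) \<le> 1 / (1 / (5 * real D))"
      using \<zeta>(2) D1 by (intro divide_left_mono mult_pos_pos) auto
    then show "1 / (1 - cmod \<zeta>) \<le> 5 * real D" by simp
  qed (use v norm_ge_zero[of "g \<zeta> - v"] \<zeta>1 in \<open>auto simp del: norm_ge_zero\<close>)
  finally have 1: "cmod (p - v) \<le> \<eta> * (5 * real D) ^ 48" .
  have \<eta>0: "\<eta> \<ge> 0" using v(2) norm_ge_zero[of "g \<zeta> - v"] by linarith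
  have "\<eta> * 1 \<le> \<eta> * (5 * real D) ^ 48" using \<eta>0 D1 by (intro mult_left_mono one_le_power) auto
  then have "cmod (p - g \<zeta>) \<le> 2 * \<eta> * (5 * real D) ^ 48"
    using norm_triangle_ineq4[of "p - v" "g \<zeta> - v"] v(2) 1 by simp
  then show ?thesis using \<zeta>1(2) by blast
qed

section \<open>Balls around points of the support shrink exponentially\<close>

lemma divide_power_le: "0 \<le> r \<Longrightarrow> r / 160 ^ i \<le> (r::real)"
  using divide_left_mono[of 1 "160 ^ i" r] by simp

text \<open>In a chart, scaled copies of one fixed cover of the unit disc by discs of radius 1/3200
  serve for all balls, so \<open>N\<close> is independent of centre and radius. The chart constants
  give \<open>4 * 5 * r / 3200 = r / 160\<close>.\<close>

lemma doubling:
  obtains N :: nat where "N > 0"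
    "\<And>(p::riemann_sphere) r. 0 < r \<Longrightarrow> r \<le> 1/4 \<Longrightarrow> \<exists>T. finite T \<and> card T \<le> N \<and> ball p r \<subseteq> (\<Union>q\<in>T. ball q (r / 160))"
proof -
  have "cball (0::complex) 1 \<subseteq> (\<Union>x\<in>cball 0 1. ball x (1/3200))" using centre_in_ball by force
  then obtain k where "k \<subseteq> cball (0::complex) 1" and k: "finite k" "cball (0::complex) 1 \<subseteq> (\<Union>x\<in>k. ball x (1/3200))"
    by (rule compactE_image[OF compact_cball open_ball])
  show thesis
  proof (rule that[of "Suc (card k)"])
    fix p :: riemann_sphere and r :: real assume r: "0 < r" "r \<le> 1/4"
    obtain b a where p: "p = crd b a" "cmod a \<le> 1" by (rule hemisphere)
    define T where "T = (\<lambda>x. crd b (a + of_real (5 * r) * x)) ` k"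
    have "ball p r \<subseteq> (\<Union>q\<in>T. ball q (r / 160))"
    proof
      fix q assume q: "q \<in> ball p r"
      obtain w where w: "q = crd b w" "cmod w < 3" using near_chart[OF p(2), of b q] q p r by auto
      have "cmod (w - a) \<le> 5 * r" using dist_crd_ge[of w a b] w p q by (simp add: dist_commute)
      then have "(w - a) / of_real (5 * r) \<in> cball 0 1" using r by (simp add: norm_divide)
      then obtain x where x: "x \<in> k" "dist x ((w - a) / of_real (5 * r)) < 1/3200" using k by auto
      have "a + of_real (5 * r) * x - w = of_real (5 * r) * (x - (w - a) / of_real (5 * r))"
        using r by (simp add: field_simps)
      then have "cmod (a + of_real (5 * r) * x - w) = 5 * r * dist x ((w - a) / of_real (5 * r))"
        using r by (simp add: norm_mult dist_norm)
      also have "\<dots> < 5 * r * (1/3200)" using x r by (intro mult_strict_left_mono) auto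
      finally have "dist (crd b (a + of_real (5 * r) * x)) q < r / 160"
        using dist_crd_le[of b "a + of_real (5 * r) * x" w] w by simp
      then show "q \<in> (\<Union>q\<in>T. ball q (r / 160))" using x(1) by (auto simp: T_def)
    qed
    moreover have "finite T" using k(1) by (simp add: T_def)
    moreover have "card T \<le> Suc (card k)" unfolding T_def by (rule le_SucI[OF card_image_le[OF k(1)]])
    ultimately show "\<exists>T. finite T \<and> card T \<le> Suc (card k) \<and> ball p r \<subseteq> (\<Union>q\<in>T. ball q (r / 160))" by blast
  qed simp
qed

context mix begin

text \<open>A value near \<open>(f ^^ n) u\<close> that is omitted on \<open>ball u \<delta>\<close>
  allows \<open>omitted_value_small\<close> on the chart disc of radius \<open>\<delta>/4\<close>.
  The chart factor 5 puts \<open>ball u (\<delta> / 40)\<close> into half of that disc, which is the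
  origin of 40; \<open>\<eta>/4\<close> and \<open>\<epsilon>/5\<close> compensate the chart
  constants in the image.\<close>

lemma bad_scale:
  assumes "\<eta> > 0"
  obtains \<eta>' where "\<eta>' > 0"
    "\<And>u \<delta> n q. small ((f ^^ n) ` ball u (2 * \<delta>)) \<Longrightarrow> \<delta> \<le> 1/4 \<Longrightarrow>
       \<not> ball ((f ^^ n) u) \<eta>' \<subseteq> (f ^^ n) ` ball u \<delta> \<Longrightarrow> q \<in> ball u (\<delta> / 40) \<Longrightarrow>
       dist ((f ^^ n) u) ((f ^^ n) q) < \<eta>"
proof -
  obtain \<epsilon> where \<epsilon>: "\<epsilon> > 0"
    "\<And>g a r v z. g holomorphic_on ball a r \<Longrightarrow> (\<And>z. z \<in> ball a r \<Longrightarrow> cmod (g z) < 3) \<Longrightarrow>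
      v \<notin> g ` ball a r \<Longrightarrow> cmod (g a - v) < \<epsilon> \<Longrightarrow> z \<in> ball a (r/2) \<Longrightarrow> cmod (g z - g a) < \<eta>/4"
    using omitted_value_small[of "\<eta>/4"] assms by auto
  define \<eta>' where "\<eta>' = min (\<epsilon>/5) (1/4)"
  show thesis
  proof (rule that[of \<eta>'])
    show "\<eta>' > 0" using \<epsilon>(1) by (simp add: \<eta>'_def)
    fix u \<delta> n q
    assume sm: "small ((f ^^ n) ` ball u (2 * \<delta>))" and d: "\<delta> \<le> 1/4"
      and miss: "\<not> ball ((f ^^ n) u) \<eta>' \<subseteq> (f ^^ n) ` ball u \<delta>" and q: "q \<in> ball u (\<delta> / 40)"
    have "dist u q < \<delta> / 40" using q by simp
    then have d0: "\<delta> > 0" using zero_le_dist[of u q] by linarith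
    obtain y where y: "(f ^^ n) ` ball u (2 * \<delta>) \<subseteq> ball y R0" using sm by (auto simp: small_def)
    obtain b a where u: "u = crd b a" "cmod a \<le> 1" by (rule hemisphere)
    obtain b' a' where y': "y = crd b' a'" "cmod a' \<le> 1" by (rule hemisphere)
    define g where "g w = icrd b' ((f ^^ n) (crd b w))" for w
    have inb: "crd b w \<in> ball u \<delta>" if "w \<in> ball a (\<delta>/4)" for w
      using dist_crd_le[of b a w] that u by (simp add: dist_norm)
    have g: "cmod (g w) < 3" "(f ^^ n) (crd b w) = crd b' (g w)" if "w \<in> ball a (\<delta>/4)" for w
    proof -
      have "crd b w \<in> ball u (2 * \<delta>)" using inb[OF that] d0 by simp
      then have "dist (crd b' a') ((f ^^ n) (crd b w)) < 1/2" using y R0(2) y' by force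
      then obtain v where "(f ^^ n) (crd b w) = crd b' v" "cmod v < 3" by (rule near_chart[OF y'(2)])
      then show "cmod (g w) < 3" "(f ^^ n) (crd b w) = crd b' (g w)" by (auto simp: g_def)
    qed
    have hg: "g holomorphic_on ball a (\<delta>/4)"
      unfolding g_def
      by (rule sph_hol_icrd[of _ "\<lambda>w. (f ^^ n) (crd b w)", OF open_ball])
         (use iter.hol[of n b] g(2) in \<open>auto simp: o_def\<close>)
    have a: "a \<in> ball a (\<delta>/4)" using d0 by simp
    obtain q0 where q0: "dist ((f ^^ n) u) q0 < \<eta>'" "q0 \<notin> (f ^^ n) ` ball u \<delta>"
      using miss unfolding subset_iff mem_ball by blast
    have "(f ^^ n) u \<in> ball y R0" using y d0 by force
    then have "dist (crd b' a') q0 < 1/2"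
      using q0(1) dist_triangle[of y q0 "(f ^^ n) u"] R0(2) y' by (simp add: \<eta>'_def)
    then obtain v where v: "q0 = crd b' v" "cmod v < 3" by (rule near_chart[OF y'(2)])
    have "v \<notin> g ` ball a (\<delta>/4)"
    proof
      assume "v \<in> g ` ball a (\<delta>/4)"
      then obtain w where "w \<in> ball a (\<delta>/4)" "v = g w" by blast
      then have "q0 = (f ^^ n) (crd b w)" "crd b w \<in> ball u \<delta>" using v g inb by auto
      then show False using q0(2) by blast
    qed
    moreover have "cmod (g a - v) < \<epsilon>"
    proof -
      have "cmod (g a - v) \<le> 5 * dist (crd b' (g a)) (crd b' v)"
        using g(1)[OF a] v by (intro dist_crd_ge) auto
      also have "\<dots> < \<epsilon>" using q0(1) g(2)[OF a] v u by (simp add: \<eta>'_def)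
      finally show ?thesis .
    qed
    moreover obtain z where z: "q = crd b z" "cmod z < 3" using near_chart[OF u(2), of b q] q u d by auto
    moreover have "z \<in> ball a (\<delta>/4/2)"
      using dist_crd_ge[of a z b] z u q by (simp add: dist_norm)
    ultimately have "cmod (g z - g a) < \<eta>/4" using \<epsilon>(2)[OF hg g(1)] by blast
    moreover have "z \<in> ball a (\<delta>/4)" using \<open>z \<in> ball a (\<delta>/4/2)\<close> d0 by simp
    ultimately show "dist ((f ^^ n) u) ((f ^^ n) q) < \<eta>"
      using dist_crd_le[of b' "g a" "g z"] g(2)[of z] g(2)[OF a] z u by (simp add: norm_minus_commute)
  qed
qed

text \<open>Around a given point the mass may drop arbitrarily fast with the scale. Passing at each
  scale to a covering ball with at least an \<open>N\<close>-th of the mass loses only the factor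
  \<open>N\<close>, and the centres accumulate at a point with controlled decay.\<close>

lemma concentrated_point:
  assumes "u0 \<in> X" "0 < r" "r \<le> 1/4"
    and N: "N > 0" "\<And>(p::riemann_sphere) r. 0 < r \<Longrightarrow> r \<le> 1/4 \<Longrightarrow> \<exists>T. finite T \<and> card T \<le> N \<and> ball p r \<subseteq> (\<Union>q\<in>T. ball q (r / 160))"
  obtains u m where "u \<in> X" "dist u0 u \<le> 3 * r" "m > 0" "\<And>i. measure \<nu> (ball u (4 * r / 160 ^ i)) \<ge> m / real N ^ i"
proof -
  define m where "m = measure \<nu> (ball u0 r)"
  have m: "m > 0" using nu_pos assms by (simp add: m_def)
  define P where "P i p \<longleftrightarrow> measure \<nu> (ball p (r / 160 ^ i)) \<ge> m / real N ^ i \<and> (i = 0 \<longrightarrow> p = u0)" for i p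
  have step: "\<exists>q. P (Suc i) q \<and> dist p q \<le> 2 * (r / 160 ^ i)" if "P i p" for i p
  proof -
    let ?r = "r / 160 ^ i"
    have "?r \<le> 1/4" by (rule order_trans[OF divide_power_le]) (use assms in auto)
    then have r: "0 < ?r" "?r \<le> 1/4" using assms(2) by auto
    obtain T where T: "finite T" "card T \<le> N" "ball p ?r \<subseteq> (\<Union>q\<in>T. ball q (?r / 160))" using N(2)[OF r, of p] by blast
    have mp: "measure \<nu> (ball p ?r) > 0" "measure \<nu> (ball p ?r) \<ge> m / real N ^ i"
      using that m N(1) unfolding P_def by (auto intro: less_le_trans[rotated])
    have "\<exists>q\<in>T. measure \<nu> (ball p ?r \<inter> ball q (?r / 160)) \<ge> measure \<nu> (ball p ?r) / N"
    proof (rule ccontr)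
      assume "\<not> ?thesis"
      then have lt: "measure \<nu> (ball p ?r \<inter> ball q (?r / 160)) < measure \<nu> (ball p ?r) / N" if "q \<in> T" for q
        using that by force
      have T0: "T \<noteq> {}" using T(3) r by auto
      have "measure \<nu> (ball p ?r) \<le> measure \<nu> (\<Union>q\<in>T. ball p ?r \<inter> ball q (?r / 160))"
      proof (rule nu.finite_measure_mono)
        show "ball p ?r \<subseteq> (\<Union>q\<in>T. ball p ?r \<inter> ball q (?r / 160))" using T(3) by blast
        show "(\<Union>q\<in>T. ball p ?r \<inter> ball q (?r / 160)) \<in> sets \<nu>"
          unfolding sets_nu by (intro borel_open open_UN ballI open_Int open_ball)
      qed
      also have "\<dots> \<le> (\<Sum>q\<in>T. measure \<nu> (ball p ?r \<inter> ball q (?r / 160)))"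
        by (rule nu.finite_measure_subadditive_finite) (use T in auto)
      also have "\<dots> < (\<Sum>q\<in>T. measure \<nu> (ball p ?r) / N)" by (rule sum_strict_mono[OF T(1) T0 lt])
      also have "\<dots> = card T * (measure \<nu> (ball p ?r) / N)" by simp
      also have "\<dots> \<le> N * (measure \<nu> (ball p ?r) / N)" using T(2) by (intro mult_right_mono) auto
      also have "\<dots> = measure \<nu> (ball p ?r)" using N(1) by simp
      finally show False by simp
    qed
    then obtain q where q: "q \<in> T" "measure \<nu> (ball p ?r \<inter> ball q (?r / 160)) \<ge> measure \<nu> (ball p ?r) / N" by blast
    have "m / real N ^ Suc i \<le> measure \<nu> (ball p ?r) / N"
      using divide_right_mono[OF mp(2), of N] by (simp add: mult.commute)
    also note q(2)
    also have "measure \<nu> (ball p ?r \<inter> ball q (?r / 160)) \<le> measure \<nu> (ball q (?r / 160))"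
      by (rule nu.finite_measure_mono) auto
    finally have "P (Suc i) q" by (simp add: P_def mult.commute)
    moreover have "dist p q \<le> 2 * ?r"
    proof -
      have "0 < measure \<nu> (ball p ?r) / N" using mp N(1) by simp
      then have "ball p ?r \<inter> ball q (?r / 160) \<noteq> {}" using q(2) by (metis measure_empty not_less)
      then obtain z where "dist p z < ?r" "dist q z < ?r / 160" by auto
      then show ?thesis using dist_triangle[of p q z] r by (simp add: dist_commute)
    qed
    ultimately show ?thesis by blast
  qed
  have "P 0 u0" using m by (simp add: P_def m_def)
  then obtain p where p: "\<And>i. P i (p i)" "\<And>i. dist (p i) (p (Suc i)) \<le> 2 * (r / 160 ^ i)"
    using dependent_nat_choice[of P "\<lambda>i x y. dist x y \<le> 2 * (r / 160 ^ i)"] step by metis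
  \<comment> \<open>The displacements from stage \<open>i\<close> on sum to at most
    \<open>3 * r / 160^i\<close>, so the ball of radius \<open>4 * r / 160^i\<close> about the limit
    contains the chosen one.\<close>
  have dd: "dist (p i) (p (i + k)) \<le> 3 * (r / 160 ^ i)" for i k
  proof (induction k arbitrary: i)
    case 0 show ?case using assms by simp
  next
    case (Suc k)
    have "dist (p i) (p (i + Suc k)) \<le> dist (p i) (p (Suc i)) + dist (p (Suc i)) (p (Suc i + k))"
      using dist_triangle[of "p i" "p (i + Suc k)" "p (Suc i)"] by simp
    also have "\<dots> \<le> 2 * (r / 160 ^ i) + 3 * (r / 160 ^ Suc i)" using p(2)[of i] Suc.IH[of "Suc i"] by linarith
    also have "\<dots> \<le> 3 * (r / 160 ^ i)" using assms(2) by (simp add: field_simps)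
    finally show ?case .
  qed
  obtain u h where h: "strict_mono h" "(p \<circ> h) \<longlonglongrightarrow> u"
    using compact_sphere unfolding compact_def by blast
  have du: "dist (p i) u \<le> 3 * (r / 160 ^ i)" for i
  proof (rule LIMSEQ_le_const2[of "\<lambda>k. dist (p i) ((p \<circ> h) k)"])
    show "(\<lambda>k. dist (p i) ((p \<circ> h) k)) \<longlonglongrightarrow> dist (p i) u" by (intro tendsto_intros h(2))
    show "\<exists>N. \<forall>k\<ge>N. dist (p i) ((p \<circ> h) k) \<le> 3 * (r / 160 ^ i)"
    proof (intro exI allI impI)
      fix k assume "i \<le> k"
      then have "i \<le> h k" using seq_suble[OF h(1), of k] by linarith
      then show "dist (p i) ((p \<circ> h) k) \<le> 3 * (r / 160 ^ i)" using dd[of i "h k - i"] by simp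
    qed
  qed
  have mass: "measure \<nu> (ball u (4 * r / 160 ^ i)) \<ge> m / real N ^ i" for i
  proof -
    have "m / real N ^ i \<le> measure \<nu> (ball (p i) (r / 160 ^ i))" using p(1)[of i] by (simp add: P_def)
    also have "\<dots> \<le> measure \<nu> (ball u (4 * r / 160 ^ i))"
    proof (rule nu.finite_measure_mono)
      show "ball (p i) (r / 160 ^ i) \<subseteq> ball u (4 * r / 160 ^ i)"
      proof
        fix z assume "z \<in> ball (p i) (r / 160 ^ i)"
        then show "z \<in> ball u (4 * r / 160 ^ i)"
          using dist_triangle[of u z "p i"] du[of i] by (simp add: dist_commute)
      qed
    qed simp
    finally show ?thesis .
  qed
  have "u \<in> X"
  proof (rule X_if_nu)
    fix e :: real assume e: "e > 0"
    obtain i where i: "(1/160::real) ^ i < e / (4 * r)" using real_arch_pow_inv[of "e / (4 * r)" "1/160"] e assms by auto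
    have "0 < m / real N ^ i" using m N(1) by simp
    also have "\<dots> \<le> measure \<nu> (ball u (4 * r / 160 ^ i))" by (rule mass)
    also have "\<dots> \<le> measure \<nu> (ball u e)"
    proof (rule nu.finite_measure_mono)
      have "4 * r / 160 ^ i \<le> e" using i assms(2) by (simp add: field_simps power_one_over)
      then show "ball u (4 * r / 160 ^ i) \<subseteq> ball u e" by (rule subset_ball)
    qed simp
    finally show "0 < measure \<nu> (ball u e)" .
  qed
  moreover have "dist u0 u \<le> 3 * r" using du[of 0] p(1)[of 0] by (simp add: P_def)
  ultimately show thesis using that m mass by blast
qed

definition \<kappa> :: real where "\<kappa> = \<rho> powr (1 / (t + 1))"

lemma kappa: "0 < \<kappa>" "\<kappa> < 1"
  using rho t_pos powr_less_mono2[of "1 / (t + 1)" \<rho> 1] by (auto simp: \<kappa>_def)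

text \<open>Replace \<open>u\<close> by a nearby point around which the mass of balls of radius \<open>\<delta> / 160\<^sup>i\<close> decays at most like
  \<open>N\<^sup>-\<^sup>i\<close>. If the image at scale \<open>i\<close> contains no ball of definite size, then it is so small at scale \<open>i + 1\<close>
  that it remains small for \<open>k\<close> further steps. Were this so at all scales, mixing would make
  the masses decay faster; the first scale for which it fails satisfies the hypothesis of \<open>image_mass\<close>.\<close>

lemma exponential_shrinking_balls:
  obtains C6 where "C6 > 0"
    "\<And>u \<delta> s. u \<in> X \<Longrightarrow> 0 < \<delta> \<Longrightarrow> \<delta> \<le> 1/4 \<Longrightarrow> (\<And>j. j \<le> s \<Longrightarrow> small ((f ^^ j) ` ball u \<delta>)) \<Longrightarrow> \<delta> \<le> C6 * \<kappa> ^ s"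
proof -
  obtain N :: nat where N: "N > 0"
    "\<And>(p::riemann_sphere) r. 0 < r \<Longrightarrow> r \<le> 1/4 \<Longrightarrow> \<exists>T. finite T \<and> card T \<le> N \<and> ball p r \<subseteq> (\<Union>q\<in>T. ball q (r / 160))"
    using doubling by metis
  obtain L where L: "L \<ge> 2" "\<And>p q. dist (f p) (f q) \<le> L * dist p q" using Lipschitz by blast
  \<comment> \<open>\<open>k\<close> steps gain the factor \<open>\<rho>^k\<close>, which has to
    beat two losses per scale: \<open>160 * N\<close> in the comparison of masses and
    \<open>160 powr (t + 1)\<close> in \<open>image_mass\<close>.\<close>
  define B where "B = max (160 * real N) (160 powr (t + 1))"
  have "B > 0" by (simp add: B_def less_max_iff_disj)
  then obtain k :: nat where k: "\<rho> ^ k < 1 / (2 * B)"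
    using real_arch_pow_inv[of "1 / (2 * B)" \<rho>] rho by auto
  have k1: "160 * real N * \<rho> ^ k < 1/2" "160 powr (t + 1) * \<rho> ^ k \<le> 1"
  proof -
    have "B * \<rho> ^ k < B * (1 / (2 * B))" using k \<open>B > 0\<close> by (intro mult_strict_left_mono)
    then have b: "B * \<rho> ^ k < 1/2" using \<open>B > 0\<close> by simp
    have "160 * real N * \<rho> ^ k \<le> B * \<rho> ^ k" "160 powr (t + 1) * \<rho> ^ k \<le> B * \<rho> ^ k"
      using rho by (auto intro!: mult_right_mono simp: B_def)
    then show "160 * real N * \<rho> ^ k < 1/2" "160 powr (t + 1) * \<rho> ^ k \<le> 1" using b by linarith+
  qed
  \<comment> \<open>Points within \<open>\<eta>\<close> of the orbit stay within \<open>R0\<close>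
    of it for \<open>k\<close> more steps.\<close>
  define \<eta> where "\<eta> = R0 / L ^ k"
  have \<eta>: "\<eta> > 0" using R0(1) L by (simp add: \<eta>_def)
  obtain \<eta>' where \<eta>': "\<eta>' > 0"
    "\<And>u \<delta> n q. small ((f ^^ n) ` ball u (2 * \<delta>)) \<Longrightarrow> \<delta> \<le> 1/4 \<Longrightarrow>
       \<not> ball ((f ^^ n) u) \<eta>' \<subseteq> (f ^^ n) ` ball u \<delta> \<Longrightarrow> q \<in> ball u (\<delta> / 40) \<Longrightarrow>
       dist ((f ^^ n) u) ((f ^^ n) q) < \<eta>"
    using bad_scale[OF \<eta>] by metis
  obtain m where m: "m > 0" "\<And>y. y \<in> X \<Longrightarrow> measure \<mu> (ball y \<eta>') \<ge> m" using mass_lower_bound[OF \<eta>'(1)] by metis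
  have Ln: "dist ((f ^^ j) p) ((f ^^ j) q) \<le> L ^ j * dist p q" for j p q
  proof (induction j)
    case (Suc j)
    have "dist ((f ^^ Suc j) p) ((f ^^ Suc j) q) \<le> L * dist ((f ^^ j) p) ((f ^^ j) q)" using L(2) by simp
    also have "\<dots> \<le> L * (L ^ j * dist p q)" using Suc L(1) by (intro mult_left_mono) auto
    finally show ?case by (simp add: mult.assoc)
  qed simp
  define A where "A = 4 powr (t + 1) * (C3 / m)"
  have A: "A > 0" using C3_pos m by (simp add: A_def)
  have main: "\<delta> powr (t + 1) \<le> A * \<rho> ^ s"
    if u0: "u0 \<in> X" and d: "0 < \<delta>" "\<delta> \<le> 1/4" and sm: "\<And>j. j \<le> s \<Longrightarrow> small ((f ^^ j) ` ball u0 \<delta>)" for u0 \<delta> s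
  proof -
    \<comment> \<open>With \<open>r = \<delta> / 8\<close> the new centre moves by at most
      \<open>3 * \<delta> / 8\<close>, and the ball of radius \<open>2 * D 0 = \<delta> / 2\<close>
      about it remains in \<open>ball u0 \<delta>\<close>.\<close>
    have "0 < \<delta> / 8" "\<delta> / 8 \<le> 1/4" using d by auto
    from concentrated_point[OF u0 this N]
    obtain u m0 where u: "u \<in> X" "dist u0 u \<le> 3 * (\<delta> / 8)" and m0: "m0 > 0"
      "\<And>i. measure \<nu> (ball u (4 * (\<delta> / 8) / 160 ^ i)) \<ge> m0 / real N ^ i" by metis
    define D where "D i = \<delta> / 4 / 160 ^ i" for i :: nat
    have D: "0 < D i" "D i \<le> 1/4" for i
    proof -
      show "0 < D i" using d by (simp add: D_def)
      show "D i \<le> 1/4" unfolding D_def by (rule order_trans[OF divide_power_le]) (use d in auto)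
    qed
    define good where "good i \<longleftrightarrow> ball ((f ^^ (s + i * k)) u) \<eta>' \<subseteq> (f ^^ (s + i * k)) ` ball u (D i)" for i
    have sm_all: "\<forall>j\<le>s + i * k. small ((f ^^ j) ` ball u (2 * D i))" if "\<And>i'. i' < i \<Longrightarrow> \<not> good i'" for i
      using that
    proof (induction i)
      case 0
      have "ball u (2 * D 0) \<subseteq> ball u0 \<delta>"
      proof
        fix z assume "z \<in> ball u (2 * D 0)"
        then show "z \<in> ball u0 \<delta>" using dist_triangle[of u0 z u] u(2) d by (simp add: D_def)
      qed
      then show ?case using sm small_subset image_mono by (metis add_0_right mult_0)
    next
      case (Suc i)
      have IH: "\<forall>j\<le>s + i * k. small ((f ^^ j) ` ball u (2 * D i))" using Suc by simp
      have sub: "ball u (2 * D (Suc i)) \<subseteq> ball u (D i / 40)" "ball u (2 * D (Suc i)) \<subseteq> ball u (2 * D i)"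
        using D[of i] by (auto simp: D_def intro!: subset_ball)
      show ?case
      proof (intro allI impI)
        fix j assume j: "j \<le> s + Suc i * k"
        show "small ((f ^^ j) ` ball u (2 * D (Suc i)))"
        proof (cases "j \<le> s + i * k")
          case True
          then show ?thesis using IH sub(2) small_subset image_mono by metis
        next
          case False
          define j' where "j' = j - (s + i * k)"
          have j': "j = j' + (s + i * k)" "j' \<le> k" using False j by (auto simp: j'_def)
          let ?v = "(f ^^ (s + i * k)) u"
          have "(f ^^ j) ` ball u (2 * D (Suc i)) \<subseteq> ball ((f ^^ j') ?v) R0"
          proof (rule image_subsetI)
            fix q assume "q \<in> ball u (2 * D (Suc i))"
            then have q: "q \<in> ball u (D i / 40)" using sub(1) by blast
            have ng: "\<not> good i" using Suc.prems by simp
            have dl: "dist ?v ((f ^^ (s + i * k)) q) < \<eta>"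
              by (rule \<eta>'(2)[OF _ D(2) ng[unfolded good_def] q]) (use IH in simp)
            have "dist ((f ^^ j') ?v) ((f ^^ j') ((f ^^ (s + i * k)) q)) \<le> L ^ j' * dist ?v ((f ^^ (s + i * k)) q)"
              by (rule Ln)
            also have "\<dots> \<le> L ^ k * dist ?v ((f ^^ (s + i * k)) q)"
              using L(1) j'(2) by (intro mult_right_mono power_increasing) auto
            also have "\<dots> < L ^ k * \<eta>" using dl L(1) by (intro mult_strict_left_mono) auto
            also have "\<dots> = R0" using L(1) by (simp add: \<eta>_def)
            finally show "(f ^^ j) q \<in> ball ((f ^^ j') ?v) R0" by (simp add: j'(1) funpow_add)
          qed
          then show ?thesis unfolding small_def by blast
        qed
      qed
    qed
    have "\<exists>i. good i"
    proof (rule ccontr)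
      assume "\<not> (\<exists>i. good i)"
      then have S: "small ((f ^^ (s + i * k)) ` ball u (2 * D i))" for i using sm_all[of i] by blast
      define Q where "Q = (10 * C + 4) * \<rho> ^ s * 4 / \<delta>"
      \<comment> \<open>The lower bound for the mass at scale \<open>i + 1\<close> meets the mixing
        bound for \<open>ball u (D i)\<close> at time \<open>s + i * k\<close>; the resulting
        right-hand side tends to 0.\<close>
      have le: "m0 / real N \<le> Q * (160 * real N * \<rho> ^ k) ^ i" for i
      proof -
        have "m0 / real N ^ Suc i \<le> measure \<nu> (ball u (4 * (\<delta> / 8) / 160 ^ Suc i))" by (rule m0(2))
        also have "\<dots> \<le> measure \<nu> (ball u (D i))"
        proof (rule nu.finite_measure_mono)
          have "4 * (\<delta> / 8) / 160 ^ Suc i = D i / 80" by (simp add: D_def)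
          then show "ball u (4 * (\<delta> / 8) / 160 ^ Suc i) \<subseteq> ball u (D i)"
            using D(1)[of i] by (intro subset_ball) simp
        qed simp
        also have "\<dots> \<le> (10 * C + 4) * \<rho> ^ (s + i * k) / D i"
          by (rule ball_mass_small[OF S]) (use D[of i] in auto)
        also have "\<dots> = Q * (160 * \<rho> ^ k) ^ i"
          by (simp add: Q_def D_def power_add power_mult power_mult_distrib mult.commute[of i k])
        finally have "m0 / real N ^ Suc i * real N ^ i \<le> Q * (160 * \<rho> ^ k) ^ i * real N ^ i"
          by (intro mult_right_mono) auto
        then show ?thesis using N(1) by (simp add: power_mult_distrib mult_ac)
      qed
      have lim: "(\<lambda>i. Q * (160 * real N * \<rho> ^ k) ^ i) \<longlonglongrightarrow> Q * 0"
        using k1(1) rho by (intro tendsto_mult tendsto_const LIMSEQ_power_zero) (auto simp: abs_mult)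
      have "m0 / real N \<le> Q * 0"
        by (rule LIMSEQ_le_const[OF lim]) (use le in blast)
      then show False using m0(1) N(1) by (simp add: divide_le_0_iff)
    qed
    define i where "i = (LEAST i. good i)"
    have gi: "good i" unfolding i_def using \<open>\<exists>i. good i\<close> by (rule LeastI_ex)
    have "\<not> good i'" if "i' < i" for i' using that not_less_Least unfolding i_def by blast
    then have S: "small ((f ^^ (s + i * k)) ` ball u (2 * D i))" using sm_all[of i] by blast
    have "m \<le> measure \<mu> (ball ((f ^^ (s + i * k)) u) \<eta>')" by (rule m(2)[OF X_forward_funpow[OF u(1)]])
    also have "\<dots> \<le> measure \<mu> ((f ^^ (s + i * k)) ` ball u (D i))"
      by (rule mu.finite_measure_mono) (use gi open_map_funpow[of "ball u (D i)"] in \<open>auto simp: good_def\<close>)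
    finally have "D i powr (t + 1) * m \<le> D i powr (t + 1) * measure \<mu> ((f ^^ (s + i * k)) ` ball u (D i))"
      by (intro mult_left_mono) auto
    also have "\<dots> \<le> C3 * \<rho> ^ (s + i * k)" by (rule image_mass[OF S D])
    finally have "D i powr (t + 1) \<le> C3 / m * \<rho> ^ (s + i * k)" using m(1) by (simp add: field_simps)
    then have "D i powr (t + 1) * (4 powr (t + 1) * (160 powr (t + 1)) ^ i)
        \<le> C3 / m * \<rho> ^ (s + i * k) * (4 powr (t + 1) * (160 powr (t + 1)) ^ i)"
      by (rule mult_right_mono) simp
    moreover have "D i powr (t + 1) * (4 powr (t + 1) * (160 powr (t + 1)) ^ i) = \<delta> powr (t + 1)"
    proof -
      have "(160 powr (t + 1)) ^ i = (160 ^ i) powr (t + 1)"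
        by (simp add: powr_realpow[symmetric] powr_powr mult.commute)
      then have "D i powr (t + 1) * (4 powr (t + 1) * (160 powr (t + 1)) ^ i) = (D i * (4 * 160 ^ i)) powr (t + 1)"
        using D(1)[of i] by (simp only: powr_mult)
      also have "D i * (4 * 160 ^ i) = \<delta>" by (simp add: D_def)
      finally show ?thesis .
    qed
    ultimately have "\<delta> powr (t + 1) \<le> C3 / m * \<rho> ^ (s + i * k) * (4 powr (t + 1) * (160 powr (t + 1)) ^ i)"
      by (simp only:)
    also have "\<dots> = A * \<rho> ^ s * (160 powr (t + 1) * \<rho> ^ k) ^ i"
      unfolding A_def power_add power_mult_distrib mult.commute[of i k] power_mult by (simp only: mult_ac)
    also have "\<dots> \<le> A * \<rho> ^ s * 1"
      using k1(2) rho A by (intro mult_left_mono power_le_one) auto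
    finally show ?thesis by simp
  qed
  define C6 where "C6 = A powr (1 / (t + 1))"
  show thesis
  proof (rule that[of C6])
    show "C6 > 0" using A by (simp add: C6_def)
    fix u \<delta> s assume a: "u \<in> X" "0 < \<delta>" "\<delta> \<le> 1/4" "\<And>j. j \<le> s \<Longrightarrow> small ((f ^^ j) ` ball u \<delta>)"
    have "\<delta> = (\<delta> powr (t + 1)) powr (1 / (t + 1))" using a t_pos by (simp add: powr_powr)
    also have "\<dots> \<le> (A * \<rho> ^ s) powr (1 / (t + 1))"
      by (rule powr_mono2) (use main[OF a(1,2,3)] a(4) t_pos in auto)
    also have "\<dots> = C6 * (\<rho> ^ s) powr (1 / (t + 1))" using A rho by (simp add: powr_mult C6_def)
    also have "(\<rho> ^ s) powr (1 / (t + 1)) = \<kappa> ^ s"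
      using rho by (simp add: \<kappa>_def powr_realpow[symmetric] powr_powr mult.commute)
    finally show "\<delta> \<le> C6 * \<kappa> ^ s" .
  qed
qed

end

section \<open>Components of preimages of small discs\<close>

text \<open>Elements more than \<open>M\<close> apart lie in different blocks of length
  \<open>M\<close>.\<close>

lemma card_gaps:
  fixes T :: "nat set"
  assumes "T \<subseteq> {..<n}" "M > 0" "\<And>i j. i \<in> T \<Longrightarrow> j \<in> T \<Longrightarrow> i < j \<Longrightarrow> j - i > M"
  shows "card T \<le> n div M + 1"
proof -
  have "inj_on (\<lambda>i. i div M) T"
  proof (rule inj_onI)
    fix i j assume ij: "i \<in> T" "j \<in> T" "i div M = j div M"
    have "\<not> j - i > M" if "i div M = j div M" for i j
    proof
      assume "j - i > M"
      then have "i + M \<le> j" by simp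
      then have "(i + M) div M \<le> j div M" by (rule div_le_mono)
      then show False using that assms(2) by simp
    qed
    then show "i = j" using assms(3)[of i j] assms(3)[of j i] ij by (metis linorder_neqE_nat)
  qed
  then have "card T = card ((\<lambda>i. i div M) ` T)" by (simp add: card_image)
  also have "\<dots> \<le> card {..n div M}"
  proof (rule card_mono)
    show "(\<lambda>i. i div M) ` T \<subseteq> {..n div M}"
    proof (rule image_subsetI)
      fix i assume "i \<in> T"
      then have "i \<le> n" using assms(1) by auto
      then show "i div M \<in> {..n div M}" using div_le_mono[of i n M] by simp
    qed
  qed simp
  finally show ?thesis by simp
qed

context rat begin

lemma finite_preimages: "finite {p. (f ^^ n) p = y}"
proof (induction n arbitrary: y)
  case (Suc n)
  have "{p. (f ^^ Suc n) p = y} = (\<Union>q\<in>f -` {y}. {p. (f ^^ n) p = q})" by auto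
  then show ?case using Suc card_fibre(1) by simp
qed simp

text \<open>Following \<open>A\<close> forward, a step at which \<open>f\<close> is injective on the
  current image preserves the count, and any other step multiplies it by at most \<open>d\<close>.
  The induction splits off the first step, which shifts the remaining indices by one.\<close>

lemma card_preimages:
  assumes "E \<subseteq> A" "(f ^^ n) ` E \<subseteq> {y}"
  shows "card E \<le> d ^ card {i. i < n \<and> \<not> inj_on f ((f ^^ i) ` A)}"
  using assms
proof (induction n arbitrary: E A)
  case 0
  then have "E \<subseteq> {y}" by auto
  then show ?case using card_mono[of "{y}" E] by simp
next
  case (Suc n)
  have finE: "finite E" using Suc.prems(2) finite_preimages[of "Suc n" y] by (auto intro: finite_subset[rotated])
  let ?J = "{i. i < n \<and> \<not> inj_on f ((f ^^ i) ` f ` A)}"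
  let ?J' = "{i. i < Suc n \<and> \<not> inj_on f ((f ^^ i) ` A)}"
  have IH: "card (f ` E) \<le> d ^ card ?J"
    by (rule Suc.IH) (use Suc.prems in \<open>auto simp: funpow_swap1\<close>)
  have im: "(f ^^ i) ` f ` A = (f ^^ Suc i) ` A" for i by (auto simp: funpow_swap1 image_comp o_def)
  have J: "Suc ` ?J \<subseteq> ?J'" using im by auto
  have cJ: "card (Suc ` ?J) = card ?J" by (rule card_image) simp
  have d1: "d \<ge> 1" using degree_ge_2 by simp
  show ?case
  proof (cases "inj_on f A")
    case True
    then have "card E = card (f ` E)" using Suc.prems(1) by (metis card_image inj_on_subset)
    also have "\<dots> \<le> d ^ card ?J" by (rule IH)
    also have "\<dots> \<le> d ^ card ?J'"
      using card_mono[OF _ J] cJ d1 by (intro power_increasing) auto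
    finally show ?thesis .
  next
    case False
    have "E \<subseteq> (\<Union>q\<in>f ` E. f -` {q})" by auto
    then have "card E \<le> card (\<Union>q\<in>f ` E. f -` {q})" by (rule card_mono[rotated]) (use finE card_fibre(1) in auto)
    also have "\<dots> \<le> (\<Sum>q\<in>f ` E. card (f -` {q}))" by (rule card_UN_le) (use finE in auto)
    also have "\<dots> \<le> (\<Sum>q\<in>f ` E. d)" by (rule sum_mono[OF card_fibre(2)])
    also have "\<dots> = d * card (f ` E)" by simp
    also have "\<dots> \<le> d * d ^ card ?J" using IH by (rule mult_le_mono2)
    also have "\<dots> = d ^ card (insert 0 (Suc ` ?J))" using cJ by simp
    also have "\<dots> \<le> d ^ card ?J'"
      using J False d1 by (intro power_increasing card_mono) auto
    finally show ?thesis .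
  qed
qed

lemma ex_iterate_Lipschitz:
  obtains L where "L \<ge> 2" "\<And>n p q. dist ((f ^^ n) p) ((f ^^ n) q) \<le> L ^ n * dist p q"
proof -
  obtain L where L: "L \<ge> 2" "\<And>p q. dist (f p) (f q) \<le> L * dist p q" using Lipschitz by blast
  have "dist ((f ^^ j) p) ((f ^^ j) q) \<le> L ^ j * dist p q" for j p q
  proof (induction j)
    case (Suc j)
    have "dist ((f ^^ Suc j) p) ((f ^^ Suc j) q) \<le> L * dist ((f ^^ j) p) ((f ^^ j) q)" using L(2) by simp
    also have "\<dots> \<le> L * (L ^ j * dist p q)" using Suc L(1) by (intro mult_left_mono) auto
    finally show ?case by (simp add: mult.assoc)
  qed simp
  then show thesis using that L(1) by blast
qed

end

context mix begin

text \<open>A critical cycle is attracting: some ball about \<open>w\<close> is mapped into itself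
  by \<open>f ^^ q\<close>, so all its images stay small, and
  \<open>exponential_shrinking_balls\<close> would force its radius to be 0 if \<open>w\<close> were
  in \<open>X\<close>.\<close>

lemma periodic_critical_not_X:
  assumes w: "w \<in> crit" and per: "(f ^^ q) w = w" "q \<ge> 1"
  shows "w \<notin> X"
proof
  assume cX: "w \<in> X"
  obtain L where L: "L \<ge> 2" "\<And>n p q. dist ((f ^^ n) p) ((f ^^ n) q) \<le> L ^ n * dist p q"
    by (rule ex_iterate_Lipschitz) blast
  obtain C6 where C6: "C6 > 0"
    "\<And>u \<delta> s. u \<in> X \<Longrightarrow> 0 < \<delta> \<Longrightarrow> \<delta> \<le> 1/4 \<Longrightarrow> (\<And>j. j \<le> s \<Longrightarrow> small ((f ^^ j) ` ball u \<delta>)) \<Longrightarrow> \<delta> \<le> C6 * \<kappa> ^ s"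
    using exponential_shrinking_balls by metis
  have "sdn q w = 0" unfolding sdn_def using w per(2) by (intro prod_zero) (auto simp: crit_def intro!: bexI[of _ 0])
  then have "((\<lambda>x. chord ((f ^^ q) x) w / chord x w) \<longlongrightarrow> 0) (at w)"
    using chord_deriv_funpow[of q w] per by simp
  then have "\<forall>\<^sub>F x in at w. chord ((f ^^ q) x) w / chord x w < 1/2" by (rule order_tendstoD) simp
  then obtain r0 where r0: "r0 > 0" "\<And>x. x \<noteq> w \<Longrightarrow> dist x w < r0 \<Longrightarrow> chord ((f ^^ q) x) w / chord x w < 1/2"
    unfolding eventually_at by auto
  define r where "r = min (min r0 (1/4)) (R0 / L ^ q)"
  have "R0 / L ^ q > 0" using R0(1) L(1) by simp
  then have r: "r > 0" "r \<le> r0" "r \<le> 1/4" "r \<le> R0 / L ^ q" using r0(1) unfolding r_def by linarith+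
  have r4: "L ^ q * r \<le> R0" using r(4) L(1) by (simp add: pos_le_divide_eq mult.commute)
  have step: "(f ^^ q) x \<in> ball w r" if x: "x \<in> ball w r" for x
  proof (cases "x = w")
    case False
    have xr: "dist x w < r0" using x r by (simp add: dist_commute)
    have "chord x w > 0" using False inj_stereo by (auto simp: chord_def inj_eq)
    then have "chord ((f ^^ q) x) w \<le> 1/2 * chord x w" using r0(2)[OF False xr] by (simp add: field_simps)
    \<comment> \<open>The contraction by 1/2 in the chord metric pays for the factor 2 of
      \<open>dist_le_chord\<close>.\<close>
    then have "dist ((f ^^ q) x) w \<le> chord x w" using dist_le_chord[of "(f ^^ q) x" w] by linarith
    also have "\<dots> \<le> dist x w" by (rule chord_le_dist)
    finally show ?thesis using x by (simp add: dist_commute)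
  qed (use per x in simp)
  have steps: "(f ^^ (k * q)) x \<in> ball w r" if "x \<in> ball w r" for k x
    using that by (induction k) (auto simp: funpow_add simp del: mem_ball intro: step)
  have "small ((f ^^ j) ` ball w r)" for j
    unfolding small_def
  proof (intro exI image_subsetI)
    fix x assume x: "x \<in> ball w r"
    have "(f ^^ j) x = (f ^^ (j mod q)) ((f ^^ (j div q * q)) x)"
      by (simp add: funpow_add[symmetric, THEN fun_cong, unfolded o_def])
    moreover have "dist ((f ^^ (j mod q)) w) ((f ^^ (j mod q)) ((f ^^ (j div q * q)) x)) \<le> L ^ (j mod q) * dist w ((f ^^ (j div q * q)) x)"
      by (rule L(2))
    moreover have "\<dots> < L ^ (j mod q) * r" using steps[OF x, of "j div q"] L(1) by (intro mult_strict_left_mono) auto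
    moreover have "L ^ (j mod q) * r \<le> L ^ q * r"
      using L(1) r per(2) by (intro mult_right_mono power_increasing) (auto intro: less_imp_le)
    ultimately show "(f ^^ j) x \<in> ball ((f ^^ (j mod q)) w) R0" using r4 by simp
  qed
  then have le: "r \<le> C6 * \<kappa> ^ s" for s using C6(2)[OF cX r(1,3)] by blast
  have lim: "(\<lambda>s. C6 * \<kappa> ^ s) \<longlonglongrightarrow> C6 * 0"
    using kappa by (intro tendsto_mult tendsto_const LIMSEQ_power_zero) auto
  have "r \<le> C6 * 0" by (rule LIMSEQ_le_const[OF lim]) (use le in blast)
  then show False using r by simp
qed

text \<open>Only times at which the image of \<open>A\<close> is near a critical point cost a factor
  \<open>d\<close>. Two visits to the same \<open>w\<close> within \<open>M\<close> steps would
  bring \<open>w\<close> back near itself. This is possible only if \<open>w\<close> has a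
  neighbourhood free of \<open>X\<close>, which is excluded because the images of \<open>A\<close>
  contain points of \<open>X\<close>. Large \<open>M\<close> thus makes the growth rate as small as
  desired, and \<open>r1\<close> does not depend on \<open>n\<close>.\<close>

lemma degree_bound:
  assumes "M \<ge> (1::nat)"
  obtains r1 where "r1 > 0"
    "\<And>A n y x. (\<And>i p q. i \<le> n \<Longrightarrow> p \<in> (f ^^ i) ` A \<Longrightarrow> q \<in> (f ^^ i) ` A \<Longrightarrow> dist p q \<le> r1) \<Longrightarrow> x \<in> A \<Longrightarrow> x \<in> X \<Longrightarrow>
       card {p \<in> A. (f ^^ n) p = y} \<le> d ^ (card crit * (n div M + 1))"
proof -
  obtain L where L: "L \<ge> 2" "\<And>n p q. dist ((f ^^ n) p) ((f ^^ n) q) \<le> L ^ n * dist p q"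
    by (rule ex_iterate_Lipschitz) blast
  \<comment> \<open>Either the critical point keeps a positive distance from its first
    \<open>M\<close> iterates, or it is periodic and some neighbourhood of it is free of
    \<open>X\<close>.\<close>
  have "\<exists>\<zeta>>0. (\<forall>q. 1 \<le> q \<and> q \<le> M \<longrightarrow> dist ((f ^^ q) w) w \<ge> \<zeta>) \<or> ball w \<zeta> \<inter> X = {}" if w: "w \<in> crit" for w
  proof (cases "\<exists>q. 1 \<le> q \<and> q \<le> M \<and> (f ^^ q) w = w")
    case True
    then have "w \<notin> X" using periodic_critical_not_X[OF w] by blast
    then obtain r where r: "r > 0" "\<not> measure \<mu> (ball w r) > 0" by (auto simp: X_def)
    then have "measure \<mu> (ball w r) = 0" using measure_nonneg[of \<mu> "ball w r"] by linarith
    then show ?thesis using null_misses_X[of "ball w r"] r(1) by auto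
  next
    case False
    define \<zeta> where "\<zeta> = Min ((\<lambda>q. dist ((f ^^ q) w) w) ` {1..M})"
    have "\<zeta> > 0" unfolding \<zeta>_def using assms False by (subst Min_gr_iff) auto
    moreover have "dist ((f ^^ q) w) w \<ge> \<zeta>" if "1 \<le> q" "q \<le> M" for q
      unfolding \<zeta>_def by (rule Min_le) (use that in auto)
    ultimately show ?thesis by blast
  qed
  then obtain \<zeta> where \<zeta>: "\<And>w. w \<in> crit \<Longrightarrow> \<zeta> w > 0"
    "\<And>w. w \<in> crit \<Longrightarrow> (\<forall>q. 1 \<le> q \<and> q \<le> M \<longrightarrow> dist ((f ^^ q) w) w \<ge> \<zeta> w) \<or> ball w (\<zeta> w) \<inter> X = {}"
    by metis
  define z where "z = Min (insert 1 (\<zeta> ` crit))"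
  have z: "z > 0" "\<And>w. w \<in> crit \<Longrightarrow> z \<le> \<zeta> w"
    unfolding z_def using finite_crit \<zeta>(1) by (auto simp: Min_gr_iff intro!: Min_le)
  define \<epsilon> where "\<epsilon> = z / (4 * L ^ M)"
  have LM: "L ^ M \<ge> 1" using L(1) by simp
  have \<epsilon>: "\<epsilon> > 0" "L ^ M * \<epsilon> = z / 4" "\<epsilon> \<le> z / 4"
    using z(1) L(1) LM by (auto simp: \<epsilon>_def field_simps)
  obtain \<delta> where \<delta>: "\<delta> > 0"
    "\<And>p q. p \<notin> (\<Union>w\<in>crit. ball w \<epsilon>) \<Longrightarrow> dist p q < \<delta> \<Longrightarrow> f p = f q \<Longrightarrow> p = q"
    using uniformly_injective[OF \<epsilon>(1)] by metis
  define r1 where "r1 = min (\<delta> / 2) (z / 4)"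
  show thesis
  proof (rule that[of r1])
    show "r1 > 0" using \<delta>(1) z(1) by (simp add: r1_def)
    fix A n y x
    assume di: "\<And>i p q. i \<le> n \<Longrightarrow> p \<in> (f ^^ i) ` A \<Longrightarrow> q \<in> (f ^^ i) ` A \<Longrightarrow> dist p q \<le> r1"
      and x: "x \<in> A" "x \<in> X"
    define V where "V w = {i. i < n \<and> (f ^^ i) ` A \<inter> ball w \<epsilon> \<noteq> {}}" for w
    have noninj: "{i. i < n \<and> \<not> inj_on f ((f ^^ i) ` A)} \<subseteq> (\<Union>w\<in>crit. V w)"
    proof safe
      fix i assume i: "i < n" "\<not> inj_on f ((f ^^ i) ` A)"
      then obtain p q where pq: "p \<in> (f ^^ i) ` A" "q \<in> (f ^^ i) ` A" "f p = f q" "p \<noteq> q" by (auto simp: inj_on_def)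
      have "dist p q < \<delta>" using di[of i p q] i pq \<delta>(1) by (simp add: r1_def)
      then have "p \<in> (\<Union>w\<in>crit. ball w \<epsilon>)" using \<delta>(2)[of p q] pq by blast
      then obtain w where "w \<in> crit" "p \<in> ball w \<epsilon>" by blast
      then show "i \<in> (\<Union>w\<in>crit. V w)" using pq(1) i unfolding V_def by blast
    qed
    have cV: "card (V w) \<le> n div M + 1" if w: "w \<in> crit" for w
    proof (rule card_gaps)
      show "V w \<subseteq> {..<n}" by (auto simp: V_def)
      fix i j assume ij: "i \<in> V w" "j \<in> V w" "i < j"
      obtain p1 where p1: "p1 \<in> (f ^^ i) ` A" "dist w p1 < \<epsilon>"
        using ij(1) unfolding V_def mem_Collect_eq by (meson Int_iff ex_in_conv mem_ball)
      obtain p2 where p2: "p2 \<in> (f ^^ j) ` A" "dist w p2 < \<epsilon>"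
        using ij(2) unfolding V_def mem_Collect_eq by (meson Int_iff ex_in_conv mem_ball)
      have "i \<le> n" "j \<le> n" using ij by (auto simp: V_def)
      show "j - i > M"
      proof (rule ccontr)
        assume q: "\<not> j - i > M"
        define k where "k = j - i"
        have k: "1 \<le> k" "k \<le> M" "j = k + i" using q ij by (auto simp: k_def)
        have "(f ^^ k) p1 \<in> (f ^^ j) ` A" using p1(1) by (auto simp: k(3) funpow_add)
        then have "dist ((f ^^ k) p1) p2 \<le> r1" using di \<open>j \<le> n\<close> p2(1) by blast
        moreover have "dist ((f ^^ k) w) ((f ^^ k) p1) \<le> L ^ k * dist w p1" by (rule L(2))
        moreover have "L ^ k * dist w p1 \<le> L ^ M * \<epsilon>"
          using L(1) k(2) p1(2) by (intro mult_mono power_increasing) auto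
        moreover have "dist ((f ^^ k) w) w \<le> dist ((f ^^ k) w) ((f ^^ k) p1) + dist ((f ^^ k) p1) p2 + dist w p2"
          using dist_triangle[of "(f ^^ k) w" w p2] dist_triangle[of "(f ^^ k) w" p2 "(f ^^ k) p1"] by (simp add: dist_commute)
        \<comment> \<open>Each of the three distances is at most \<open>z/4\<close>.\<close>
        ultimately have "dist ((f ^^ k) w) w < z" using p2(2) \<epsilon>(2,3) z(1) by (simp add: r1_def)
        then have "\<not> (\<forall>q. 1 \<le> q \<and> q \<le> M \<longrightarrow> dist ((f ^^ q) w) w \<ge> \<zeta> w)" using z(2)[OF w] k by force
        then have e: "ball w (\<zeta> w) \<inter> X = {}" using \<zeta>(2)[OF w] by blast
        have "(f ^^ i) x \<in> (f ^^ i) ` A" using x by blast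
        then have "dist p1 ((f ^^ i) x) \<le> r1" using di[of i] p1(1) \<open>i \<le> n\<close> by blast
        then have "dist w ((f ^^ i) x) < z"
          using dist_triangle[of w "(f ^^ i) x" p1] p1(2) \<epsilon>(3) z(1) by (simp add: r1_def)
        then have "(f ^^ i) x \<in> ball w (\<zeta> w) \<inter> X" using z(2)[OF w] X_forward_funpow[OF x(2)] by simp
        then show False using e by blast
      qed
    qed (use assms in simp)
    have "card {i. i < n \<and> \<not> inj_on f ((f ^^ i) ` A)} \<le> card (\<Union>w\<in>crit. V w)"
      by (rule card_mono[OF _ noninj]) (use finite_crit in \<open>auto simp: V_def\<close>)
    also have "\<dots> \<le> (\<Sum>w\<in>crit. card (V w))" by (rule card_UN_le[OF finite_crit])
    also have "\<dots> \<le> (\<Sum>w\<in>crit. n div M + 1)" by (rule sum_mono[OF cV])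
    also have "\<dots> = card crit * (n div M + 1)" by simp
    finally have cJ: "card {i. i < n \<and> \<not> inj_on f ((f ^^ i) ` A)} \<le> card crit * (n div M + 1)" .
    have "card {p \<in> A. (f ^^ n) p = y} \<le> d ^ card {i. i < n \<and> \<not> inj_on f ((f ^^ i) ` A)}"
      by (rule card_preimages[of _ _ n y]) auto
    also have "\<dots> \<le> d ^ (card crit * (n div M + 1))"
      by (rule power_increasing[OF cJ]) (use degree_ge_2 in simp)
    finally show "card {p \<in> A. (f ^^ n) p = y} \<le> d ^ (card crit * (n div M + 1))" .
  qed
qed

end

section \<open>Pullbacks of discs as simply connected plane domains\<close>

context rat begin

lemma chart_holomorphic:
  assumes "open U" "\<And>z. z \<in> U \<Longrightarrow> (f ^^ n) (crd b z) \<noteq> pole b'"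
  shows "(\<lambda>z. icrd b' ((f ^^ n) (crd b z))) holomorphic_on U"
  by (rule sph_hol_icrd[of _ "\<lambda>w. (f ^^ n) (crd b w)", OF assms(1)]) (use iter.hol[of n b] assms(2) in \<open>auto simp: o_def\<close>)

lemma continuous_on_funpow_crd: "continuous_on A (\<lambda>z. (f ^^ n) (crd b z))"
  using continuous_on_compose[OF continuous_crd iter.continuous_f] by (simp add: o_def)

text \<open>Once the image of the inside of \<open>T\<close> is known to stay in one chart, the
  maximum principle carries the bound on \<open>T\<close> over to the inside.\<close>

lemma fills_inside:
  assumes T: "compact T" "z0 \<in> T" and q: "cmod a \<le> 1" "(f ^^ n) (crd b z0) = crd b' a0" "dist a a0 < r"
    and near: "\<And>z. z \<in> T \<union> inside T \<Longrightarrow> dist (crd b' a) ((f ^^ n) (crd b z)) < 1/2"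
    and le: "\<And>z. z \<in> T \<Longrightarrow> dist a (icrd b' ((f ^^ n) (crd b z))) < r"
    and z: "z \<in> T \<union> inside T"
  shows "\<exists>w. (f ^^ n) (crd b z) = crd b' w \<and> dist a w < r"
proof -
  define U where "U = (\<lambda>z. (f ^^ n) (crd b z)) -` ball (crd b' a) (1/2)"
  have U: "open U" unfolding U_def by (rule open_vimage[OF open_ball continuous_on_funpow_crd])
  have ex: "\<exists>w. (f ^^ n) (crd b z) = crd b' w" if "z \<in> U" for z
    using that near_chart[OF q(1), of b' "(f ^^ n) (crd b z)"] unfolding U_def by (metis mem_ball vimage_eq)
  have hol: "(\<lambda>z. icrd b' ((f ^^ n) (crd b z))) holomorphic_on U"
    by (rule chart_holomorphic[OF U]) (metis ex crd_neq_pole)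
  have TU: "T \<union> inside T \<subseteq> U" using near by (auto simp: U_def)
  have "dist a (icrd b' ((f ^^ n) (crd b z))) < r"
    using inside_maximum_modulus[OF T(1) U TU hol le] le z by blast
  moreover obtain w where "(f ^^ n) (crd b z) = crd b' w" using ex z TU by blast
  ultimately show ?thesis by simp
qed

text \<open>It has to be shown that the inside of a compact connected \<open>T \<subseteq> S\<close>
  is mapped into the disc, though a priori its images might leave every chart. Hence the maximum
  principle is applied at each time \<open>i\<close>: a step of \<open>f\<close> stretches the bound
  \<open>24 * r1\<close> to less than 1/2, which keeps the image in a chart, and the bound
  \<open>6 * r1\<close> for \<open>T\<close> in that chart restores \<open>24 * r1\<close>.\<close>

lemma simply_connected_pullback:
  assumes a: "cmod a \<le> 1" and R: "0 < R" "R \<le> 1/16" and z0: "cmod z0 \<le> 1"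
    and r1: "r1 > 0" "r1 \<le> 1/200" "24 * L * r1 < 1/2"
    and L: "L \<ge> 1" "\<And>p q. dist (f p) (f q) \<le> L * dist p q"
    and S: "S = connected_component_set {z. (f ^^ n) (crd b0 z) \<in> crd b ` ball a R} z0"
    and diam: "\<And>i z w. i \<le> n \<Longrightarrow> z \<in> S \<Longrightarrow> w \<in> S \<Longrightarrow> dist ((f ^^ i) (crd b0 z)) ((f ^^ i) (crd b0 w)) \<le> r1"
    and ne: "z0 \<in> S"
  shows "open S" "simply_connected S" "S \<subseteq> ball z0 (6 * r1)"
proof -
  let ?V = "crd b ` ball a R"
  define \<Omega> where "\<Omega> = {z. (f ^^ n) (crd b0 z) \<in> ?V}"
  have "open ((\<lambda>z. (f ^^ n) (crd b0 z)) -` ?V)"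
    by (rule open_vimage[OF open_crd_image[OF open_ball] continuous_on_funpow_crd])
  then have "open \<Omega>" by (simp add: \<Omega>_def vimage_def)
  then show oS: "open S" unfolding S \<Omega>_def[symmetric] by (rule open_connected_component)
  show Sb: "S \<subseteq> ball z0 (6 * r1)"
  proof
    fix z assume z: "z \<in> S"
    have d: "dist (crd b0 z0) (crd b0 z) \<le> r1" using diam[of 0 z0 z] z ne by simp
    then have "dist (crd b0 z0) (crd b0 z) < 1/2" using r1 by linarith
    then obtain w where "crd b0 z = crd b0 w" "cmod w < 3" by (rule near_chart[OF z0])
    then have "cmod (z0 - z) \<le> 5 * dist (crd b0 z0) (crd b0 z)" using z0 by (intro dist_crd_ge) auto
    then show "z \<in> ball z0 (6 * r1)" using d r1(1) by (simp add: dist_norm)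
  qed
  show "simply_connected S"
  proof (rule simply_connected_if_inside[OF oS])
    show "connected S" by (simp add: S)
    fix T assume T: "compact T" "connected T" "T \<subseteq> S"
    show "inside T \<subseteq> S"
    proof (cases "T = {}")
      case False
      then obtain t where t: "t \<in> T" by blast
      define q where "q i = (f ^^ i) (crd b0 z0)" for i
      have qT: "dist (q i) ((f ^^ i) (crd b0 z)) \<le> r1" if "i \<le> n" "z \<in> T" for i z
        using diam[OF that(1) ne] that(2) T(3) by (auto simp: q_def)
      have main: "\<forall>z\<in>T \<union> inside T. dist (q i) ((f ^^ i) (crd b0 z)) \<le> 24 * r1" if "i \<le> n" for i
        using that
      proof (induction i)
        case 0
        have "dist z0 z < 6 * r1" if "z \<in> T \<union> inside T" for z
          using inside_maximum_modulus[OF T(1) open_UNIV _ holomorphic_on_id, of z0 "6 * r1" z] T(3) Sb that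
          by (auto simp: subset_iff)
        then have "dist (crd b0 z0) (crd b0 z) \<le> 24 * r1" if "z \<in> T \<union> inside T" for z
          using dist_crd_le[of b0 z0 z] that by (force simp: dist_norm)
        then show ?case by (simp add: q_def)
      next
        case (Suc i)
        obtain b1 a1 where q1: "q (Suc i) = crd b1 a1" "cmod a1 \<le> 1" by (rule hemisphere)
        have near: "dist (crd b1 a1) ((f ^^ Suc i) (crd b0 z)) < 1/2" if "z \<in> T \<union> inside T" for z
        proof -
          have "dist (q i) ((f ^^ i) (crd b0 z)) \<le> 24 * r1" using Suc that by simp
          then have "L * dist (q i) ((f ^^ i) (crd b0 z)) \<le> L * (24 * r1)" using L(1) by (intro mult_left_mono) auto
          moreover have "dist (q (Suc i)) ((f ^^ Suc i) (crd b0 z)) \<le> L * dist (q i) ((f ^^ i) (crd b0 z))"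
            using L(2) by (simp add: q_def)
          ultimately show ?thesis using r1(3) q1(1) by (simp add: mult_ac)
        qed
        have le: "dist a1 (icrd b1 ((f ^^ Suc i) (crd b0 z))) < 6 * r1" if z: "z \<in> T" for z
        proof -
          obtain w where w: "(f ^^ Suc i) (crd b0 z) = crd b1 w" "cmod w < 3"
            by (rule near_chart[OF q1(2)]) (use near z in blast)
          have "dist (crd b1 a1) (crd b1 w) \<le> r1" using qT[OF Suc.prems z] q1(1) w(1) by simp
          moreover have "cmod (a1 - w) \<le> 5 * dist (crd b1 a1) (crd b1 w)" using q1(2) w(2) by (intro dist_crd_ge) auto
          ultimately show ?thesis using r1(1) w(1) by (simp add: dist_norm)
        qed
        show ?case
        proof
          fix z assume z: "z \<in> T \<union> inside T"
          obtain a0 where a0: "(f ^^ Suc i) (crd b0 t) = crd b1 a0"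
            by (rule near_chart[OF q1(2)]) (use near t in blast)
          have "dist a1 a0 < 6 * r1" using le[OF t] a0 by simp
          from fills_inside[OF T(1) t q1(2) a0 this near le z]
          obtain w where w: "(f ^^ Suc i) (crd b0 z) = crd b1 w" "dist a1 w < 6 * r1" by blast
          then show "dist (q (Suc i)) ((f ^^ Suc i) (crd b0 z)) \<le> 24 * r1"
            using dist_crd_le[of b1 a1 w] q1(1) by (simp add: dist_norm)
        qed
      qed
      have V: "\<exists>w. (f ^^ n) (crd b0 z) = crd b w \<and> dist a w < R" if "z \<in> S" for z
      proof -
        have "(f ^^ n) (crd b0 z) \<in> ?V" using that connected_component_subset unfolding S by blast
        then show ?thesis by auto
      qed
      have near: "dist (crd b a) ((f ^^ n) (crd b0 z)) < 1/2" if "z \<in> T \<union> inside T" for z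
      proof -
        obtain w where w: "q n = crd b w" "dist a w < R" using V[OF ne] by (auto simp: q_def)
        have "dist (crd b a) (q n) \<le> 4 * R" using dist_crd_le[of b a w] w by (simp add: dist_norm)
        moreover have "dist (q n) ((f ^^ n) (crd b0 z)) \<le> 24 * r1" using main that by blast
        moreover have "dist (crd b a) ((f ^^ n) (crd b0 z)) \<le> dist (crd b a) (q n) + dist (q n) ((f ^^ n) (crd b0 z))"
          by (rule dist_triangle)
        ultimately show ?thesis using r1(2) R(2) by linarith
      qed
      have le: "dist a (icrd b ((f ^^ n) (crd b0 z))) < R" if "z \<in> T" for z
      proof -
        have "z \<in> S" using that T(3) by blast
        then obtain w where "(f ^^ n) (crd b0 z) = crd b w" "dist a w < R" using V by blast
        then show ?thesis by simp
      qed
      obtain a0 where a0: "(f ^^ n) (crd b0 t) = crd b a0" "dist a a0 < R" using V[of t] t T(3) by blast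
      have sub: "T \<union> inside T \<subseteq> \<Omega>"
      proof
        fix z assume "z \<in> T \<union> inside T"
        from fills_inside[OF T(1) t a a0 near le this] show "z \<in> \<Omega>" by (auto simp: \<Omega>_def)
      qed
      have "connected (T \<union> inside T)" using T by (intro connected_with_inside) (auto simp: compact_imp_closed)
      then have "T \<union> inside T \<subseteq> connected_component_set \<Omega> t" using t sub by (intro connected_component_maximal) auto
      also have "\<dots> = S"
      proof -
        have "t \<in> connected_component_set \<Omega> z0" using t T(3) unfolding S \<Omega>_def by blast
        then show ?thesis unfolding S \<Omega>_def[symmetric] using connected_component_eq by metis
      qed
      finally show ?thesis by blast
    qed simp
  qed
qed

text \<open>Being a component, \<open>S\<close> is relatively closed in the preimage of the open
  disc, so its part over a smaller closed disc is closed in the plane.\<close>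

lemma proper_pullback:
  assumes S: "S = connected_component_set {z. (f ^^ n) (crd b0 z) \<in> crd b ` ball a R} z0" "bounded S" and r: "r < R"
  shows "compact {z \<in> S. dist a (icrd b ((f ^^ n) (crd b0 z))) \<le> r}"
proof -
  define \<Omega> where "\<Omega> = {z. (f ^^ n) (crd b0 z) \<in> crd b ` ball a R}"
  define K where "K = (\<lambda>z. (f ^^ n) (crd b0 z)) -` (crd b ` cball a r)"
  have "closed (crd b ` cball a r)"
    by (intro compact_imp_closed compact_continuous_image continuous_crd compact_cball)
  then have K: "closed K" unfolding K_def by (rule closed_vimage[OF _ continuous_on_funpow_crd])
  have "closedin (top_of_set \<Omega>) S" unfolding S(1) \<Omega>_def by (rule closedin_connected_component)
  then obtain T where T: "closed T" "S = \<Omega> \<inter> T" by (auto simp: closedin_closed)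
  have eq: "{z \<in> S. dist a (icrd b ((f ^^ n) (crd b0 z))) \<le> r} = T \<inter> K"
  proof (intro set_eqI iffI)
    fix z assume z: "z \<in> {z \<in> S. dist a (icrd b ((f ^^ n) (crd b0 z))) \<le> r}"
    then have "z \<in> \<Omega>" using T(2) by blast
    then show "z \<in> T \<inter> K" using z T(2) by (auto simp: K_def \<Omega>_def)
  next
    fix z assume z: "z \<in> T \<inter> K"
    then obtain w where "(f ^^ n) (crd b0 z) = crd b w" "dist a w \<le> r" by (auto simp: K_def)
    then show "z \<in> {z \<in> S. dist a (icrd b ((f ^^ n) (crd b0 z))) \<le> r}"
      using z r T(2) by (auto simp: \<Omega>_def)
  qed
  have "bounded {z \<in> S. dist a (icrd b ((f ^^ n) (crd b0 z))) \<le> r}"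
    by (rule bounded_subset[OF S(2)]) auto
  then show ?thesis unfolding eq using K T(1) by (auto simp: compact_eq_bounded_closed intro: closed_Int)
qed

end

text \<open>Stated for all connected sets instead of components, so that it applies directly to
  images of a pullback under part of the iterate.\<close>

definition (in rat) tame :: "real \<Rightarrow> nat \<Rightarrow> riemann_sphere set \<Rightarrow> bool" where
  "tame r n V \<longleftrightarrow> (\<forall>i\<le>n. \<forall>B. connected B \<longrightarrow> (f ^^ i) ` B \<subseteq> V \<longrightarrow> (\<forall>p\<in>B. \<forall>q\<in>B. dist p q \<le> r))"

context mix begin

text \<open>A preimage in \<open>X\<close> with a ball of radius \<open>\<eta> / 5\<close> around it inside the pullback would contradict
  the assumption on \<^term>\<open>C6\<close>, so \<open>near_preimage\<close> applies with this \<open>\<eta>\<close>.\<close>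

lemma near_support:
  assumes C6: "C6 > 0"
      "\<And>u \<delta> s. u \<in> X \<Longrightarrow> 0 < \<delta> \<Longrightarrow> \<delta> \<le> 1/4 \<Longrightarrow> (\<And>j. j \<le> s \<Longrightarrow> small ((f ^^ j) ` ball u \<delta>)) \<Longrightarrow> \<delta> \<le> C6 * \<kappa> ^ s"
    and deg: "\<And>A y x. (\<And>i p q. i \<le> n \<Longrightarrow> p \<in> (f ^^ i) ` A \<Longrightarrow> q \<in> (f ^^ i) ` A \<Longrightarrow> dist p q \<le> r1) \<Longrightarrow> x \<in> A \<Longrightarrow> x \<in> X \<Longrightarrow>
       card {p \<in> A. (f ^^ n) p = y} \<le> D"
    and r1: "r1 > 0" "r1 \<le> 1/200" "24 * L * r1 < 1/2" "r1 < R0"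
    and L: "L \<ge> 1" "\<And>p q. dist (f p) (f q) \<le> L * dist p q"
    and a: "crd b a \<in> X" "cmod a \<le> 1" and R: "0 < R" "R \<le> 1/16"
    and tame: "tame r1 n (crd b ` ball a R)"
    and sm: "\<And>j. j \<le> s \<Longrightarrow> small ((f ^^ j) ` crd b ` ball a R)"
    and B: "connected B" "(f ^^ n) ` B \<subseteq> crd b ` ball a (R / 2)" "p \<in> B"
    and \<eta>: "\<eta> = 6 * C6 * \<kappa> ^ (n + s)"
  shows "\<exists>Z. finite Z \<and> card Z \<le> D \<and> Z \<subseteq> X \<and> B \<subseteq> (\<Union>u\<in>Z. cball u (8 * \<eta> * (5 * real D) ^ 48))"
proof -
  let ?V = "crd b ` ball a R"
  obtain b0 z0 where p: "p = crd b0 z0" "cmod z0 \<le> 1" by (rule hemisphere)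
  define S where "S = connected_component_set {z. (f ^^ n) (crd b0 z) \<in> ?V} z0"
  define F where "F z = icrd b ((f ^^ n) (crd b0 z))" for z
  have \<eta>0: "\<eta> > 0" using C6(1) kappa by (simp add: \<eta>)
  have BV: "(f ^^ n) ` B \<subseteq> ?V" using B(2) R by (auto 0 3)
  have Bd: "dist p q \<le> r1" if "q \<in> B" for q
    using tame B(1) BV B(3) that unfolding tame_def by blast
  have Bc: "\<exists>z. q = crd b0 z \<and> cmod z < 3" if "q \<in> B" for q
  proof -
    have "dist (crd b0 z0) q < 1/2" using Bd[OF that] r1(2) p(1) by simp
    then show ?thesis by (rule near_chart[OF p(2)]) blast
  qed
  have Bcrd: "crd b0 (icrd b0 q) = q" if "q \<in> B" for q using Bc[OF that] by auto
  have BS: "icrd b0 q \<in> S" if "q \<in> B" for q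
  proof -
    have "continuous_on B (icrd b0)"
      using Bc by (intro continuous_at_imp_continuous_on ballI isCont_icrd) (metis crd_neq_pole)
    then have "connected (icrd b0 ` B)" using B(1) by (rule connected_continuous_image)
    moreover have "z0 \<in> icrd b0 ` B" using B(3) p(1) by (metis icrd_crd image_eqI)
    moreover have "icrd b0 ` B \<subseteq> {z. (f ^^ n) (crd b0 z) \<in> ?V}" using BV Bcrd by auto
    ultimately have "icrd b0 ` B \<subseteq> S" unfolding S_def by (intro connected_component_maximal)
    then show ?thesis using that by blast
  qed
  have ne: "z0 \<in> S" using BS[OF B(3)] p(1) by simp
  have SV: "(f ^^ n) (crd b0 z) \<in> ?V" if "z \<in> S" for z
    using that connected_component_subset unfolding S_def by blast
  have diam: "dist ((f ^^ i) (crd b0 z)) ((f ^^ i) (crd b0 w)) \<le> r1" if "i \<le> n" "z \<in> S" "w \<in> S" for i z w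
  proof -
    have "connected ((\<lambda>z. (f ^^ i) (crd b0 z)) ` S)"
      by (rule connected_continuous_image[OF continuous_on_funpow_crd]) (simp add: S_def)
    moreover have "(f ^^ (n - i)) ((f ^^ i) x) = (f ^^ n) x" for x
      using that(1) funpow_add[of "n - i" i f] by simp
    then have "(f ^^ (n - i)) ` (\<lambda>z. (f ^^ i) (crd b0 z)) ` S \<subseteq> ?V" using SV by auto
    moreover have "n - i \<le> n" by simp
    ultimately show ?thesis using tame that unfolding tame_def by blast
  qed
  have geo: "open S" "simply_connected S" "S \<subseteq> ball z0 (6 * r1)"
    by (rule simply_connected_pullback[OF a(2) R p(2) r1(1-3) L S_def _ ne]; (rule diam; assumption))+
  have FS: "(f ^^ n) (crd b0 z) = crd b (F z)" "dist a (F z) < R" if "z \<in> S" for z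
    using SV[OF that] by (auto simp: F_def)
  have F: "F holomorphic_on S"
    unfolding F_def by (rule chart_holomorphic[OF geo(1)]) (simp add: FS(1))
  \<comment> \<open>Avoiding the forward images of critical points up to time \<open>n\<close> makes
    all preimages of \<open>y'\<close> simple, and choosing \<open>y'\<close> in \<open>X\<close>
    puts them into \<open>X\<close>.\<close>
  define P where "P = (\<Union>k\<le>n. (f ^^ k) ` crit)"
  have "finite P" using finite_crit by (simp add: P_def)
  moreover have "crd b a \<in> crd b ` ball a (R / 8)" using R by auto
  ultimately obtain y' where y': "y' \<in> crd b ` ball a (R / 8)" "y' \<in> X" "y' \<notin> P"
    using X_avoid_finite[OF open_crd_image[OF open_ball] _ a(1)] by metis
  then obtain y where y: "y' = crd b y" "dist a y < R / 8" by auto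
  define Z where "Z = {z \<in> S. F z = y}"
  have Zy: "(f ^^ n) (crd b0 z) = y'" if "z \<in> Z" for z using that FS(1) y(1) by (simp add: Z_def)
  have ZX: "crd b0 z \<in> X" if "z \<in> Z" for z using X_backward_funpow[of n "crd b0 z"] Zy[OF that] y'(2) by simp
  have inj: "inj_on (crd b0) Z" by (rule inj_onI) simp
  have sub: "crd b0 ` Z \<subseteq> {p \<in> crd b0 ` S. (f ^^ n) p = y'}" using Zy by (auto simp: Z_def)
  have fin: "finite {p \<in> crd b0 ` S. (f ^^ n) p = y'}"
    by (rule finite_subset[OF _ finite_preimages[of n y']]) blast
  have finZ: "finite Z" using finite_imageD[OF finite_subset[OF sub fin] inj] .
  have cardZ: "card Z \<le> D"
  proof (cases "Z = {}")
    case False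
    then obtain z where z: "z \<in> Z" by blast
    have "card Z = card (crd b0 ` Z)" using card_image[OF inj] by simp
    also have "\<dots> \<le> card {p \<in> crd b0 ` S. (f ^^ n) p = y'}" by (rule card_mono[OF fin sub])
    also have "\<dots> \<le> D"
    proof (rule deg[of _ "crd b0 z"])
      show "crd b0 z \<in> crd b0 ` S" using z by (auto simp: Z_def)
      show "crd b0 z \<in> X" by (rule ZX[OF z])
      show "dist p q \<le> r1" if "i \<le> n" "p \<in> (f ^^ i) ` crd b0 ` S" "q \<in> (f ^^ i) ` crd b0 ` S" for i p q
        using that diam by auto
    qed
    finally show ?thesis .
  qed simp
  have simple: "deriv F z \<noteq> 0" if z: "z \<in> Z" for z
  proof
    assume 0: "deriv F z = 0"
    have "(f ^^ n) (crd b0 z) \<noteq> pole b" using FS(1)[of z] z by (simp add: Z_def)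
    then obtain e where "rep (f ^^ n) b0 z b F e" unfolding F_def by (rule iter.rep_chart)
    then have "sdn n (crd b0 z) = 0" using iter.spherical_deriv_rep[of n b0 z b F e] 0 by (simp add: sdn_eq)
    then obtain i where i: "i < n" "(f ^^ i) (crd b0 z) \<in> crit" by (auto simp: sdn_def crit_def)
    have "(f ^^ (n - i)) ((f ^^ i) (crd b0 z)) = y'"
      using i(1) funpow_add[of "n - i" i f] Zy[OF z] by simp
    then have "y' \<in> P" using i unfolding P_def by (intro UN_I[of "n - i"]) auto
    then show False using y'(3) by blast
  qed
  have close: "\<exists>v. v \<notin> S \<and> cmod (z - v) \<le> \<eta>" if z: "z \<in> Z" for z
  \<comment> \<open>\<open>S\<close> lies in a disc of radius \<open>6 * r1\<close>, so for
    \<open>\<eta> >= 1\<close> the point \<open>z + 1\<close> is outside. Otherwise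
    \<open>\<eta>/5\<close> is below 1/4, as the estimate for balls about \<open>X\<close>
    demands.\<close>
  proof (cases "\<eta> \<ge> 1")
    case True
    have zS: "dist z0 z < 6 * r1" using geo(3) z by (auto simp: Z_def)
    have "z + 1 \<notin> S"
    proof
      assume "z + 1 \<in> S"
      then have "dist z0 (z + 1) < 6 * r1" using geo(3) by auto
      moreover have "dist z (z + 1) \<le> dist z0 z + dist z0 (z + 1)" by (metis dist_triangle3)
      ultimately show False using zS r1(2) by (simp add: dist_norm)
    qed
    then show ?thesis using True by (intro exI[of _ "z + 1"]) simp
  next
    case False
    show ?thesis
    proof (rule ccontr)
      assume neg: "\<not> ?thesis"
      have zS: "z \<in> S" using z by (simp add: Z_def)
      have dz: "dist (crd b0 z0) (crd b0 z) \<le> r1" using diam[of 0 z0 z] ne zS by simp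
      then have "dist (crd b0 z0) (crd b0 z) < 1/2" using r1(2) by simp
      then have z3: "cmod z < 3" by (rule near_chart[OF p(2)]) simp
      have sub: "ball (crd b0 z) (\<eta>/5) \<subseteq> crd b0 ` S"
      proof
        fix q assume q: "q \<in> ball (crd b0 z) (\<eta>/5)"
        then have "dist (crd b0 z0) q < 1/2" 
          using dz r1(2) False dist_triangle[of "crd b0 z0" q "crd b0 z"] by simp
        then obtain w where w: "q = crd b0 w" "cmod w < 3" by (rule near_chart[OF p(2)])
        have "cmod (z - w) \<le> 5 * dist (crd b0 z) (crd b0 w)" using z3 w(2) by (intro dist_crd_ge) auto
        also have "\<dots> \<le> \<eta>" using q w(1) by simp
        finally show "q \<in> crd b0 ` S" using neg w(1) by blast
      qed
      \<comment> \<open>Up to time \<open>n\<close> the images stay within \<open>r1 < R0\<close> of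
        the orbit; after that they lie in images of the disc, which remain small for
        \<open>s\<close> more steps. So the estimate for balls applies over \<open>n + s\<close>
        steps.\<close>
      have small: "small ((f ^^ j) ` ball (crd b0 z) (\<eta>/5))" if j: "j \<le> n + s" for j
      proof (cases "j \<le> n")
        case True
        have "(f ^^ j) ` crd b0 ` S \<subseteq> ball ((f ^^ j) (crd b0 z)) R0"
        proof (clarsimp)
          fix w assume "w \<in> S"
          then show "dist ((f ^^ j) (crd b0 z)) ((f ^^ j) (crd b0 w)) < R0"
            using diam[OF True zS, of w] r1(4) by linarith
        qed
        then show ?thesis unfolding small_def using sub by (meson image_mono subset_trans)
      next
        case False
        have "(f ^^ j) ` ball (crd b0 z) (\<eta>/5) \<subseteq> (f ^^ (j - n)) ` ?V"
        proof (rule image_subsetI)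
          fix q assume "q \<in> ball (crd b0 z) (\<eta>/5)"
          then have "(f ^^ n) q \<in> ?V" using sub SV by blast
          moreover have "(f ^^ j) q = (f ^^ (j - n)) ((f ^^ n) q)"
            using False funpow_add[of "j - n" n f] by simp
          ultimately show "(f ^^ j) q \<in> (f ^^ (j - n)) ` ?V" by simp
        qed
        moreover have "j - n \<le> s" using j by linarith
        ultimately show ?thesis using sm small_subset by blast
      qed
      \<comment> \<open>The factor 6 in \<open>\<eta>\<close> exceeds the 5 lost in the chart, which
        gives the contradiction.\<close>
      have "\<eta>/5 \<le> C6 * \<kappa> ^ (n + s)" by (rule C6(2)[OF ZX[OF z]]) (use \<eta>0 False small in auto)
      moreover have "C6 * \<kappa> ^ (n + s) > 0" using C6(1) kappa by simp
      ultimately show False by (simp add: \<eta>)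
    qed
  qed
  have "B \<subseteq> (\<Union>u\<in>crd b0 ` Z. cball u (8 * \<eta> * (5 * real D) ^ 48))"
  proof
    fix q assume q: "q \<in> B"
    have qS: "icrd b0 q \<in> S" by (rule BS[OF q])
    obtain w where w: "(f ^^ n) q = crd b w" "dist a w < R / 2" using B(2) q by auto
    have "\<exists>z\<in>Z. cmod (icrd b0 q - z) \<le> 2 * \<eta> * (5 * real D) ^ 48"
    proof (rule near_preimage[OF geo(1,2) _ F R(1) _ _ less_imp_le[OF y(2)] Z_def finZ cardZ simple qS _ close])
      show "S \<noteq> UNIV" using geo(3) not_bounded_UNIV bounded_subset[OF bounded_ball] by metis
      show "F ` S \<subseteq> ball a R" using FS(2) by auto
      show "compact {z \<in> S. dist a (F z) \<le> r}" if "r < R" for r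
        unfolding F_def by (rule proper_pullback[OF S_def bounded_subset[OF bounded_ball geo(3)] that])
      show "dist a (F (icrd b0 q)) \<le> R / 2" using w Bcrd[OF q] by (simp add: F_def)
    qed
    then obtain z where z: "z \<in> Z" "cmod (icrd b0 q - z) \<le> 2 * \<eta> * (5 * real D) ^ 48" by blast
    have "dist (crd b0 z) q \<le> 4 * cmod (z - icrd b0 q)" using dist_crd_le[of b0 z "icrd b0 q"] Bcrd[OF q] by simp
    also have "\<dots> \<le> 8 * \<eta> * (5 * real D) ^ 48" using z(2) by (simp add: norm_minus_commute)
    finally show "q \<in> (\<Union>u\<in>crd b0 ` Z. cball u (8 * \<eta> * (5 * real D) ^ 48))" using z(1) by auto
  qed
  moreover have "card (crd b0 ` Z) \<le> D" using cardZ card_image[OF inj] by simp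
  ultimately show ?thesis using finZ ZX by (intro exI[of _ "crd b0 ` Z"]) auto
qed

text \<open>The decay \<open>\<kappa>^n\<close> is balanced against the degree: 48 powers of
  \<open>D\<close> come from \<open>near_preimage\<close> and one more from the number of balls
  covering \<open>B\<close>. For large \<open>M\<close> these 49 powers are at most a constant times
  \<open>(1 / \<theta>)^n\<close>, with \<open>\<theta>\<close> the square root of
  \<open>\<kappa>\<close>. The additional \<open>s\<close> is the time for which the disc itself
  stays small.\<close>

lemma pullback_decay:
  shows "\<exists>\<theta> C7 r1. 0 < \<theta> \<and> \<theta> < 1 \<and> C7 > 0 \<and> r1 > 0 \<and> r1 \<le> 1/200 \<and>
     (\<forall>b a R n s B p. crd b a \<in> X \<longrightarrow> cmod a \<le> 1 \<longrightarrow> 0 < R \<longrightarrow> R \<le> 1/16 \<longrightarrow> tame r1 n (crd b ` ball a R) \<longrightarrow>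
       (\<forall>j\<le>s. small ((f ^^ j) ` crd b ` ball a R)) \<longrightarrow>
       connected B \<longrightarrow> (f ^^ n) ` B \<subseteq> crd b ` ball a (R / 2) \<longrightarrow> p \<in> B \<longrightarrow>
       (\<exists>u\<in>X. dist p u \<le> C7 * \<theta> ^ (n + s)) \<and> (\<forall>q\<in>B. dist p q \<le> C7 * \<theta> ^ (n + s)))"
proof -
  obtain C6 where C6: "C6 > 0"
    "\<And>u \<delta> s. u \<in> X \<Longrightarrow> 0 < \<delta> \<Longrightarrow> \<delta> \<le> 1/4 \<Longrightarrow> (\<And>j. j \<le> s \<Longrightarrow> small ((f ^^ j) ` ball u \<delta>)) \<Longrightarrow> \<delta> \<le> C6 * \<kappa> ^ s"
    by (rule exponential_shrinking_balls) blast
  obtain L where L: "L \<ge> 2" "\<And>p q. dist (f p) (f q) \<le> L * dist p q" using Lipschitz by blast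
  define \<theta> where "\<theta> = sqrt \<kappa>"
  have \<theta>: "0 < \<theta>" "\<theta> < 1" "\<theta> * \<theta> = \<kappa>" using kappa by (auto simp: \<theta>_def)
  define k where "k = card crit"
  have d1: "real d \<ge> 1" using degree_ge_2 by simp
  obtain M0 where M0: "real d ^ (49 * k) < (1 / \<theta>) ^ M0" using real_arch_pow[of "1 / \<theta>"] \<theta> by auto
  define M where "M = Suc M0"
  have "(1 / \<theta>) ^ M0 \<le> (1 / \<theta>) ^ M" using \<theta> unfolding M_def by (intro power_increasing) auto
  then have M: "real d ^ (49 * k) \<le> (1 / \<theta>) ^ M" "M \<ge> 1" using M0 by (auto simp: M_def)
  obtain r2 where r2: "r2 > 0"
    "\<And>A n y x. (\<And>i p q. i \<le> n \<Longrightarrow> p \<in> (f ^^ i) ` A \<Longrightarrow> q \<in> (f ^^ i) ` A \<Longrightarrow> dist p q \<le> r2) \<Longrightarrow> x \<in> A \<Longrightarrow> x \<in> X \<Longrightarrow>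
       card {p \<in> A. (f ^^ n) p = y} \<le> d ^ (card crit * (n div M + 1))"
    by (rule degree_bound[OF M(2)]) blast
  define r1 where "r1 = min (min r2 (1/200)) (min (R0 / 2) (1 / (50 * L)))"
  have "1 / (50 * L) > 0" using L(1) by simp
  then have r1: "r1 > 0" "r1 \<le> r2" "r1 \<le> 1/200" "r1 \<le> R0 / 2" "r1 \<le> 1 / (50 * L)"
    using r2(1) R0(1) unfolding r1_def by linarith+
  have "L * r1 \<le> L * (1 / (50 * L))" using r1(5) L(1) by (intro mult_left_mono) auto
  then have "L * r1 \<le> 1/50" using L(1) by simp
  then have r1L: "24 * L * r1 < 1/2" by (simp add: mult.assoc)
  have r1R: "r1 < R0" using r1(4) R0(1) by linarith
  \<comment> \<open>96 = 2 * 8 * 6: the passage from radius to diameter, the factor of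
    \<open>near_support\<close>, and the factor in \<open>\<eta>\<close>.\<close>
  define C7 where "C7 = 96 * C6 * 5 ^ 48 * real d ^ (49 * k)"
  have C7: "C7 > 0" using C6(1) d1 by (simp add: C7_def)
  have main: "(\<exists>u\<in>X. dist p u \<le> C7 * \<theta> ^ (n + s)) \<and> (\<forall>q\<in>B. dist p q \<le> C7 * \<theta> ^ (n + s))"
    if a: "crd b a \<in> X" "cmod a \<le> 1" "0 < R" "R \<le> 1/16" "tame r1 n (crd b ` ball a R)"
      and sm: "\<forall>j\<le>s. small ((f ^^ j) ` crd b ` ball a R)"
      and B: "connected B" "(f ^^ n) ` B \<subseteq> crd b ` ball a (R / 2)" "p \<in> B" for b a R n s B p
  proof -
    define D where "D = d ^ (k * (n div M + 1))"
    define \<eta> where "\<eta> = 6 * C6 * \<kappa> ^ (n + s)"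
    define e where "e = 8 * \<eta> * (5 * real D) ^ 48"
    have D1: "real D \<ge> 1" unfolding D_def of_nat_power using d1 by simp
    have \<eta>0: "\<eta> > 0" using C6(1) kappa by (simp add: \<eta>_def)
    have "\<exists>Z. finite Z \<and> card Z \<le> D \<and> Z \<subseteq> X \<and> B \<subseteq> (\<Union>u\<in>Z. cball u (8 * \<eta> * (5 * real D) ^ 48))"
    proof (rule near_support[OF C6 _ r1(1,3) r1L r1R _ L(2) a _ B \<eta>_def])
      show "card {p \<in> A. (f ^^ n) p = y} \<le> D"
        if "\<And>i p q. i \<le> n \<Longrightarrow> p \<in> (f ^^ i) ` A \<Longrightarrow> q \<in> (f ^^ i) ` A \<Longrightarrow> dist p q \<le> r1" "x \<in> A" "x \<in> X" for A y x
        unfolding D_def k_def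
      proof (rule r2(2)[OF _ that(2,3)])
        show "dist p q \<le> r2" if i: "i \<le> n" "p \<in> (f ^^ i) ` A" "q \<in> (f ^^ i) ` A" for i p q
          using that(1) \<open>\<And>i p q. i \<le> n \<Longrightarrow> p \<in> (f ^^ i) ` A \<Longrightarrow> q \<in> (f ^^ i) ` A \<Longrightarrow> dist p q \<le> r1\<close>[OF i] r1(2) by linarith
      qed
    qed (use L(1) sm in auto)
    then obtain Z where Z: "finite Z" "card Z \<le> D" "Z \<subseteq> X" "B \<subseteq> (\<Union>u\<in>Z. cball u e)" unfolding e_def by blast
    have e0: "e \<ge> 0" using \<eta>0 by (simp add: e_def)
    have "real D ^ 49 = (real d ^ (49 * k)) * (real d ^ (49 * k)) ^ (n div M)"
      by (simp add: D_def power_mult[symmetric] power_add[symmetric] algebra_simps)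
    also have "(real d ^ (49 * k)) ^ (n div M) \<le> ((1 / \<theta>) ^ M) ^ (n div M)"
      by (intro power_mono M) auto
    also have "\<dots> = (1 / \<theta>) ^ (M * (n div M))" by (simp add: power_mult)
    also have "\<dots> \<le> (1 / \<theta>) ^ n" using \<theta> by (intro power_increasing) auto
    finally have D49: "real D ^ 49 \<le> real d ^ (49 * k) * (1 / \<theta>) ^ n" by (simp add: mult_left_mono)
    have "2 * e * real D = 96 * C6 * 5 ^ 48 * real D ^ 49 * \<kappa> ^ (n + s)"
      by (simp add: e_def \<eta>_def power_mult_distrib power_Suc[of "real D" 48, simplified])
    also have "\<dots> \<le> 96 * C6 * 5 ^ 48 * (real d ^ (49 * k) * (1 / \<theta>) ^ n) * \<kappa> ^ (n + s)"
      using D49 C6(1) kappa by (intro mult_right_mono mult_left_mono) auto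
    also have "\<dots> = C7 * ((1 / \<theta>) ^ n * \<kappa> ^ (n + s))" by (simp only: C7_def mult_ac)
    also have "(1 / \<theta>) ^ n * \<kappa> ^ (n + s) = \<theta> ^ s * \<theta> ^ (n + s)"
      using \<theta>(1) unfolding \<theta>(3)[symmetric] by (simp add: power_mult_distrib power_add power_divide)
    also have "\<dots> \<le> 1 * \<theta> ^ (n + s)"
      using \<theta> by (intro mult_right_mono power_le_one) auto
    finally have E: "2 * e * real D \<le> C7 * \<theta> ^ (n + s)" using C7 by simp
    have "e * 1 \<le> (2 * e) * real D" using e0 D1 by (intro mult_mono) auto
    then have eE: "e \<le> C7 * \<theta> ^ (n + s)" using E by simp
    obtain u where u: "u \<in> Z" "p \<in> cball u e" using Z(4) B(3) by blast
    then have "dist p u \<le> C7 * \<theta> ^ (n + s)" using eE by (simp add: dist_commute)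
    moreover have "dist p q \<le> C7 * \<theta> ^ (n + s)" if "q \<in> B" for q
    proof -
      have "dist p q \<le> 2 * e * real (card Z)" by (rule connected_cover_dist[OF B(1) Z(1,4) B(3) that e0])
      also have "\<dots> \<le> 2 * e * real D" using Z(2) e0 by (intro mult_left_mono) auto
      finally show ?thesis using E by linarith
    qed
    ultimately show ?thesis using u(1) Z(3) by blast
  qed
  show ?thesis
    by (intro exI[of _ \<theta>] exI[of _ C7] exI[of _ r1] conjI allI impI \<theta>(1,2) C7 r1(1,3); (rule main[THEN conjunct1] main[THEN conjunct2]; assumption))
qed

end

section \<open>Removal of the smallness assumption by induction over scales\<close>

lemma chart_ball_subset:
  assumes "cmod a \<le> 1" "5 * r \<le> R" "r \<le> 1/2"
  shows "ball (crd b a) r \<subseteq> crd b ` ball a R"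
proof
  fix q assume q: "q \<in> ball (crd b a) r"
  then have "dist (crd b a) q < 1/2" using assms(3) by simp
  then obtain w where w: "q = crd b w" "cmod w < 3" by (rule near_chart[OF assms(1)])
  have "cmod (a - w) \<le> 5 * dist (crd b a) (crd b w)" using assms(1) w(2) by (intro dist_crd_ge) auto
  then have "dist a w < R" using q w(1) assms(2) by (simp add: dist_norm)
  then show "q \<in> crd b ` ball a R" using w(1) by auto
qed

lemma (in rat) connected_preimage_small_funpow:
  assumes "\<eta> > 0"
  shows "\<exists>\<delta>>0. \<forall>k\<le>l. \<forall>B. connected B \<longrightarrow> (\<forall>p\<in>B. \<forall>q\<in>B. dist ((f ^^ k) p) ((f ^^ k) q) < \<delta>) \<longrightarrow> (\<forall>p\<in>B. \<forall>q\<in>B. dist p q \<le> \<eta>)"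
  using assms
proof (induction l arbitrary: \<eta>)
  case 0
  then show ?case by (intro exI[of _ \<eta>]) (auto intro: less_imp_le)
next
  case (Suc l)
  obtain \<delta>1 where \<delta>1: "\<delta>1 > 0"
    "\<And>B x p q. connected B \<Longrightarrow> f ` B \<subseteq> ball x \<delta>1 \<Longrightarrow> p \<in> B \<Longrightarrow> q \<in> B \<Longrightarrow> dist p q \<le> \<eta>"
    by (rule connected_preimage_small[OF Suc.prems]) blast
  define \<eta>' where "\<eta>' = min (\<delta>1 / 2) \<eta>"
  have \<eta>': "\<eta>' > 0" "\<eta>' < \<delta>1" "\<eta>' \<le> \<eta>" using \<delta>1(1) Suc.prems by (auto simp: \<eta>'_def)
  obtain \<delta> where \<delta>0: "\<delta> > 0"
    "\<forall>k\<le>l. \<forall>B. connected B \<longrightarrow> (\<forall>p\<in>B. \<forall>q\<in>B. dist ((f ^^ k) p) ((f ^^ k) q) < \<delta>) \<longrightarrow> (\<forall>p\<in>B. \<forall>q\<in>B. dist p q \<le> \<eta>')"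
    using Suc.IH[OF \<eta>'(1)] by (elim exE conjE)
  have \<delta>: "\<delta> > 0" "\<And>k B p q. k \<le> l \<Longrightarrow> connected B \<Longrightarrow> (\<forall>p\<in>B. \<forall>q\<in>B. dist ((f ^^ k) p) ((f ^^ k) q) < \<delta>) \<Longrightarrow>
      p \<in> B \<Longrightarrow> q \<in> B \<Longrightarrow> dist p q \<le> \<eta>'"
    using \<delta>0 by blast+
  define \<delta>' where "\<delta>' = min \<delta> \<eta>"
  show ?case
  proof (intro exI[of _ \<delta>'] conjI allI impI ballI)
    show "\<delta>' > 0" using \<delta>(1) Suc.prems by (simp add: \<delta>'_def)
    fix k B p q
    assume k: "k \<le> Suc l" and B: "connected B" "\<forall>p\<in>B. \<forall>q\<in>B. dist ((f ^^ k) p) ((f ^^ k) q) < \<delta>'" "p \<in> B" "q \<in> B"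
    show "dist p q \<le> \<eta>"
    proof (cases k)
      case 0
      then have "dist p q < \<delta>'" using B(2,3,4) by simp
      then show ?thesis by (simp add: \<delta>'_def)
    next
      case (Suc i)
      have c: "connected (f ` B)" by (rule connected_continuous_image[OF continuous_f B(1)])
      have il: "i \<le> l" using k Suc by simp
      have "\<forall>p\<in>f ` B. \<forall>q\<in>f ` B. dist ((f ^^ i) p) ((f ^^ i) q) < \<delta>"
      proof (intro ballI)
        fix p' q' assume "p' \<in> f ` B" "q' \<in> f ` B"
        then obtain p q where "p \<in> B" "q \<in> B" "p' = f p" "q' = f q" by blast
        then have "dist ((f ^^ k) p) ((f ^^ k) q) < \<delta>'" "(f ^^ i) p' = (f ^^ k) p" "(f ^^ i) q' = (f ^^ k) q"
          using B(2) Suc by (auto simp: funpow_swap1)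
        then show "dist ((f ^^ i) p') ((f ^^ i) q') < \<delta>" by (simp add: \<delta>'_def)
      qed
      then have "dist (f p) y \<le> \<eta>'" if "y \<in> f ` B" for y using \<delta>(2)[OF il c] B(3) that by blast
      then have "f ` B \<subseteq> ball (f p) \<delta>1" using \<eta>'(2) by force
      then show ?thesis using \<delta>1(2) B(1,3,4) by blast
    qed
  qed
qed

lemma (in rat) tameD: "tame r n V \<Longrightarrow> i \<le> n \<Longrightarrow> connected B \<Longrightarrow> (f ^^ i) ` B \<subseteq> V \<Longrightarrow> p \<in> B \<Longrightarrow> q \<in> B \<Longrightarrow> dist p q \<le> r"
  unfolding tame_def by blast

context mix begin

text \<open>The disc of radius \<open>R / 2\<^sup>j\<close> has small pullbacks for \<open>l j\<close> steps by induction on \<open>j\<close>. Its pullbacks under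
  \<open>f\<^sup>l\<^sup>j\<close> have diameter of order \<open>4\<^sup>-\<^sup>j\<close>, so for large \<open>j\<close> they lie in a disc of radius \<open>\<sigma> = R / 2\<^sup>j\<^sup>+\<^sup>1\<close> around a
  point of \<open>X\<close>, and discs of radius \<open>\<sigma>\<close> have small pullbacks of all orders.\<close>

lemma exponential_shrinking_support:
  "\<exists>C \<theta> r. C > 0 \<and> 0 < \<theta> \<and> \<theta> < 1 \<and> r > 0 \<and>
     (\<forall>x\<in>X. \<forall>n B. connected B \<longrightarrow> (f ^^ n) ` B \<subseteq> ball x r \<longrightarrow> (\<forall>p\<in>B. \<forall>q\<in>B. dist p q \<le> C * \<theta> ^ n))"
proof -
  obtain \<theta> C7 r1 where \<theta>: "0 < \<theta>" "\<theta> < 1" and C7: "C7 > 0" and r1: "r1 > 0"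
    and decay: "\<forall>b a R n s B p. crd b a \<in> X \<longrightarrow> cmod a \<le> 1 \<longrightarrow> 0 < R \<longrightarrow> R \<le> 1/16 \<longrightarrow> tame r1 n (crd b ` ball a R) \<longrightarrow>
       (\<forall>j\<le>s. small ((f ^^ j) ` crd b ` ball a R)) \<longrightarrow>
       connected B \<longrightarrow> (f ^^ n) ` B \<subseteq> crd b ` ball a (R / 2) \<longrightarrow> p \<in> B \<longrightarrow>
       (\<exists>u\<in>X. dist p u \<le> C7 * \<theta> ^ (n + s)) \<and> (\<forall>q\<in>B. dist p q \<le> C7 * \<theta> ^ (n + s))"
    using pullback_decay by metis
  have Cpow: "C7 * \<theta> ^ (n + s) \<le> C7 * \<theta> ^ n" for n s
    using C7 \<theta> by (intro mult_left_mono power_decreasing) auto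
  obtain L where L: "L \<ge> 2" "\<And>n p q. dist ((f ^^ n) p) ((f ^^ n) q) \<le> L ^ n * dist p q"
    by (rule ex_iterate_Lipschitz) blast
  \<comment> \<open>Each halving of the radius is granted \<open>l\<close> steps; with
    \<open>\<theta>^l <= 1/4\<close> the decay outruns the halving.\<close>
  obtain l0 where l0: "\<theta> ^ l0 < 1/4" using real_arch_pow_inv[of "1/4" \<theta>] \<theta> by auto
  define l where "l = Suc l0"
  have "\<theta> ^ l \<le> \<theta> ^ l0" unfolding l_def using \<theta> by (intro power_decreasing) auto
  then have l: "\<theta> ^ l \<le> 1/4" "l \<ge> 1" using l0 by (auto simp: l_def)
  obtain \<delta> where \<delta>0: "\<delta> > 0"
    "\<forall>k\<le>l. \<forall>B. connected B \<longrightarrow> (\<forall>p\<in>B. \<forall>q\<in>B. dist ((f ^^ k) p) ((f ^^ k) q) < \<delta>) \<longrightarrow> (\<forall>p\<in>B. \<forall>q\<in>B. dist p q \<le> r1)"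
    using connected_preimage_small_funpow[OF r1, of l] by (elim exE conjE)
  have \<delta>: "\<delta> > 0" "\<And>k B p q. k \<le> l \<Longrightarrow> connected B \<Longrightarrow> (\<forall>p\<in>B. \<forall>q\<in>B. dist ((f ^^ k) p) ((f ^^ k) q) < \<delta>) \<Longrightarrow>
      p \<in> B \<Longrightarrow> q \<in> B \<Longrightarrow> dist p q \<le> r1"
    using \<delta>0 by blast+
  \<comment> \<open>If the disc stays small for \<open>s\<close> further steps, the decay bound is
    below \<open>\<delta>\<close> already for \<open>n = 0\<close>, where the induction over scales
    starts. \<open>R\<close> is then chosen according to \<open>s\<close>.\<close>
  obtain s where s: "\<theta> ^ s < \<delta> / C7" using real_arch_pow_inv[of "\<delta> / C7" \<theta>] \<theta> C7 \<delta>(1) by auto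
  have s': "C7 * \<theta> ^ (n + s) < \<delta>" for n
  proof -
    have "C7 * \<theta> ^ (n + s) \<le> C7 * \<theta> ^ s" using C7 \<theta> by (intro mult_left_mono power_decreasing) auto
    also have "\<dots> < \<delta>" using s C7 by (simp add: pos_less_divide_eq mult.commute)
    finally show ?thesis .
  qed
  define R where "R = min (r1 / 8) (min (1/16) (R0 / (8 * L ^ s)))"
  have "R0 / (8 * L ^ s) > 0" using R0(1) L(1) by simp
  then have R: "R > 0" "8 * R \<le> r1" "R \<le> 1/16" "R \<le> R0 / (8 * L ^ s)"
    using r1 unfolding R_def by linarith+
  have RL: "L ^ s * (4 * R) < R0"
  proof -
    have "L ^ s * (4 * R) \<le> L ^ s * (4 * (R0 / (8 * L ^ s)))" using R(4) L(1) by (intro mult_left_mono) auto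
    also have "\<dots> = R0 / 2" using L(1) by simp
    finally show ?thesis using R0(1) by linarith
  qed
  have sm: "small ((f ^^ j) ` crd b ` ball a R')" if "j \<le> s" "R' \<le> R" for j b a R'
  proof -
    have "(f ^^ j) ` crd b ` ball a R' \<subseteq> ball ((f ^^ j) (crd b a)) R0"
    proof (clarsimp)
      fix w assume w: "dist a w < R'"
      have "dist ((f ^^ j) (crd b a)) ((f ^^ j) (crd b w)) \<le> L ^ j * dist (crd b a) (crd b w)" by (rule L(2))
      also have "\<dots> \<le> L ^ s * (4 * R)"
        using L(1) that w R(1) dist_crd_le[of b a w] by (intro mult_mono power_increasing) (auto simp: dist_norm)
      finally show "dist ((f ^^ j) (crd b a)) ((f ^^ j) (crd b w)) < R0" using RL by linarith
    qed
    then show ?thesis unfolding small_def by blast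
  qed
  have Rj: "0 < R / 2 ^ j" "R / 2 ^ j \<le> R" for j :: nat
    using R(1) divide_left_mono[of 1 "2 ^ j" R] by auto
  have P: "tame r1 (l * j) (crd b ` ball a (R / 2 ^ j))" if a: "crd b a \<in> X" "cmod a \<le> 1" for b a j
  proof (induction j)
    case 0
    have "dist p q \<le> r1" if pq: "p \<in> crd b ` ball a R" "q \<in> crd b ` ball a R" for p q
    proof -
      obtain w w' where w: "p = crd b w" "dist a w < R" "q = crd b w'" "dist a w' < R" using pq by auto
      have "dist p q \<le> dist (crd b a) p + dist (crd b a) q" by (metis dist_triangle3)
      also have "\<dots> \<le> 4 * R + 4 * R" using w dist_crd_le[of b a w] dist_crd_le[of b a w'] by (simp add: dist_norm)
      finally show ?thesis using R(2) by simp
    qed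
    then have "dist p q \<le> r1" if "B \<subseteq> crd b ` ball a R" "p \<in> B" "q \<in> B" for p q B using that by blast
    then show ?case unfolding tame_def by simp
  next
    case (Suc j)
    show ?case
      unfolding tame_def
    proof (intro allI impI ballI)
      fix i B p q
      assume i: "i \<le> l * Suc j" and B: "connected B" "(f ^^ i) ` B \<subseteq> crd b ` ball a (R / 2 ^ Suc j)" "p \<in> B" "q \<in> B"
      have half: "R / 2 ^ Suc j = R / 2 ^ j / 2" by simp
      show "dist p q \<le> r1"
      proof (cases "i \<le> l * j")
        case True
        have "crd b ` ball a (R / 2 ^ Suc j) \<subseteq> crd b ` ball a (R / 2 ^ j)"
          unfolding half using Rj(1)[of j] by (intro image_mono subset_ball) simp
        then show ?thesis by (rule tameD[OF Suc.IH True B(1) subset_trans[OF B(2)] B(3,4)])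
      next
        case False
        \<comment> \<open>The first \<open>k <= l\<close> iterates are split off: by decay their
          image of \<open>B\<close> has diameter below \<open>\<delta>\<close>, and then
          \<open>B\<close> itself has diameter at most \<open>r1\<close>.\<close>
        define k where "k = i - l * j"
        have k: "k \<le> l" "i = l * j + k" using i False by (auto simp: k_def)
        have c: "connected ((f ^^ k) ` B)" by (rule connected_continuous_image[OF iter.continuous_f B(1)])
        have im: "(f ^^ (l * j)) ` (f ^^ k) ` B \<subseteq> crd b ` ball a (R / 2 ^ j / 2)"
          using B(2) unfolding half k(2) funpow_add by (simp add: image_comp)
        have "dist ((f ^^ k) p) ((f ^^ k) q) < \<delta>" if "p \<in> B" "q \<in> B" for p q
        proof -
          have "R / 2 ^ j \<le> 1/16" using Rj(2)[of j] R(3) by linarith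
          from decay[rule_format, OF a Rj(1) this Suc.IH sm[OF _ Rj(2)] c im imageI[OF that(1)]]
          have "\<forall>q'\<in>(f ^^ k) ` B. dist ((f ^^ k) p) q' \<le> C7 * \<theta> ^ (l * j + s)" by blast
          then have "dist ((f ^^ k) p) ((f ^^ k) q) \<le> C7 * \<theta> ^ (l * j + s)" using that(2) by blast
          then show ?thesis using s'[of "l * j"] by linarith
        qed
        then show ?thesis using \<delta>(2)[OF k(1) B(1)] B(3,4) by blast
      qed
    qed
  qed
  \<comment> \<open>\<open>10 * E < \<sigma>\<close> is needed with \<open>E\<close> at most
    \<open>C7 / 4^j\<close> and \<open>\<sigma> = R / 2^j / 2\<close>, so \<open>2^j\<close> has to
    exceed \<open>20 * C7 / R\<close>; 24 leaves room.\<close>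
  obtain j0 where j0: "(1/2) ^ j0 < R / (24 * C7)" using real_arch_pow_inv[of "R / (24 * C7)" "1/2"] R(1) C7 by auto
  define j where "j = Suc j0"
  define N where "N = l * j"
  define \<sigma> where "\<sigma> = R / 2 ^ Suc j"
  define E where "E = C7 * \<theta> ^ (N + s)"
  have N: "N \<ge> 1" using l(2) by (simp add: N_def j_def)
  have \<sigma>: "0 < \<sigma>" "\<sigma> \<le> R" "\<sigma> = R / 2 ^ j / 2" using Rj[of "Suc j"] by (auto simp: \<sigma>_def)
  have E: "10 * E < \<sigma>" "E \<ge> 0"
  proof -
    have "E \<le> C7 * \<theta> ^ N" unfolding E_def by (rule Cpow)
    also have "\<theta> ^ N = (\<theta> ^ l) ^ j" by (simp add: N_def power_mult)
    also have "C7 * (\<theta> ^ l) ^ j \<le> C7 * (1/4) ^ j" using C7 l(1) \<theta> by (intro mult_left_mono power_mono) auto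
    also have "\<dots> = C7 * (1/2) ^ j * (1/2) ^ j" by (simp add: power_mult_distrib[symmetric])
    also have "\<dots> \<le> C7 * (1/2) ^ j0 * (1/2) ^ j" unfolding j_def using C7 by (intro mult_right_mono mult_left_mono power_decreasing) auto
    also have "\<dots> < R / 24 * (1/2) ^ j"
      using j0 C7 by (intro mult_strict_right_mono) (auto simp: field_simps)
    finally have "E < R / 24 * (1/2) ^ j" .
    then show "10 * E < \<sigma>" using R(1) by (simp add: \<sigma>(3) power_divide field_simps)
    show "E \<ge> 0" using C7 \<theta> by (simp add: E_def)
  qed
  have half: "x / 2 \<le> x" if "0 < x" for x :: real using that by simp
  have "\<sigma> \<le> R / 2 ^ j" unfolding \<sigma>(3) by (rule half[OF Rj(1)])
  then have subj: "crd b ` ball a \<sigma> \<subseteq> crd b ` ball a (R / 2 ^ j)" for b a by (intro image_mono subset_ball)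
  have T: "\<forall>b a. crd b a \<in> X \<longrightarrow> cmod a \<le> 1 \<longrightarrow>
      (\<forall>B. connected B \<longrightarrow> (f ^^ i) ` B \<subseteq> crd b ` ball a \<sigma> \<longrightarrow> (\<forall>p\<in>B. \<forall>q\<in>B. dist p q \<le> r1))" for i
  proof (induction i rule: less_induct)
    case (less i)
    show ?case
    proof (intro allI impI ballI)
      fix b a B p q
      assume a: "crd b a \<in> X" "cmod a \<le> 1" and B: "connected B" "(f ^^ i) ` B \<subseteq> crd b ` ball a \<sigma>" "p \<in> B" "q \<in> B"
      have tameN: "tame r1 N (crd b ` ball a (R / 2 ^ j))" unfolding N_def by (rule P[OF a])
      show "dist p q \<le> r1"
      proof (cases "i \<le> N")
        case True
        show ?thesis by (rule tameD[OF tameN True B(1) subset_trans[OF B(2) subj] B(3,4)])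
      next
        case False
        define k where "k = i - N"
        have k: "k < i" "i = N + k" using False N by (auto simp: k_def)
        have c: "connected ((f ^^ k) ` B)" by (rule connected_continuous_image[OF iter.continuous_f B(1)])
        have im: "(f ^^ N) ` (f ^^ k) ` B \<subseteq> crd b ` ball a (R / 2 ^ j / 2)"
          using B(2) unfolding \<sigma>(3)[symmetric] k(2) funpow_add by (simp add: image_comp)
        have "R / 2 ^ j \<le> 1/16" using Rj(2)[of j] R(3) by linarith
        from decay[rule_format, OF a Rj(1) this tameN sm[OF _ Rj(2)] c im imageI[OF B(3)]]
        have dec: "(\<exists>u\<in>X. dist ((f ^^ k) p) u \<le> E) \<and> (\<forall>q'\<in>(f ^^ k) ` B. dist ((f ^^ k) p) q' \<le> E)"
          unfolding E_def by blast
        then obtain u where u: "u \<in> X" "dist ((f ^^ k) p) u \<le> E" by blast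
        obtain b' a' where u': "u = crd b' a'" "cmod a' \<le> 1" by (rule hemisphere)
        \<comment> \<open>All points of the image are within \<open>2 * E < \<sigma> / 5\<close> of
          \<open>u\<close>, and the chart factor 5 leads to the disc of radius
          \<open>\<sigma>\<close>. This is the reason for \<open>10 * E < \<sigma>\<close>.\<close>
        have "(f ^^ k) ` B \<subseteq> ball (crd b' a') (\<sigma> / 5)"
        proof
          fix q' assume "q' \<in> (f ^^ k) ` B"
          then have "dist ((f ^^ k) p) q' \<le> E" using dec by blast
          then have "dist u q' \<le> E + E" using u(2) dist_triangle3[of u q' "(f ^^ k) p"] by linarith
          then show "q' \<in> ball (crd b' a') (\<sigma> / 5)" using E u'(1) by simp
        qed
        also have "\<dots> \<subseteq> crd b' ` ball a' \<sigma>"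
          by (rule chart_ball_subset[OF u'(2)]) (use \<sigma>(1,2) R(3) in auto)
        finally have "(f ^^ k) ` B \<subseteq> crd b' ` ball a' \<sigma>" .
        moreover have "crd b' a' \<in> X" using u(1) u'(1) by simp
        ultimately show ?thesis using less.IH[rule_format, OF k(1) _ u'(2) B(1) _ B(3,4)] by blast
      qed
    qed
  qed
  show ?thesis
  proof (rule exI[of _ C7], rule exI[of _ \<theta>], rule exI[of _ "\<sigma> / 10"], intro conjI ballI allI impI)
    show "C7 > 0" "0 < \<theta>" "\<theta> < 1" by (fact C7 \<theta>)+
    show "\<sigma> / 10 > 0" using \<sigma>(1) by simp
    fix x n B p q assume x: "x \<in> X" and B: "connected B" "(f ^^ n) ` B \<subseteq> ball x (\<sigma> / 10)" "p \<in> B" "q \<in> B"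
    obtain b a where a: "x = crd b a" "cmod a \<le> 1" by (rule hemisphere)
    have "ball (crd b a) (\<sigma> / 10) \<subseteq> crd b ` ball a (\<sigma> / 2)"
      by (rule chart_ball_subset[OF a(2)]) (use \<sigma>(1,2) R(3) in auto)
    then have im: "(f ^^ n) ` B \<subseteq> crd b ` ball a (\<sigma> / 2)" using B(2) a(1) by blast
    have x': "crd b a \<in> X" using x a(1) by simp
    have tame: "tame r1 n (crd b ` ball a \<sigma>)" unfolding tame_def using T x' a(2) by simp
    have "\<sigma> \<le> 1/16" using \<sigma>(2) R(3) by linarith
    from decay[rule_format, OF x' a(2) \<sigma>(1) this tame sm[OF _ \<sigma>(2)] B(1) im B(3)]
    have "dist p q \<le> C7 * \<theta> ^ (n + s)" using B(4) by blast
    then show "dist p q \<le> C7 * \<theta> ^ n" using Cpow[of n s] by linarith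
  qed
qed

text \<open>For \<open>n >= N\<close> the constant is absorbed by passing from
  \<open>\<theta>\<close> to its square root \<open>\<tau>\<close>. For the finitely many smaller
  \<open>n\<close> the radius is reduced until connected preimages have diameter at most
  \<open>\<tau>^N\<close>, which is at most \<open>\<tau>^n\<close>.\<close>

theorem exponential_shrinking_components:
  "\<exists>\<theta>>1. \<exists>r>0. \<forall>x\<in>X. \<forall>n\<ge>1. \<forall>W\<in>components ((f ^^ n) -` ball x r). diameter W \<le> \<theta> powi (- int n)"
proof -
  obtain C \<theta> r where C: "C > 0" and \<theta>: "0 < \<theta>" "\<theta> < 1" and r: "r > 0"
    and *: "\<forall>x\<in>X. \<forall>n B. connected B \<longrightarrow> (f ^^ n) ` B \<subseteq> ball x r \<longrightarrow> (\<forall>p\<in>B. \<forall>q\<in>B. dist p q \<le> C * \<theta> ^ n)"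
    using exponential_shrinking_support by metis
  define \<tau> where "\<tau> = sqrt \<theta>"
  have \<tau>: "0 < \<tau>" "\<tau> < 1" "\<theta> = \<tau> * \<tau>" using \<theta> by (auto simp: \<tau>_def)
  obtain N where N: "\<tau> ^ N < 1 / C" using real_arch_pow_inv[of "1 / C" \<tau>] \<tau> C by auto
  have large: "C * \<theta> ^ n \<le> \<tau> ^ n" if "n \<ge> N" for n
  proof -
    have "\<tau> ^ n \<le> \<tau> ^ N" using that \<tau> by (intro power_decreasing) auto
    then have "C * \<tau> ^ n \<le> C * (1 / C)" using N C by (intro mult_left_mono) auto
    then have "C * \<tau> ^ n \<le> 1" using C by simp
    then have "C * \<tau> ^ n * \<tau> ^ n \<le> 1 * \<tau> ^ n" using \<tau> by (intro mult_right_mono) auto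
    then show ?thesis by (simp add: \<tau>(3) power_mult_distrib mult.assoc)
  qed
  obtain \<delta> where \<delta>0: "\<delta> > 0"
    "\<forall>k\<le>N. \<forall>B. connected B \<longrightarrow> (\<forall>p\<in>B. \<forall>q\<in>B. dist ((f ^^ k) p) ((f ^^ k) q) < \<delta>) \<longrightarrow> (\<forall>p\<in>B. \<forall>q\<in>B. dist p q \<le> \<tau> ^ N)"
    using connected_preimage_small_funpow[OF zero_less_power[OF \<tau>(1)], of N N] by (elim exE conjE)
  have \<delta>: "\<delta> > 0" "\<And>k B p q. k \<le> N \<Longrightarrow> connected B \<Longrightarrow> (\<forall>p\<in>B. \<forall>q\<in>B. dist ((f ^^ k) p) ((f ^^ k) q) < \<delta>) \<Longrightarrow>
      p \<in> B \<Longrightarrow> q \<in> B \<Longrightarrow> dist p q \<le> \<tau> ^ N"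
    using \<delta>0 by blast+
  define r0 where "r0 = min r (\<delta> / 2)"
  have "diameter W \<le> (1 / \<tau>) powi (- int n)" if x: "x \<in> X" and W: "W \<in> components ((f ^^ n) -` ball x r0)" for x n W
  proof -
    have conn: "connected W" and sub: "(f ^^ n) ` W \<subseteq> ball x r0" and ne: "W \<noteq> {}"
      using in_components_connected[OF W] in_components_subset[OF W] in_components_nonempty[OF W] by auto
    have "dist p q \<le> \<tau> ^ n" if pq: "p \<in> W" "q \<in> W" for p q
    proof (cases "n \<ge> N")
      case True
      have "(f ^^ n) ` W \<subseteq> ball x r" using sub by (auto simp: r0_def)
      then have "dist p q \<le> C * \<theta> ^ n" using * x conn pq by blast
      then show ?thesis using large[OF True] by linarith
    next
      case False
      have "dist ((f ^^ n) p) ((f ^^ n) q) < \<delta>" if "p \<in> W" "q \<in> W" for p q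
      proof -
        have "dist x ((f ^^ n) p) < \<delta> / 2" "dist x ((f ^^ n) q) < \<delta> / 2" using sub that by (auto simp: r0_def)
        then show ?thesis using dist_triangle3[of "(f ^^ n) p" "(f ^^ n) q" x] by linarith
      qed
      then have "dist p q \<le> \<tau> ^ N" using \<delta>(2)[of n W p q] False conn pq by auto
      also have "\<dots> \<le> \<tau> ^ n" using False \<tau> by (intro power_decreasing) auto
      finally show ?thesis .
    qed
    then have "diameter W \<le> \<tau> ^ n" using ne unfolding diameter_def by (auto intro!: cSUP_least)
    also have "\<dots> = (1 / \<tau>) powi (- int n)" using \<tau>(1) by (simp add: power_int_minus power_int_divide_distrib field_simps)
    finally show ?thesis .
  qed
  moreover have "1 / \<tau> > 1" using \<tau> by simp
  moreover have "r0 > 0" using r \<delta>(1) by (simp add: r0_def)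
  ultimately show ?thesis by blast
qed

end

section \<open>The Julia set lies in the support\<close>

definition moebius :: "complex \<Rightarrow> complex \<Rightarrow> complex \<Rightarrow> complex \<Rightarrow> riemann_sphere \<Rightarrow> riemann_sphere" where
  "moebius a b c e = rational_map [:b, a:] [:e, c:]"

lemma hol_map_moebius:
  assumes "a * e - b * c \<noteq> 0"
  shows "hol_map (moebius a b c e)"
proof -
  have "coprime [:b, a:] [:e, c:]"
  proof (rule coprimeI)
    fix r assume r: "r dvd [:b, a:]" "r dvd [:e, c:]"
    have "r dvd smult a [:e, c:] - smult c [:b, a:]" using r by (intro dvd_diff dvd_smult)
    also have "smult a [:e, c:] - smult c [:b, a:] = [:a * e - b * c:]" by (simp add: mult.commute)
    finally show "is_unit r" using assms by (meson dvd_trans is_unit_pCons_iff dvd_field_iff is_unit_triv)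
  qed
  moreover have "max (degree [:b, a:]) (degree [:e, c:]) = 1" using assms by auto
  ultimately have "rational_map_of_degree 1 (moebius a b c e)"
    unfolding rational_map_of_degree_def moebius_def by blast
  then interpret nonconst_rat "moebius a b c e" 1 by unfold_locales simp_all
  show ?thesis by (rule hol_map_axioms)
qed

lemma moebius_Plane: "moebius a b c e (Plane z) = (if c * z + e = 0 then Infty else Plane ((a * z + b) / (c * z + e)))"
  by (simp add: moebius_def rational_map_def add.commute mult.commute)

lemma moebius_Infty: "a \<noteq> 0 \<or> c \<noteq> 0 \<Longrightarrow> moebius a b c e Infty = (if c = 0 then Infty else Plane (a / c))"
  by (auto simp: moebius_def rational_map_def Let_def)

lemma moebius_inverse:
  assumes "a * e - b * c \<noteq> 0"
  shows "moebius e (- b) (- c) a (moebius a b c e p) = p"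
proof (cases p)
  case (Plane z)
  show ?thesis
  proof (cases "c * z + e = 0")
    case True
    have "c \<noteq> 0" using True assms by auto
    moreover have "z = - e / c" using True \<open>c \<noteq> 0\<close> by (simp add: field_simps add_eq_0_iff)
    ultimately show ?thesis using True Plane by (simp add: moebius_Plane moebius_Infty)
  next
    case False
    have 1: "- c * ((a * z + b) / (c * z + e)) + a = (a * e - b * c) / (c * z + e)"
      using False by (simp add: field_simps)
    have 2: "e * ((a * z + b) / (c * z + e)) + - b = (a * e - b * c) * z / (c * z + e)"
      using False by (simp add: field_simps)
    have "moebius e (- b) (- c) a (moebius a b c e p) = Plane ((a * e - b * c) * z / (c * z + e) / ((a * e - b * c) / (c * z + e)))"
      using False assms unfolding Plane moebius_Plane[of a] if_not_P[OF False] moebius_Plane 1 2 by simp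
    also have "(a * e - b * c) * z / (c * z + e) / ((a * e - b * c) / (c * z + e)) = z"
      using False assms by simp
    finally show ?thesis by (simp add: Plane)
  qed
next
  case Infty
  have ac: "a \<noteq> 0 \<or> c \<noteq> 0" using assms by auto
  show ?thesis
  proof (cases "c = 0")
    case True
    then show ?thesis using Infty ac assms by (simp add: moebius_Infty)
  next
    case False
    then show ?thesis using Infty by (simp add: moebius_Infty moebius_Plane)
  qed
qed

text \<open>After normalisation each function or its reciprocal is bounded by 1 at the centre, and
  both omit 0 and 1. Schottky's theorem, in the form \<open>GPicard1\<close>, then bounds them near
  \<open>a\<close>, and Montel's theorem applies to a subsequence on which the same alternative
  holds throughout.\<close>

lemma omitting_three_values_normal:
  fixes F :: "(riemann_sphere \<Rightarrow> riemann_sphere) set"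
  assumes F: "\<And>h. h \<in> F \<Longrightarrow> hol_map h" and e: "e > 0"
    and \<alpha>\<beta>\<gamma>: "\<alpha> \<noteq> \<beta>" "\<beta> \<noteq> \<gamma>" "\<alpha> \<noteq> \<gamma>"
    and omit: "\<And>h z. h \<in> F \<Longrightarrow> z \<in> ball a e \<Longrightarrow> h (crd b z) \<notin> {Plane \<alpha>, Plane \<beta>, Plane \<gamma>}"
  shows "\<exists>e'>0. normal_family_on F (crd b ` ball a e')"
proof -
  have det: "(\<beta> - \<gamma>) * (- \<gamma> * (\<beta> - \<alpha>)) - (- \<alpha> * (\<beta> - \<gamma>)) * (\<beta> - \<alpha>) \<noteq> 0"
  proof -
    have "(\<beta> - \<gamma>) * (- \<gamma> * (\<beta> - \<alpha>)) - (- \<alpha> * (\<beta> - \<gamma>)) * (\<beta> - \<alpha>) = (\<beta> - \<gamma>) * (\<beta> - \<alpha>) * (\<alpha> - \<gamma>)" by algebra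
    then show ?thesis using \<alpha>\<beta>\<gamma> by simp
  qed
  \<comment> \<open>The cross ratio that sends \<open>\<alpha>\<close>, \<open>\<beta>\<close>,
    \<open>\<gamma>\<close> to 0, 1 and infinity. The Lipschitz bound of its inverse
    \<open>N\<close> carries uniform convergence back.\<close>
  define M where "M = moebius (\<beta> - \<gamma>) (- \<alpha> * (\<beta> - \<gamma>)) (\<beta> - \<alpha>) (- \<gamma> * (\<beta> - \<alpha>))"
  define N where "N = moebius (- \<gamma> * (\<beta> - \<alpha>)) (- (- \<alpha> * (\<beta> - \<gamma>))) (- (\<beta> - \<alpha>)) (\<beta> - \<gamma>)"
  have NM: "N (M p) = p" for p unfolding M_def N_def by (rule moebius_inverse[OF det])
  interpret M: hol_map M unfolding M_def by (rule hol_map_moebius[OF det])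
  have "hol_map N" unfolding N_def
  proof (rule hol_map_moebius)
    show "- \<gamma> * (\<beta> - \<alpha>) * (\<beta> - \<gamma>) - - (- \<alpha> * (\<beta> - \<gamma>)) * - (\<beta> - \<alpha>) \<noteq> 0"
    proof -
      have eq: "- \<gamma> * (\<beta> - \<alpha>) * (\<beta> - \<gamma>) - - (- \<alpha> * (\<beta> - \<gamma>)) * - (\<beta> - \<alpha>) =
          (\<beta> - \<gamma>) * (- \<gamma> * (\<beta> - \<alpha>)) - (- \<alpha> * (\<beta> - \<gamma>)) * (\<beta> - \<alpha>)" by algebra
      show ?thesis unfolding eq by (rule det)
    qed
  qed
  then obtain L where L: "L \<ge> 2" "\<And>p q. dist (N p) (N q) \<le> L * dist p q" using hol_map.Lipschitz by blast
  have M0: "M (Plane \<alpha>) = Plane 0" "M (Plane \<beta>) = Plane 1" "M (Plane \<gamma>) = Infty"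
  proof -
    have "(\<beta> - \<alpha>) * z + - \<gamma> * (\<beta> - \<alpha>) = (\<beta> - \<alpha>) * (z - \<gamma>)" "(\<beta> - \<gamma>) * z + - \<alpha> * (\<beta> - \<gamma>) = (\<beta> - \<gamma>) * (z - \<alpha>)" for z
      by algebra+
    then show "M (Plane \<alpha>) = Plane 0" "M (Plane \<beta>) = Plane 1" "M (Plane \<gamma>) = Infty"
      unfolding M_def moebius_Plane using \<alpha>\<beta>\<gamma> by auto
  qed
  have Mh: "M (h (crd b z)) \<noteq> Plane 0" "M (h (crd b z)) \<noteq> Plane 1" "M (h (crd b z)) \<noteq> Infty"
    if "h \<in> F" "z \<in> ball a e" for h z
    using omit[OF that] NM M0 by (metis insertCI)+
  \<comment> \<open>The normalised function read in the chart \<open>\<sigma>\<close>: itself or its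
    reciprocal.\<close>
  define T where "T \<sigma> h z = (let w = icrd True (M (h (crd b z))) in if \<sigma> then w else inverse w)"
    for \<sigma> and h :: "riemann_sphere \<Rightarrow> riemann_sphere" and z
  have T: "T \<sigma> h z \<noteq> 0" "T \<sigma> h z \<noteq> 1" "crd \<sigma> (T \<sigma> h z) = M (h (crd b z))" if hz: "h \<in> F" "z \<in> ball a e" for \<sigma> h z
  proof -
    obtain w where w: "M (h (crd b z)) = Plane w" "w \<noteq> 0" "w \<noteq> 1"
      using Mh[OF hz] by (metis riemann_sphere.exhaust)
    then show "T \<sigma> h z \<noteq> 0" "T \<sigma> h z \<noteq> 1" by (auto simp: T_def icrd_def)
    show "crd \<sigma> (T \<sigma> h z) = M (h (crd b z))"
      using w by (auto simp: T_def icrd_def crd_def sphere_inversion_def inverse_eq_divide)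
  qed
  have Thol: "T \<sigma> h holomorphic_on ball a e" if h: "h \<in> F" for \<sigma> h
  proof -
    interpret h: hol_map h by (rule F[OF h])
    have "(\<lambda>z. icrd True (M (h (crd b z)))) holomorphic_on ball a e"
    proof (rule sph_hol_icrd[OF open_ball])
      show "sph_hol (\<lambda>z. M (h (crd b z))) z" for z
        using sph_hol_compose[OF h.hol[of b z] M.hol] by (simp add: o_def)
      show "M (h (crd b z)) \<noteq> pole True" if "z \<in> ball a e" for z using Mh(3)[OF h that] by (simp add: pole_def)
    qed
    then have T1: "T True h holomorphic_on ball a e" by (simp add: T_def[abs_def])
    moreover have "T False h = (\<lambda>z. inverse (T True h z))" by (simp add: T_def fun_eq_iff)
    then have "T False h holomorphic_on ball a e"
      using holomorphic_on_inverse[OF T1] T(1)[OF h] by simp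
    ultimately show ?thesis by (cases \<sigma>) auto
  qed
  define W where "W = {h. h holomorphic_on ball a e \<and> (\<forall>z\<in>ball a e. h z \<noteq> 0 \<and> h z \<noteq> 1)}"
  define Y where "Y = {h \<in> W. norm (h a) \<le> 1}"
  obtain B Z where BZ: "0 < B" "open Z" "a \<in> Z" "Z \<subseteq> ball a e" "\<And>h z. h \<in> Y \<Longrightarrow> z \<in> Z \<Longrightarrow> norm (h z) \<le> B"
  proof (rule GPicard1[of "ball a e" a 1 Y W])
    show "Y \<subseteq> W" by (simp add: Y_def)
  qed (use e in \<open>auto simp: W_def Y_def\<close>)
  obtain e' where e': "e' > 0" "ball a e' \<subseteq> Z" using BZ(2,3) open_contains_ball by blast
  have "normal_family_on F (crd b ` ball a e')"
    unfolding normal_family_on_def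
  proof (intro allI impI)
    fix g :: "nat \<Rightarrow> riemann_sphere \<Rightarrow> riemann_sphere"
    assume g: "\<forall>n. g n \<in> F"
    have TW: "T \<sigma> (g n) \<in> W" for \<sigma> n using Thol T(1,2) g by (auto simp: W_def)
    define I where "I \<sigma> = {n. norm (T \<sigma> (g n) a) \<le> 1}" for \<sigma>
    have "I True \<union> I False = UNIV"
    proof (intro set_eqI iffI UNIV_I)
      fix n
      have "norm (T True (g n) a) \<le> 1 \<or> norm (T False (g n) a) \<le> 1"
        by (auto simp: T_def Let_def norm_inverse intro: inverse_le_1_iff[THEN iffD2])
      then show "n \<in> I True \<union> I False" by (auto simp: I_def)
    qed
    then have "infinite (I True \<union> I False)" by simp
    then obtain \<sigma> where inf: "infinite (I \<sigma>)" by blast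
    define r0 where "r0 = enumerate (I \<sigma>)"
    have r0: "strict_mono r0" "\<And>n. r0 n \<in> I \<sigma>"
      unfolding r0_def using strict_mono_enumerate[OF inf] enumerate_in_set[OF inf] by auto
    define H where "H n = T \<sigma> (g (r0 n))" for n
    have HY: "H n \<in> Y" for n using TW r0(2)[of n] by (simp add: H_def Y_def I_def)
    obtain k r1 where k: "k holomorphic_on ball a e'" "strict_mono (r1 :: nat \<Rightarrow> nat)"
      "\<And>x. x \<in> ball a e' \<Longrightarrow> (\<lambda>n. H (r1 n) x) \<longlonglongrightarrow> k x"
      "\<And>K. compact K \<Longrightarrow> K \<subseteq> ball a e' \<Longrightarrow> uniform_limit K (H \<circ> r1) k sequentially"
    proof (rule Montel[of "ball a e'" Y H])
      show "h holomorphic_on ball a e'" if "h \<in> Y" for h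
        using that e'(2) BZ(4) holomorphic_on_subset by (auto simp: Y_def W_def)
      show "\<exists>B. \<forall>h\<in>Y. \<forall>z\<in>K. norm (h z) \<le> B" if "K \<subseteq> ball a e'" for K
        using BZ(5) e'(2) that by blast
    qed (use HY in auto)
    define l where "l q = N (crd \<sigma> (k (icrd b q)))" for q
    show "\<exists>r l. strict_mono (r :: nat \<Rightarrow> nat) \<and>
           (\<forall>K. compact K \<and> K \<subseteq> crd b ` ball a e' \<longrightarrow> uniform_limit K (g \<circ> r) l sequentially)"
    proof (intro exI[of _ "r0 \<circ> r1"] exI[of _ l] conjI allI impI)
      show "strict_mono (r0 \<circ> r1)" using r0(1) k(2) by (rule strict_mono_o)
      fix K assume K: "compact K \<and> K \<subseteq> crd b ` ball a e'"
      have "q \<noteq> pole b" if "q \<in> K" for q using K that range_crd by blast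
      then have "continuous_on K (icrd b)"
        by (intro continuous_at_imp_continuous_on ballI isCont_icrd)
      then have cK: "compact (icrd b ` K)" using K compact_continuous_image by blast
      have sK: "icrd b ` K \<subseteq> ball a e'" using K by auto
      have u: "uniform_limit (icrd b ` K) (H \<circ> r1) k sequentially" by (rule k(4)[OF cK sK])
      show "uniform_limit K (g \<circ> (r0 \<circ> r1)) l sequentially"
      proof (rule uniform_limitI)
        fix \<epsilon> :: real assume \<epsilon>: "\<epsilon> > 0"
        then have "\<epsilon> / (4 * L) > 0" using L(1) by simp
        from uniform_limitD[OF u this]
        show "\<forall>\<^sub>F n in sequentially. \<forall>q\<in>K. dist ((g \<circ> (r0 \<circ> r1)) n q) (l q) < \<epsilon>"
        proof (rule eventually_mono)
          fix n assume n: "\<forall>z\<in>icrd b ` K. dist ((H \<circ> r1) n z) (k z) < \<epsilon> / (4 * L)"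
          show "\<forall>q\<in>K. dist ((g \<circ> (r0 \<circ> r1)) n q) (l q) < \<epsilon>"
          proof
            fix q assume q: "q \<in> K"
            then obtain z where z: "q = crd b z" "z \<in> ball a e'" using K by blast
            have ze: "z \<in> ball a e" using z(2) e'(2) BZ(4) by blast
            have gF: "g (r0 (r1 n)) \<in> F" using g by blast
            have "g (r0 (r1 n)) q = N (crd \<sigma> (H (r1 n) z))" using T(3)[OF gF ze] NM z(1) by (simp add: H_def)
            then have "dist (g (r0 (r1 n)) q) (l q) \<le> L * dist (crd \<sigma> (H (r1 n) z)) (crd \<sigma> (k z))"
              using L(2) z(1) by (simp add: l_def)
            also have "\<dots> \<le> L * (4 * cmod (H (r1 n) z - k z))"
              using L(1) by (intro mult_left_mono dist_crd_le) auto
            also have "\<dots> < L * (4 * (\<epsilon> / (4 * L)))"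
              using n q z(1) L(1) by (intro mult_strict_left_mono) (force simp: dist_norm)+
            also have "\<dots> = \<epsilon>" using L(1) by simp
            finally show "dist ((g \<circ> (r0 \<circ> r1)) n q) (l q) < \<epsilon>" by simp
          qed
        qed
      qed
    qed
  qed
  then show ?thesis using e'(1) by blast
qed

context mix begin

lemma ex_three_X: "\<exists>\<alpha> \<beta> \<gamma>. \<alpha> \<noteq> \<beta> \<and> \<beta> \<noteq> \<gamma> \<and> \<alpha> \<noteq> \<gamma> \<and> {Plane \<alpha>, Plane \<beta>, Plane \<gamma>} \<subseteq> X"
proof -
  have "measure \<nu> UNIV = 1" using nu.prob_space by simp
  then obtain x where x: "x \<in> X" using X_nonempty_Int[OF compact_sphere] by auto
  have ex: "\<exists>\<alpha>. Plane \<alpha> \<in> X \<and> \<alpha> \<notin> S" if S: "finite S" for S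
  proof -
    have "finite (insert Infty (Plane ` S))" using S by simp
    then obtain y where y: "y \<in> X" "y \<notin> insert Infty (Plane ` S)"
      by (rule X_avoid_finite[OF open_UNIV UNIV_I x])
    then show ?thesis by (cases y) auto
  qed
  obtain \<alpha> where "Plane \<alpha> \<in> X" using ex[of "{}"] by auto
  moreover obtain \<beta> where "Plane \<beta> \<in> X" "\<beta> \<noteq> \<alpha>" using ex[of "{\<alpha>}"] by auto
  moreover obtain \<gamma> where "Plane \<gamma> \<in> X" "\<gamma> \<noteq> \<alpha>" "\<gamma> \<noteq> \<beta>" using ex[of "{\<alpha>, \<beta>}"] by auto
  ultimately show ?thesis by (intro exI[of _ \<alpha>] exI[of _ \<beta>] exI[of _ \<gamma>]) auto
qed

lemma julia_subset_X: "julia_set f \<subseteq> X"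
proof
  fix x assume x: "x \<in> julia_set f"
  show "x \<in> X"
  proof (rule ccontr)
    assume "x \<notin> X"
    then obtain r where r: "r > 0" "\<not> measure \<mu> (ball x r) > 0" by (auto simp: X_def)
    then have null: "measure \<mu> (ball x r) = 0" using measure_nonneg[of \<mu> "ball x r"] by linarith
    have miss: "(f ^^ n) ` ball x r \<inter> X = {}" for n
      by (rule null_misses_X[OF open_map_funpow[OF open_ball] null_image[OF open_ball null]])
    obtain b a where a: "x = crd b a" "cmod a \<le> 1" by (rule hemisphere)
    obtain \<alpha> \<beta> \<gamma> where t: "\<alpha> \<noteq> \<beta>" "\<beta> \<noteq> \<gamma>" "\<alpha> \<noteq> \<gamma>" "{Plane \<alpha>, Plane \<beta>, Plane \<gamma>} \<subseteq> X"
      using ex_three_X by blast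
    have "\<exists>e'>0. normal_family_on (range (\<lambda>n. f ^^ n)) (crd b ` ball a e')"
    proof (rule omitting_three_values_normal[OF _ _ t(1-3)])
      show "hol_map h" if "h \<in> range (\<lambda>n. f ^^ n)" for h using that iter.hol_map_axioms by auto
      show "r / 4 > 0" using r by simp
      show "h (crd b z) \<notin> {Plane \<alpha>, Plane \<beta>, Plane \<gamma>}" if h: "h \<in> range (\<lambda>n. f ^^ n)" and z: "z \<in> ball a (r / 4)" for h z
      proof -
        obtain n where n: "h = f ^^ n" using h by blast
        have "dist (crd b a) (crd b z) \<le> 4 * cmod (a - z)" by (rule dist_crd_le)
        then have "crd b z \<in> ball x r" using z a(1) by (simp add: dist_norm)
        then have "h (crd b z) \<notin> X" using miss[of n] n by blast
        then show ?thesis using t(4) by blast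
      qed
    qed
    then obtain e' where "e' > 0" "normal_family_on (range (\<lambda>n. f ^^ n)) (crd b ` ball a e')" by blast
    then have "x \<in> fatou_set f"
      unfolding fatou_set_def using open_crd_image[OF open_ball] a(1)
      by (auto intro!: exI[of _ "crd b ` ball a e'"])
    then show False using x by (simp add: julia_set_def)
  qed
qed

end

section \<open>From the stated hypotheses to their working form\<close>

lemma lip_norm_le:
  assumes "julia_set f \<noteq> {}" "\<And>x. 0 \<le> \<psi> x \<and> \<psi> x \<le> 1" "K-lipschitz_on UNIV \<psi>"
  shows "lip_norm f \<psi> \<le> (1 + \<bar>Sup ({} :: real set)\<bar>) * (1 + K)"
proof -
  let ?P = "{(z, z'). z \<in> julia_set f \<and> z' \<in> julia_set f \<and> z \<noteq> z'}"
  let ?s = "\<bar>Sup ({} :: real set)\<bar>"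
  have K: "K \<ge> 0" using assms(3) by (rule lipschitz_on_nonneg)
  have 1: "(SUP z\<in>julia_set f. \<bar>\<psi> z\<bar>) \<le> 1" by (rule cSUP_least) (use assms(1,2) in auto)
  have 2: "(SUP (z, z')\<in>?P. \<bar>\<psi> z - \<psi> z'\<bar> / dist z z') \<le> K + ?s"
  \<comment> \<open>If the Julia set is a single point, there are no pairs and the supremum is the
    unspecified \<open>Sup {}\<close>; adding its modulus to the constant covers this case.\<close>
  proof (cases "?P = {}")
    case True
    show ?thesis unfolding True using K by simp
  next
    case False
    have "(SUP (z, z')\<in>?P. \<bar>\<psi> z - \<psi> z'\<bar> / dist z z') \<le> K"
    proof (rule cSUP_least[OF False], clarify)
      fix z z' :: riemann_sphere assume "z \<noteq> z'"
      then have "dist z z' > 0" by simp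
      moreover have "\<bar>\<psi> z - \<psi> z'\<bar> \<le> K * dist z z'"
        using lipschitz_onD[OF assms(3), of z z'] by (simp add: dist_real_def)
      ultimately show "\<bar>\<psi> z - \<psi> z'\<bar> / dist z z' \<le> K" by (simp add: pos_divide_le_eq)
    qed
    then show ?thesis by simp
  qed
  have "?s * K \<ge> 0" using K by simp
  then show ?thesis using 1 2 unfolding lip_norm_def by (simp add: algebra_simps)
qed

text \<open>Indicators have supremum at most 1, and a function with values in [0,1] and Lipschitz
  constant \<open>K\<close> has norm at most a fixed multiple of \<open>1 + K\<close>; the multiple
  goes into the constant.\<close>

lemma mixing_indicator:
  assumes "exponentially_mixing f \<nu>" "julia_set f \<noteq> {}" "sets \<nu> = sets borel"
  shows "\<exists>C>0. \<exists>\<rho>. 0 < \<rho> \<and> \<rho> < 1 \<and> (\<forall>A \<psi> K n. A \<in> sets borel \<longrightarrow> (\<forall>x. 0 \<le> \<psi> x \<and> \<psi> x \<le> 1) \<longrightarrow>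
    K-lipschitz_on UNIV \<psi> \<longrightarrow> n \<ge> 1 \<longrightarrow>
        \<bar>(\<integral>x. indicator A ((f ^^ n) x) * \<psi> x \<partial>\<nu>) - measure \<nu> A * (\<integral>x. \<psi> x \<partial>\<nu>)\<bar> \<le> C * (1 + K) * \<rho> ^ n)"
proof -
  obtain C \<rho> where C: "C > 0" and \<rho>: "0 < \<rho>" "\<rho> < 1"
    and mix: "\<And>\<phi> \<psi> n. \<phi> \<in> borel_measurable borel \<Longrightarrow> bounded (range \<phi>) \<Longrightarrow> \<exists>L. L-lipschitz_on UNIV \<psi> \<Longrightarrow> n \<ge> 1 \<Longrightarrow>
          \<bar>(\<integral>x. \<phi> ((f ^^ n) x) * \<psi> x \<partial>\<nu>) - (\<integral>x. \<phi> x \<partial>\<nu>) * (\<integral>x. \<psi> x \<partial>\<nu>)\<bar>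
            \<le> C * (SUP z\<in>julia_set f. \<bar>\<phi> z\<bar>) * lip_norm f \<psi> * \<rho> ^ n"
    using assms(1) unfolding exponentially_mixing_def by blast
  let ?s = "1 + \<bar>Sup ({} :: real set)\<bar>"
  have bound: "\<bar>(\<integral>x. indicator A ((f ^^ n) x) * \<psi> x \<partial>\<nu>) - measure \<nu> A * (\<integral>x. \<psi> x \<partial>\<nu>)\<bar> \<le> C * ?s * (1 + K) * \<rho> ^ n"
    if A: "A \<in> sets borel" and \<psi>: "\<forall>x. 0 \<le> \<psi> x \<and> \<psi> x \<le> 1" "K-lipschitz_on UNIV \<psi>" and n: "n \<ge> 1" for A \<psi> K n
  proof -
    let ?S = "SUP z\<in>julia_set f. \<bar>indicator A z :: real\<bar>"
    have K: "K \<ge> 0" using \<psi>(2) by (rule lipschitz_on_nonneg)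
    have S1: "?S \<le> 1" by (rule cSUP_least[OF assms(2)]) (simp add: indicator_def)
    obtain z where z: "z \<in> julia_set f" using assms(2) by blast
    have "bdd_above ((\<lambda>z. \<bar>indicator A z :: real\<bar>) ` julia_set f)" by (intro bdd_aboveI[of _ 1]) (auto simp: indicator_def)
    then have "\<bar>indicator A z\<bar> \<le> ?S" by (rule cSUP_upper[OF z])
    then have S0: "?S \<ge> 0" by linarith
    have "?S * lip_norm f \<psi> \<le> ?S * (?s * (1 + K))"
      using lip_norm_le[OF assms(2)] \<psi> S0 by (intro mult_left_mono) auto
    also have "\<dots> \<le> 1 * (?s * (1 + K))" using S1 K by (intro mult_right_mono) auto
    finally have le: "?S * lip_norm f \<psi> \<le> ?s * (1 + K)" by simp
    have "\<bar>(\<integral>x. indicator A ((f ^^ n) x) * \<psi> x \<partial>\<nu>) - (\<integral>x. indicator A x \<partial>\<nu>) * (\<integral>x. \<psi> x \<partial>\<nu>)\<bar>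
        \<le> C * ?S * lip_norm f \<psi> * \<rho> ^ n"
    proof (rule mix)
      show "(indicator A :: riemann_sphere \<Rightarrow> real) \<in> borel_measurable borel" using A by simp
      show "bounded (range (indicator A :: riemann_sphere \<Rightarrow> real))" by (rule boundedI[of _ 1]) (auto simp: indicator_def)
    qed (use \<psi> n in auto)
    also have "\<dots> = C * (?S * lip_norm f \<psi>) * \<rho> ^ n" by (simp only: mult_ac)
    also have "\<dots> \<le> C * (?s * (1 + K)) * \<rho> ^ n"
      using le C \<rho> by (intro mult_right_mono mult_left_mono) auto
    finally show ?thesis using A assms(3) by (simp add: mult.assoc sets_eq_imp_space_eq[OF assms(3)])
  qed
  have "C * ?s > 0" using C by (intro mult_pos_pos) auto
  then show ?thesis using \<rho> bound by blast
qed

theorem theoremD: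
  fixes f :: "riemann_sphere \<Rightarrow> riemann_sphere"
    and d :: nat
    and \<mu> \<nu> :: "riemann_sphere measure"
    and c :: real
  assumes "rational_map_of_degree d f" and "d \<ge> 2"
    and "invariant_probability f \<nu>"
    and "exponentially_mixing f \<nu>"
    and "conformal_measure f \<mu>"
    and "absolutely_continuous \<mu> \<nu>"
    and "c > 0" and "AE x in \<mu>. ennreal c \<le> RN_deriv \<mu> \<nu> x"
  shows "topological_collet_eckmann f"
\<comment> \<open>For an empty Julia set the condition is vacuous; otherwise the suprema of single
  values in the mixing bound range over a nonempty set.\<close>
proof (cases "julia_set f = {}")
  case True
  show ?thesis unfolding topological_collet_eckmann_def True
    by (rule exI[of _ 2], simp, rule exI[of _ 1], simp)
next
  case False
  have nu: "sets \<nu> = sets borel" "prob_space \<nu>" "distr \<nu> \<nu> f = \<nu>"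
    using assms(3) by (auto simp: invariant_probability_def)
  obtain t where mu: "sets \<mu> = sets borel" "finite_measure \<mu>" "t > 0"
    "\<forall>U\<in>sets borel. inj_on f U \<longrightarrow> emeasure \<mu> (f ` U) = (\<integral>\<^sup>+x\<in>U. ennreal (spherical_deriv f x powr t) \<partial>\<mu>)"
    using assms(5) by (auto simp: conformal_measure_def)
  interpret mu: finite_measure \<mu> by fact
  have density: "density \<mu> (RN_deriv \<mu> \<nu>) = \<nu>" by (rule mu.density_RN_deriv[OF assms(6)]) (simp add: nu mu)
  have dens: "ennreal c * emeasure \<mu> A \<le> emeasure \<nu> A" if A: "A \<in> sets borel" for A
  proof -
    have A': "A \<in> sets \<mu>" using A mu(1) by simp
    have "ennreal c * emeasure \<mu> A = (\<integral>\<^sup>+x. ennreal c * indicator A x \<partial>\<mu>)"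
      using A' by (simp add: nn_integral_cmult_indicator)
    also have "\<dots> \<le> (\<integral>\<^sup>+x. RN_deriv \<mu> \<nu> x * indicator A x \<partial>\<mu>)"
      by (rule nn_integral_mono_AE) (use assms(8) in \<open>auto elim!: eventually_mono intro!: mult_right_mono\<close>)
    also have "\<dots> = emeasure (density \<mu> (RN_deriv \<mu> \<nu>)) A" using A' by (simp add: emeasure_density)
    finally show ?thesis by (simp add: density)
  qed
  have ac: "emeasure \<nu> A = 0" if A: "A \<in> sets borel" "emeasure \<mu> A = 0" for A
  proof -
    have "A \<in> null_sets \<mu>" using A mu(1) by (simp add: null_sets_def)
    then show ?thesis using assms(6) by (auto simp: absolutely_continuous_def)
  qed
  obtain C \<rho> where C: "C > 0" and \<rho>: "0 < \<rho>" "\<rho> < 1"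
    and mix: "\<forall>A \<psi> K n. A \<in> sets borel \<longrightarrow> (\<forall>x. 0 \<le> \<psi> x \<and> \<psi> x \<le> 1) \<longrightarrow> K-lipschitz_on UNIV \<psi> \<longrightarrow> n \<ge> 1 \<longrightarrow>
        \<bar>(\<integral>x. indicator A ((f ^^ n) x) * \<psi> x \<partial>\<nu>) - measure \<nu> A * (\<integral>x. \<psi> x \<partial>\<nu>)\<bar> \<le> C * (1 + K) * \<rho> ^ n"
    using mixing_indicator[OF assms(4) False nu(1)] by (elim exE conjE)
  interpret mix f d \<mu> t \<nu> c C \<rho>
  proof (intro mix.intro mix_axioms.intro conf.intro conf_axioms.intro rat.intro rat_axioms.intro nonconst_rat.intro)
    show "d \<ge> 1" using assms(2) by simp
  qed (fact assms(1,2,7) nu mu(1,2,3) C \<rho> | rule ac dens; assumption | rule mu(4)[rule_format]; assumption | rule mix[rule_format]; simp)+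
  show ?thesis
    unfolding topological_collet_eckmann_def using exponential_shrinking_components julia_subset_X by blast
qed

end
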